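(* Let $\mathcal P=\mathcal P(\mathcal E,\mathcal R)$ be a quadratic contractad, weight-graded with respect to its generators, with finite-dimensional weight components $\mathcal P^{(r)}(\Gamma)$ and $(\mathcal P^!)^{(r)}(\Gamma)$. If $\mathcal P$ is Koszul, then $$\chi^{\mathrm w}_{-q}(\mathcal P^!)*\chi^{\mathrm w}_q(\mathcal P)=\chi(\mathbb 1)=\varepsilon.$$ In particular, if $\mathcal P$ is generated by binary operations (i.e. $\mathcal E$ is concentrated in the component $\mathsf P_2$), then $$\chi_{-1}(\mathcal P^!)*\chi(\mathcal P)=\varepsilon,$$ where $\chi_{-1}(\mathcal P^!)(\Gamma)=(-1)^{|V_\Gamma|-1}\dim\mathcal P^!(\Gamma)$.
   Context: Graphs are finite, simple, undirected. A tube of $\Gamma$ is a non-empty $G\subset V_\Gamma$ with $\Gamma|_G$ connected. A partition $I\vdash\Gamma$ is a set partition of $V_\Gamma$ into tubes; $\Gamma/I$ has the blocks as vertices, two distinct blocks adjacent iff their union is a tube. $\mathsf P_n$ is the path on $n$ vertices. A graphical collection is a contravariant functor from the groupoid of non-empty connected graphs to (graded) vector spaces; contraction product $(\mathcal P\circ\mathcal Q)(\Gamma)=\bigoplus_{I\vdash\Gamma}\mathcal P(\Gamma/I)\otimes\bigotimes_{G\in I}\mathcal Q(\Gamma|_G)$ with unit $\mathbb 1$ (one-dimensional on $\mathsf P_1$, zero elsewhere). A contractad is a monoid for $\circ$, a cocontractad a comonoid. The free contractad is $\mathbb T(\mathcal E)(\Gamma)=\bigoplus_T\bigotimes_v\mathcal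 E(\mathrm{In}(v))$ over rooted trees $T$ with leaves labelled by $V_\Gamma$ such that the leaves above each edge form a tube; $\mathrm{In}(v)$ is the graph on incoming edges of $v$, two adjacent iff the union of their leaf sets is a tube. It is weight-graded by the number of vertices of $T$ ($\mathcal E$ has weight 1). $\mathcal P(\mathcal E,\mathcal R)=\mathbb T(\mathcal E)/\langle\mathcal R\rangle$ with $\mathcal R$ in weight 2 is a quadratic contractad, which inherits the weight grading. $\mathcal P^{\text{!`}}$ is the quadratic cocontractad with cogenerators $s\mathcal E$ and corelations $s^2\mathcal R$ ($s$ the homological shift); $\mathcal P^!:=\mathcal S^{-1}(\mathcal P^{\text{!`}})^*$, where $\mathcal S^{-1}$ is componentwise tensor product with the one-dimensional $\mathrm{Hom}((\mathsf ks^{-1})^{\otimes V_\Gamma},\mathsf ks^{-1})$. Both are weight-graded and $\dim(\mathcal P^!)^{(r)}(\Gamma)=\dim(\mathcal P^{\text{!`}})^{(r)}(\Gamma)$. The Koszul complex is $\mathcal P^{\text{!`}}\circ\mathcal P$ with differential obtained by splitting off one cogenerator of $\mathcal P^{\text{!`}}$ by the infinitesimal decomposition, desuspending it and composing it into $\mathcal P$; $\mathcal P$ is Koszul if this complex is quasi-isomorphic to $\mathbb 1$. A graphic function is a function on connected graphs, constant on isomorphism classes, with values in a commutative ring. $(\phi*\psi)(\Gamma)=\sum_{I\vdash\Gamma}\phi(\Gamma/I)\prod_{G\in I}\psi(\Gamma|_G)$; the unit is $\varepsilon$, with $\varepsilon(\mathsf P_1)=1$ and $\varepsilon(\Gamma)=0$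 otherwise. $\chi(\mathcal P)(\Gamma)=\dim\mathcal P(\Gamma)$ and $\chi^{\mathrm w}_q(\mathcal P)(\Gamma)=\sum_r\dim\mathcal P^{(r)}(\Gamma)\,q^r$ (weight $r$). *)

theory Defs
  imports
    "HOL-Library.Function_Algebras"
    "HOL-Library.Disjoint_Sets"
    "HOL-Combinatorics.Permutations"
    "HOL-Computational_Algebra.Formal_Power_Series"
begin

section \<open>Graphs, tubes, contractions\<close>

text \<open>
  A graph is a pair of a vertex set and a set of two-element vertex sets. Vertices are natural
  numbers, so that a block of a partition can be named by its least element. With this naming the
  canonical isomorphisms between iterated contractions and restrictions are equalities.
\<close>

type_synonym graph = "nat set \<times> nat set set"

abbreviation verts :: "graph \<Rightarrow> nat set" where "verts \<equiv> fst"
abbreviation edges :: "graph \<Rightarrow> nat set set" where "edges \<equiv> snd"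

definition simple_graph :: "graph \<Rightarrow> bool" where
  "simple_graph \<Gamma> \<longleftrightarrow> finite (verts \<Gamma>) \<and> (\<forall>e\<in>edges \<Gamma>. e \<subseteq> verts \<Gamma> \<and> card e = 2)"

definition connected_in :: "graph \<Rightarrow> nat set \<Rightarrow> bool" where
  "connected_in \<Gamma> G \<longleftrightarrow>
    (\<forall>u\<in>G. \<forall>v\<in>G. (u, v) \<in> {(a, b). a \<in> G \<and> b \<in> G \<and> {a, b} \<in> edges \<Gamma>}\<^sup>*)"

definition tube :: "graph \<Rightarrow> nat set \<Rightarrow> bool" where
  "tube \<Gamma> G \<longleftrightarrow> G \<noteq> {} \<and> G \<subseteq> verts \<Gamma> \<and> connected_in \<Gamma> G"

definition connected_graphs :: "graph set" where
  "connected_graphs = {\<Gamma>. simple_graph \<Gamma> \<and> tube \<Gamma> (verts \<Gamma>)}"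

definition induced :: "graph \<Rightarrow> nat set \<Rightarrow> graph" where
  "induced \<Gamma> G = (G, {e \<in> edges \<Gamma>. e \<subseteq> G})"

definition graph_partitions :: "graph \<Rightarrow> nat set set set" where
  "graph_partitions \<Gamma> = {I. partition_on (verts \<Gamma>) I \<and> (\<forall>G\<in>I. tube \<Gamma> G)}"

text \<open>
  The family \<open>J\<close> consists of disjoint tubes. It is a partition of all vertices in \<open>\<Gamma>/I\<close>, and a
  partition of a tube in the graph of incoming edges of a vertex of a tree.
\<close>

definition contract :: "graph \<Rightarrow> nat set set \<Rightarrow> graph" where
  "contract \<Gamma> J =
    (Min ` J, {{Min G, Min H} | G H. G \<in> J \<and> H \<in> J \<and> G \<noteq> H \<and> tube \<Gamma> (G \<union> H)})"

definition map_graph :: "(nat \<Rightarrow> nat) \<Rightarrow> graph \<Rightarrow> graph" where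
  "map_graph f \<Gamma> = (f ` verts \<Gamma>, (\<lambda>e. f ` e) ` edges \<Gamma>)"


section \<open>Graphic functions\<close>

definition graphic_conv ::
    "(graph \<Rightarrow> 'a::comm_ring_1) \<Rightarrow> (graph \<Rightarrow> 'a) \<Rightarrow> graph \<Rightarrow> 'a" where
  "graphic_conv \<phi> \<psi> \<Gamma> =
    (\<Sum>I\<in>graph_partitions \<Gamma>. \<phi> (contract \<Gamma> I) * (\<Prod>G\<in>I. \<psi> (induced \<Gamma> G)))"

definition graphic_unit :: "graph \<Rightarrow> 'a::comm_ring_1" where
  "graphic_unit \<Gamma> = (if card (verts \<Gamma>) = 1 then 1 else 0)"


section \<open>Linear algebra\<close>

text \<open>Free vector spaces and their duals are spaces of functions with the pointwise structure.\<close>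

definition fscale :: "'k::field \<Rightarrow> ('x \<Rightarrow> 'k) \<Rightarrow> 'x \<Rightarrow> 'k" where
  "fscale c x = (\<lambda>t. c * x t)"

definition some_basis :: "('k::field \<Rightarrow> 'e \<Rightarrow> 'e) \<Rightarrow> 'e::ab_group_add set \<Rightarrow> 'e set" where
  "some_basis sc V =
    (SOME B. B \<subseteq> V \<and> \<not> module.dependent sc B \<and> module.span sc B = V)"

definition finite_dim :: "('x \<Rightarrow> 'k::field) set \<Rightarrow> bool" where
  "finite_dim V \<longleftrightarrow> (\<exists>B. finite B \<and> V \<subseteq> module.span fscale B)"

text \<open>\<open>S\<close> is a set of representatives of a basis of the quotient of \<open>A\<close> by its subspace \<open>B\<close>.\<close>

definition quot_basis :: "('x \<Rightarrow> 'k::field) set \<Rightarrow> ('x \<Rightarrow> 'k) set \<Rightarrow> ('x \<Rightarrow> 'k) set \<Rightarrow> bool" where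
  "quot_basis A B S \<longleftrightarrow> S \<subseteq> A \<and> A \<subseteq> module.span fscale (S \<union> B) \<and>
    (\<forall>s\<in>S. s \<notin> module.span fscale ((S - {s}) \<union> B))"

definition quot_finite_dim :: "('x \<Rightarrow> 'k::field) set \<Rightarrow> ('x \<Rightarrow> 'k) set \<Rightarrow> bool" where
  "quot_finite_dim A B \<longleftrightarrow> (\<exists>S. finite S \<and> quot_basis A B S)"

definition quot_dim :: "('x \<Rightarrow> 'k::field) set \<Rightarrow> ('x \<Rightarrow> 'k) set \<Rightarrow> nat" where
  "quot_dim A B = (if quot_finite_dim A B
    then card (SOME S. finite S \<and> quot_basis A B S) else 0)"


section \<open>Koszul signs\<close>

definition parity_sign :: "int \<Rightarrow> 'k::field" where
  "parity_sign n = (if even n then 1 else - 1)"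

text \<open>
  A word lists homogeneous factors in their final order; each factor is given by its rank in the
  original order together with its degree. Factors of equal rank keep their relative order. The
  Koszul sign collects the product of the degrees over all inverted pairs.
\<close>

fun inversion_degree :: "(nat \<times> int) list \<Rightarrow> int" where
  "inversion_degree [] = 0"
| "inversion_degree ((k, d) # w) =
    (\<Sum>(k', d')\<leftarrow>w. if k' < k then d * d' else 0) + inversion_degree w"

definition koszul_sign :: "(nat \<times> int) list \<Rightarrow> 'k::field" where
  "koszul_sign w = parity_sign (inversion_degree w)"


section \<open>Graphical collections\<close>

text \<open>
  \<open>cmp E \<Gamma> d\<close> is the component of homological degree \<open>d\<close> on \<open>\<Gamma>\<close>. An injection \<open>f\<close> on the vertices
  is an isomorphism from \<open>\<Gamma>\<close> onto \<open>map_graph f \<Gamma>\<close>, and \<open>act E f \<Gamma> d\<close> is the induced contravariant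
  map from the component on \<open>map_graph f \<Gamma>\<close> to the one on \<open>\<Gamma>\<close>.
\<close>

record ('k, 'e) collection =
  scl :: "'k \<Rightarrow> 'e \<Rightarrow> 'e"
  cmp :: "graph \<Rightarrow> int \<Rightarrow> 'e set"
  act :: "(nat \<Rightarrow> nat) \<Rightarrow> graph \<Rightarrow> int \<Rightarrow> 'e \<Rightarrow> 'e"

definition graphical_collection :: "('k::field, 'e::ab_group_add) collection \<Rightarrow> bool" where
  "graphical_collection E \<longleftrightarrow> vector_space (scl E) \<and>
    (\<forall>\<Gamma>\<in>connected_graphs. \<forall>d. module.subspace (scl E) (cmp E \<Gamma> d)) \<and>
    (\<forall>\<Gamma>\<in>connected_graphs. \<forall>d f. inj_on f (verts \<Gamma>) \<longrightarrow>
      (\<forall>x\<in>cmp E (map_graph f \<Gamma>) d. act E f \<Gamma> d x \<in> cmp E \<Gamma> d \<and>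
        (\<forall>c. act E f \<Gamma> d (scl E c x) = scl E c (act E f \<Gamma> d x)) \<and>
        (\<forall>y\<in>cmp E (map_graph f \<Gamma>) d.
          act E f \<Gamma> d (x + y) = act E f \<Gamma> d x + act E f \<Gamma> d y) \<and>
        (\<forall>g. (\<forall>v\<in>verts \<Gamma>. g v = f v) \<longrightarrow> act E g \<Gamma> d x = act E f \<Gamma> d x))) \<and>
    (\<forall>\<Gamma>\<in>connected_graphs. \<forall>d. \<forall>x\<in>cmp E \<Gamma> d. act E id \<Gamma> d x = x) \<and>
    (\<forall>\<Gamma>\<in>connected_graphs. \<forall>d f g. inj_on f (verts \<Gamma>) \<longrightarrow> inj_on g (f ` verts \<Gamma>) \<longrightarrow>
      (\<forall>x\<in>cmp E (map_graph (g \<circ> f) \<Gamma>) d.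
        act E (g \<circ> f) \<Gamma> d x = act E f \<Gamma> d (act E g (map_graph f \<Gamma>) d x)))"

definition suspension :: "('k, 'e) collection \<Rightarrow> ('k, 'e) collection" where
  "suspension E = \<lparr>scl = scl E, cmp = (\<lambda>\<Gamma> d. cmp E \<Gamma> (d - 1)),
    act = (\<lambda>f \<Gamma> d. act E f \<Gamma> (d - 1))\<rparr>"


section \<open>Decorated trees and the free contractad\<close>

text \<open>
  \<open>Vertex d e ts\<close> is a vertex decorated by an element \<open>e\<close> of degree \<open>d\<close>, with incoming subtrees \<open>ts\<close>.
  Subtrees are listed by increasing least leaf, so that each rooted tree with labelled leaves has
  exactly one representative, and the vertices of a tree are ordered in preorder. An incoming edge
  is named by the least leaf above it.
\<close>

datatype 'e tree = Leaf nat | Vertex int 'e "'e tree list"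

fun leaves :: "'e tree \<Rightarrow> nat set" where
  "leaves (Leaf n) = {n}"
| "leaves (Vertex d e ts) = (\<Union>t\<in>set ts. leaves t)"

definition low :: "'e tree \<Rightarrow> nat" where
  "low t = Min (leaves t)"

definition plug :: "'e tree list \<Rightarrow> nat \<Rightarrow> 'e tree" where
  "plug Fs n = the (find (\<lambda>t. low t = n) Fs)"

fun tree_weight :: "'e tree \<Rightarrow> nat" where
  "tree_weight (Leaf n) = 0"
| "tree_weight (Vertex d e ts) = Suc (\<Sum>t\<leftarrow>ts. tree_weight t)"

fun tree_degree :: "'e tree \<Rightarrow> int" where
  "tree_degree (Leaf n) = 0"
| "tree_degree (Vertex d e ts) = d + (\<Sum>t\<leftarrow>ts. tree_degree t)"

fun decorated :: "('k::field, 'e::ab_group_add) collection \<Rightarrow> graph \<Rightarrow> 'e tree \<Rightarrow> bool" where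
  "decorated E \<Gamma> (Leaf n) \<longleftrightarrow> n \<in> verts \<Gamma>"
| "decorated E \<Gamma> (Vertex d e ts) \<longleftrightarrow> ts \<noteq> [] \<and> (\<forall>t\<in>set ts. decorated E \<Gamma> t) \<and>
    sorted_wrt (\<lambda>t u. leaves t \<inter> leaves u = {} \<and> low t < low u) ts \<and>
    tube \<Gamma> (\<Union>t\<in>set ts. leaves t) \<and>
    e \<in> some_basis (scl E) (cmp E (contract \<Gamma> (leaves ` set ts)) d)"

definition trees :: "('k::field, 'e::ab_group_add) collection \<Rightarrow> graph \<Rightarrow> 'e tree set" where
  "trees E \<Gamma> = {t. decorated E \<Gamma> t \<and> leaves t = verts \<Gamma>}"

text \<open>
  The tensor product over the vertices of a tree has as basis the decorations of the vertices by
  basis elements, so the value of the free contractad on \<open>\<Gamma>\<close> is the space with basis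
  \<open>trees E \<Gamma>\<close>. The same space underlies the cofree conilpotent cocontractad.
\<close>

definition free_space ::
    "('k::field, 'e::ab_group_add) collection \<Rightarrow> graph \<Rightarrow> ('e tree \<Rightarrow> 'k) set" where
  "free_space E \<Gamma> = {x. finite {t. x t \<noteq> 0} \<and> (\<forall>t. x t \<noteq> 0 \<longrightarrow> t \<in> trees E \<Gamma>)}"

definition of_weight :: "nat \<Rightarrow> ('e tree \<Rightarrow> 'k::field) set" where
  "of_weight r = {x. \<forall>t. x t \<noteq> 0 \<longrightarrow> tree_weight t = r}"

definition weight_part :: "nat \<Rightarrow> ('e tree \<Rightarrow> 'k::field) \<Rightarrow> 'e tree \<Rightarrow> 'k" where
  "weight_part r x = (\<lambda>t. if tree_weight t = r then x t else 0)"

definition degree_part :: "int \<Rightarrow> ('e tree \<Rightarrow> 'k::field) \<Rightarrow> 'e tree \<Rightarrow> 'k" where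
  "degree_part n x = (\<lambda>t. if tree_degree t = n then x t else 0)"

text \<open>
  The action of isomorphisms on the free contractad. The matrix entry between a tree \<open>t\<close> on \<open>\<Gamma>\<close> and
  a tree on \<open>map_graph f \<Gamma>\<close> vanishes unless \<open>f\<close> maps the first underlying tree to the second.
  It is then the product of the matrix entries at the vertices and of the Koszul sign that reorders
  the vertices; at each vertex the incoming subtrees are permuted as blocks.
\<close>

fun tree_coeff :: "('k::field, 'e::ab_group_add) collection \<Rightarrow> (nat \<Rightarrow> nat) \<Rightarrow> graph \<Rightarrow>
    'e tree \<Rightarrow> 'e tree \<Rightarrow> 'k" where
  "tree_coeff E f \<Gamma> (Leaf n) u = (if u = Leaf (f n) then 1 else 0)"
| "tree_coeff E f \<Gamma> (Vertex d e ts) u = (case u of Leaf n \<Rightarrow> 0 | Vertex d' e' us \<Rightarrow>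
    (if d' = d \<and> leaves ` set us = (\<lambda>t. f ` leaves t) ` set ts then
      (let \<Delta> = contract \<Gamma> (leaves ` set ts);
           g = (\<lambda>n. Min (f ` leaves (plug ts n)))
       in module.representation (scl E) (some_basis (scl E) (cmp E \<Delta> d)) (act E g \<Delta> d e') e *
          koszul_sign (map (\<lambda>t. (Min (f ` leaves t), tree_degree t)) ts) *
          prod_list (map (\<lambda>t. tree_coeff E f \<Gamma> t
            (the (find (\<lambda>u'. leaves u' = f ` leaves t) us))) ts))
     else 0))"

definition tree_act :: "('k::field, 'e::ab_group_add) collection \<Rightarrow> (nat \<Rightarrow> nat) \<Rightarrow> graph \<Rightarrow>
    ('e tree \<Rightarrow> 'k) \<Rightarrow> 'e tree \<Rightarrow> 'k" where
  "tree_act E f \<Gamma> x = (\<lambda>t. if t \<in> trees E \<Gamma>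
    then (\<Sum>u | x u \<noteq> 0. tree_coeff E f \<Gamma> t u * x u) else 0)"

text \<open>
  Subcollections are taken in the category of collections that are graded both by homological
  degree and by weight.
\<close>

definition subcollection :: "('k::field, 'e::ab_group_add) collection \<Rightarrow>
    (graph \<Rightarrow> ('e tree \<Rightarrow> 'k) set) \<Rightarrow> bool" where
  "subcollection E C \<longleftrightarrow> (\<forall>\<Gamma>\<in>connected_graphs.
    C \<Gamma> \<subseteq> free_space E \<Gamma> \<and> module.subspace fscale (C \<Gamma>) \<and>
    (\<forall>x\<in>C \<Gamma>. (\<forall>r. weight_part r x \<in> C \<Gamma>) \<and> (\<forall>n. degree_part n x \<in> C \<Gamma>)) \<and>
    (\<forall>f. inj_on f (verts \<Gamma>) \<longrightarrow> (\<forall>x\<in>C (map_graph f \<Gamma>). tree_act E f \<Gamma> x \<in> C \<Gamma>)))"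


section \<open>Contraction product, composition and decomposition\<close>

text \<open>
  A basis element of the contraction product of two free spaces is a tree on \<open>\<Gamma>/I\<close> together with
  a tree on each block of \<open>I\<close>. The latter are listed by increasing least leaf, and \<open>I\<close> is recovered
  as the set of their leaf sets.
\<close>

definition two_level :: "('k::field, 'e::ab_group_add) collection \<Rightarrow> ('k, 'e) collection \<Rightarrow>
    graph \<Rightarrow> ('e tree \<times> 'e tree list) set" where
  "two_level E E' \<Gamma> = {(S, Fs). sorted_wrt (\<lambda>t u. low t < low u) Fs \<and>
    leaves ` set Fs \<in> graph_partitions \<Gamma> \<and>
    S \<in> trees E (contract \<Gamma> (leaves ` set Fs)) \<and>
    (\<forall>t\<in>set Fs. t \<in> trees E' (induced \<Gamma> (leaves t)))}"

definition tensor :: "nat set set \<Rightarrow> ('e tree \<Rightarrow> 'k::field) \<Rightarrow> (nat set \<Rightarrow> 'e tree \<Rightarrow> 'k) \<Rightarrow>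
    'e tree \<times> 'e tree list \<Rightarrow> 'k" where
  "tensor I c y = (\<lambda>(S, Fs). if sorted_wrt (\<lambda>t u. low t < low u) Fs \<and> leaves ` set Fs = I
    then c S * (\<Prod>t\<leftarrow>Fs. y (leaves t) t) else 0)"

definition contraction_product :: "(graph \<Rightarrow> ('e tree \<Rightarrow> 'k::field) set) \<Rightarrow>
    (graph \<Rightarrow> ('e tree \<Rightarrow> 'k) set) \<Rightarrow> graph \<Rightarrow> ('e tree \<times> 'e tree list \<Rightarrow> 'k) set" where
  "contraction_product A B \<Gamma> = module.span fscale
    {tensor I c y | I c y. I \<in> graph_partitions \<Gamma> \<and> c \<in> A (contract \<Gamma> I) \<and>
      (\<forall>G\<in>I. y G \<in> B (induced \<Gamma> G))}"

text \<open>
  The subspace of \<open>A \<circ> B\<close> spanned by the pure tensors with at least one upper factor in \<open>N\<close>, that is,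
  the kernel of the projection of \<open>A \<circ> B\<close> onto \<open>A \<circ> (B/N)\<close>.
\<close>

definition contraction_product_ker :: "(graph \<Rightarrow> ('e tree \<Rightarrow> 'k::field) set) \<Rightarrow>
    (graph \<Rightarrow> ('e tree \<Rightarrow> 'k) set) \<Rightarrow> (graph \<Rightarrow> ('e tree \<Rightarrow> 'k) set) \<Rightarrow>
    graph \<Rightarrow> ('e tree \<times> 'e tree list \<Rightarrow> 'k) set" where
  "contraction_product_ker A B N \<Gamma> = module.span fscale
    {tensor I c y | I c y. I \<in> graph_partitions \<Gamma> \<and> c \<in> A (contract \<Gamma> I) \<and>
      (\<forall>G\<in>I. y G \<in> B (induced \<Gamma> G)) \<and> (\<exists>G\<in>I. y G \<in> N (induced \<Gamma> G))}"

fun graft :: "'e tree \<Rightarrow> 'e tree list \<Rightarrow> 'e tree" where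
  "graft (Leaf n) Fs = plug Fs n"
| "graft (Vertex d e ts) Fs = Vertex d e (map (\<lambda>t. graft t Fs) ts)"

text \<open>
  The sign of moving the vertices of \<open>S\<close>, followed by the vertices of the trees \<open>Fs\<close>, into the
  preorder of the grafted tree.
\<close>

fun graft_word :: "'e tree \<Rightarrow> 'e tree list \<Rightarrow> (nat \<times> int) list" where
  "graft_word (Leaf n) Fs = [(Suc n, tree_degree (plug Fs n))]"
| "graft_word (Vertex d e ts) Fs = (0, d) # concat (map (\<lambda>t. graft_word t Fs) ts)"

definition graft_sign :: "'e tree \<Rightarrow> 'e tree list \<Rightarrow> 'k::field" where
  "graft_sign S Fs = koszul_sign (graft_word S Fs)"

text \<open>
  The product of the free contractad grafts trees, and the coproduct of the cofree cocontractad is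
  its transpose with respect to the bases of trees.
\<close>

definition tree_compose ::
    "('e tree \<times> 'e tree list \<Rightarrow> 'k::field) \<Rightarrow> 'e tree \<Rightarrow> 'k" where
  "tree_compose z = (\<lambda>t. \<Sum>(S, Fs) | z (S, Fs) \<noteq> 0 \<and> graft S Fs = t.
    graft_sign S Fs * z (S, Fs))"

definition tree_decompose :: "('k::field, 'e::ab_group_add) collection \<Rightarrow> graph \<Rightarrow>
    ('e tree \<Rightarrow> 'k) \<Rightarrow> 'e tree \<times> 'e tree list \<Rightarrow> 'k" where
  "tree_decompose E \<Gamma> x = (\<lambda>(S, Fs). if (S, Fs) \<in> two_level E E \<Gamma>
    then graft_sign S Fs * x (graft S Fs) else 0)"


section \<open>Quadratic contractads\<close>

definition contractad_ideal :: "('k::field, 'e::ab_group_add) collection \<Rightarrow>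
    (graph \<Rightarrow> ('e tree \<Rightarrow> 'k) set) \<Rightarrow> bool" where
  "contractad_ideal E J \<longleftrightarrow> subcollection E J \<and>
    (\<forall>\<Gamma>\<in>connected_graphs. \<forall>I\<in>graph_partitions \<Gamma>. \<forall>c y.
      c \<in> free_space E (contract \<Gamma> I) \<longrightarrow> (\<forall>G\<in>I. y G \<in> free_space E (induced \<Gamma> G)) \<longrightarrow>
      c \<in> J (contract \<Gamma> I) \<or> (\<exists>G\<in>I. y G \<in> J (induced \<Gamma> G)) \<longrightarrow>
      tree_compose (tensor I c y) \<in> J \<Gamma>)"

definition quadratic_data :: "('k::field, 'e::ab_group_add) collection \<Rightarrow>
    (graph \<Rightarrow> ('e tree \<Rightarrow> 'k) set) \<Rightarrow> bool" where
  "quadratic_data E R \<longleftrightarrow> graphical_collection E \<and> subcollection E R \<and>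
    (\<forall>\<Gamma>\<in>connected_graphs. R \<Gamma> \<subseteq> of_weight 2)"

definition relation_ideal :: "('k::field, 'e::ab_group_add) collection \<Rightarrow>
    (graph \<Rightarrow> ('e tree \<Rightarrow> 'k) set) \<Rightarrow> graph \<Rightarrow> ('e tree \<Rightarrow> 'k) set" where
  "relation_ideal E R \<Gamma> = {x \<in> free_space E \<Gamma>. \<forall>J. contractad_ideal E J \<longrightarrow>
    (\<forall>\<Delta>\<in>connected_graphs. R \<Delta> \<subseteq> J \<Delta>) \<longrightarrow> x \<in> J \<Gamma>}"

text \<open>The dimensions of the quadratic contractad \<open>free_space E / relation_ideal E R\<close>.\<close>

definition contractad_finite :: "('k::field, 'e::ab_group_add) collection \<Rightarrow>
    (graph \<Rightarrow> ('e tree \<Rightarrow> 'k) set) \<Rightarrow> nat \<Rightarrow> graph \<Rightarrow> bool" where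
  "contractad_finite E R r \<Gamma> \<longleftrightarrow>
    quot_finite_dim (free_space E \<Gamma> \<inter> of_weight r) (relation_ideal E R \<Gamma> \<inter> of_weight r)"

definition contractad_weight_dim :: "('k::field, 'e::ab_group_add) collection \<Rightarrow>
    (graph \<Rightarrow> ('e tree \<Rightarrow> 'k) set) \<Rightarrow> nat \<Rightarrow> graph \<Rightarrow> nat" where
  "contractad_weight_dim E R r \<Gamma> =
    quot_dim (free_space E \<Gamma> \<inter> of_weight r) (relation_ideal E R \<Gamma> \<inter> of_weight r)"

definition contractad_dim :: "('k::field, 'e::ab_group_add) collection \<Rightarrow>
    (graph \<Rightarrow> ('e tree \<Rightarrow> 'k) set) \<Rightarrow> graph \<Rightarrow> nat" where
  "contractad_dim E R \<Gamma> = quot_dim (free_space E \<Gamma>) (relation_ideal E R \<Gamma>)"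


section \<open>Koszul dual cocontractad\<close>

definition sub_cocontractad :: "('k::field, 'e::ab_group_add) collection \<Rightarrow>
    (graph \<Rightarrow> ('e tree \<Rightarrow> 'k) set) \<Rightarrow> bool" where
  "sub_cocontractad E C \<longleftrightarrow> subcollection E C \<and>
    (\<forall>\<Gamma>\<in>connected_graphs. \<forall>x\<in>C \<Gamma>. tree_decompose E \<Gamma> x \<in> contraction_product C C \<Gamma>)"

text \<open>The largest sub-cocontractad of the cofree one whose weight 2 part consists of corelations.\<close>

definition quadratic_cocontractad :: "('k::field, 'e::ab_group_add) collection \<Rightarrow>
    (graph \<Rightarrow> ('e tree \<Rightarrow> 'k) set) \<Rightarrow> graph \<Rightarrow> ('e tree \<Rightarrow> 'k) set" where
  "quadratic_cocontractad E Q \<Gamma> = module.span fscale (\<Union> {C \<Gamma> | C. sub_cocontractad E C \<and>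
    (\<forall>\<Delta>\<in>connected_graphs. \<forall>x\<in>C \<Delta>. weight_part 2 x \<in> Q \<Delta>)})"

fun desuspend_tree :: "'e tree \<Rightarrow> 'e tree" where
  "desuspend_tree (Leaf n) = Leaf n"
| "desuspend_tree (Vertex d e ts) = Vertex (d - 1) e (map desuspend_tree ts)"

text \<open>
  Preorder lists the root first, and \<open>s \<otimes> s\<close> sends \<open>e \<otimes> e'\<close> to \<open>(-1)\<^bsup>deg e\<^esup> se \<otimes> se'\<close>.
\<close>

fun suspension_sign :: "'e tree \<Rightarrow> 'k::field" where
  "suspension_sign (Leaf n) = 1"
| "suspension_sign (Vertex d e ts) = parity_sign d"

definition suspended_relations :: "(graph \<Rightarrow> ('e tree \<Rightarrow> 'k::field) set) \<Rightarrow>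
    graph \<Rightarrow> ('e tree \<Rightarrow> 'k) set" where
  "suspended_relations R \<Gamma> =
    (\<lambda>x t. suspension_sign (desuspend_tree t) * x (desuspend_tree t)) ` R \<Gamma>"

definition koszul_dual_co :: "('k::field, 'e::ab_group_add) collection \<Rightarrow>
    (graph \<Rightarrow> ('e tree \<Rightarrow> 'k) set) \<Rightarrow> graph \<Rightarrow> ('e tree \<Rightarrow> 'k) set" where
  "koszul_dual_co E R = quadratic_cocontractad (suspension E) (suspended_relations R)"


section \<open>Koszul dual contractad\<close>

text \<open>
  Elements of the one-dimensional space of maps from the tensor power of \<open>ks\<^sup>-\<^sup>1\<close> over the vertices
  to \<open>ks\<^sup>-\<^sup>1\<close> are alternating functions of an enumeration of the vertices, since \<open>s\<^sup>-\<^sup>1\<close> is odd. The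
  weight \<open>r\<close> component of the dual of the cocontractad tensored with this line therefore consists of
  functions that are alternating in the enumeration and linear in the cocontractad. Functions are
  extended by zero outside their domain, so that components of different weights are independent.
\<close>

definition koszul_dual_weight :: "('k::field, 'e::ab_group_add) collection \<Rightarrow>
    (graph \<Rightarrow> ('e tree \<Rightarrow> 'k) set) \<Rightarrow> nat \<Rightarrow> graph \<Rightarrow>
    (nat list \<times> ('e tree \<Rightarrow> 'k) \<Rightarrow> 'k) set" where
  "koszul_dual_weight E R r \<Gamma> = (let C = koszul_dual_co E R \<Gamma> \<inter> of_weight r in {\<phi>.
    (\<forall>l x. \<phi> (l, x) \<noteq> 0 \<longrightarrow> distinct l \<and> set l = verts \<Gamma> \<and> x \<in> C) \<and>
    (\<forall>l p x. p permutes {..<length l} \<longrightarrow>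
      \<phi> (permute_list p l, x) = of_int (sign p) * \<phi> (l, x)) \<and>
    (\<forall>l. \<forall>x\<in>C. \<forall>y\<in>C. \<phi> (l, x + y) = \<phi> (l, x) + \<phi> (l, y)) \<and>
    (\<forall>l a. \<forall>x\<in>C. \<phi> (l, fscale a x) = a * \<phi> (l, x))})"

definition koszul_dual :: "('k::field, 'e::ab_group_add) collection \<Rightarrow>
    (graph \<Rightarrow> ('e tree \<Rightarrow> 'k) set) \<Rightarrow> graph \<Rightarrow>
    (nat list \<times> ('e tree \<Rightarrow> 'k) \<Rightarrow> 'k) set" where
  "koszul_dual E R \<Gamma> = module.span fscale (\<Union>r. koszul_dual_weight E R r \<Gamma>)"

definition koszul_dual_weight_dim :: "('k::field, 'e::ab_group_add) collection \<Rightarrow>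
    (graph \<Rightarrow> ('e tree \<Rightarrow> 'k) set) \<Rightarrow> nat \<Rightarrow> graph \<Rightarrow> nat" where
  "koszul_dual_weight_dim E R r \<Gamma> = vector_space.dim fscale (koszul_dual_weight E R r \<Gamma>)"

definition koszul_dual_dim :: "('k::field, 'e::ab_group_add) collection \<Rightarrow>
    (graph \<Rightarrow> ('e tree \<Rightarrow> 'k) set) \<Rightarrow> graph \<Rightarrow> nat" where
  "koszul_dual_dim E R \<Gamma> = vector_space.dim fscale (koszul_dual E R \<Gamma>)"


section \<open>Koszul complex\<close>

text \<open>
  The Koszul complex is the quotient of \<open>koszul_space\<close> by \<open>koszul_ker\<close>. The upper factor is the
  free contractad modulo the ideal of relations.
\<close>

definition koszul_space :: "('k::field, 'e::ab_group_add) collection \<Rightarrow>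
    (graph \<Rightarrow> ('e tree \<Rightarrow> 'k) set) \<Rightarrow> graph \<Rightarrow> ('e tree \<times> 'e tree list \<Rightarrow> 'k) set" where
  "koszul_space E R = contraction_product (koszul_dual_co E R) (free_space E)"

definition koszul_ker :: "('k::field, 'e::ab_group_add) collection \<Rightarrow>
    (graph \<Rightarrow> ('e tree \<Rightarrow> 'k) set) \<Rightarrow> graph \<Rightarrow> ('e tree \<times> 'e tree list \<Rightarrow> 'k) set" where
  "koszul_ker E R =
    contraction_product_ker (koszul_dual_co E R) (free_space E) (relation_ideal E R)"

text \<open>
  The differential, written through its matrix entries. The coefficient at \<open>(S, Fs)\<close> collects, for
  each tree \<open>Vertex d e ts\<close> in \<open>Fs\<close>, the coefficient at the pair in which this vertex has been moved,
  with degree \<open>d + 1\<close>, to the top of \<open>S\<close>. The three signs come from splitting the suspended vertex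
  off to the right of \<open>S\<close>, from moving the desuspension of degree \<open>-1\<close> past \<open>S\<close>, and from moving the
  desuspended vertex and the trees above it to their places in \<open>Fs\<close>.
\<close>

definition koszul_diff :: "('k::field, 'e::ab_group_add) collection \<Rightarrow> graph \<Rightarrow>
    ('e tree \<times> 'e tree list \<Rightarrow> 'k) \<Rightarrow> 'e tree \<times> 'e tree list \<Rightarrow> 'k" where
  "koszul_diff E \<Gamma> x = (\<lambda>(S, Fs). if (S, Fs) \<in> two_level (suspension E) E \<Gamma> then
    (\<Sum>i<length Fs. case Fs ! i of Leaf n \<Rightarrow> 0 | Vertex d e ts \<Rightarrow>
      (let corolla = Vertex (d + 1) e (map (\<lambda>t. Leaf (low t)) ts);
           Cs = (map (\<lambda>t. Leaf (low t)) Fs)[i := corolla];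
           Gs = sort_key low (take i Fs @ ts @ drop (Suc i) Fs);
           block = (\<lambda>t. (Suc (low t), tree_degree t))
       in graft_sign S Cs * parity_sign (tree_degree S) *
          koszul_sign (map block (take i Fs) @ (0, d) # map block ts @
            map block (drop (Suc i) Fs)) *
          x (graft S Cs, Gs)))
    else 0)"

definition unit_space :: "graph \<Rightarrow> (unit \<Rightarrow> 'k::field) set" where
  "unit_space \<Gamma> = (if card (verts \<Gamma>) = 1 then UNIV else {0})"

definition augmentation :: "graph \<Rightarrow> ('e tree \<times> 'e tree list \<Rightarrow> 'k::field) \<Rightarrow> unit \<Rightarrow> 'k" where
  "augmentation \<Gamma> x = (if card (verts \<Gamma>) = 1
    then (\<lambda>_. x (Leaf (the_elem (verts \<Gamma>)), [Leaf (the_elem (verts \<Gamma>))])) else 0)"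

definition koszul_cycles :: "('k::field, 'e::ab_group_add) collection \<Rightarrow>
    (graph \<Rightarrow> ('e tree \<Rightarrow> 'k) set) \<Rightarrow> graph \<Rightarrow> ('e tree \<times> 'e tree list \<Rightarrow> 'k) set" where
  "koszul_cycles E R \<Gamma> = {x \<in> koszul_space E R \<Gamma>. koszul_diff E \<Gamma> x \<in> koszul_ker E R \<Gamma>}"

definition koszul_boundaries :: "('k::field, 'e::ab_group_add) collection \<Rightarrow>
    (graph \<Rightarrow> ('e tree \<Rightarrow> 'k) set) \<Rightarrow> graph \<Rightarrow> ('e tree \<times> 'e tree list \<Rightarrow> 'k) set" where
  "koszul_boundaries E R \<Gamma> =
    {koszul_diff E \<Gamma> y + z | y z. y \<in> koszul_space E R \<Gamma> \<and> z \<in> koszul_ker E R \<Gamma>}"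

text \<open>
  The augmentation induces an isomorphism from the homology of the Koszul complex to the unit
  collection: the boundaries are exactly the cycles of augmentation zero, and the augmentation maps
  the cycles onto the unit.
\<close>

definition koszul :: "('k::field, 'e::ab_group_add) collection \<Rightarrow>
    (graph \<Rightarrow> ('e tree \<Rightarrow> 'k) set) \<Rightarrow> bool" where
  "koszul E R \<longleftrightarrow> (\<forall>\<Gamma>\<in>connected_graphs.
    koszul_boundaries E R \<Gamma> = {x \<in> koszul_cycles E R \<Gamma>. augmentation \<Gamma> x = 0} \<and>
    augmentation \<Gamma> ` koszul_cycles E R \<Gamma> = unit_space \<Gamma>)"


section \<open>Generating functions\<close>

text \<open>
  Power series in \<open>q\<close>, since infinitely many weights occur on a fixed graph when there are
  generators on the graph with one vertex.
\<close>

definition weight_series :: "(nat \<Rightarrow> graph \<Rightarrow> nat) \<Rightarrow> graph \<Rightarrow> int fps" where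
  "weight_series dm \<Gamma> = Abs_fps (\<lambda>r. int (dm r \<Gamma>))"

definition weight_series_neg :: "(nat \<Rightarrow> graph \<Rightarrow> nat) \<Rightarrow> graph \<Rightarrow> int fps" where
  "weight_series_neg dm \<Gamma> = weight_series dm \<Gamma> oo (- fps_X)"

definition generated_by_binary :: "('k::field, 'e::ab_group_add) collection \<Rightarrow> bool" where
  "generated_by_binary E \<longleftrightarrow>
    (\<forall>\<Gamma>\<in>connected_graphs. card (verts \<Gamma>) \<noteq> 2 \<longrightarrow> (\<forall>d. cmp E \<Gamma> d = {0}))"

end

theory Submission
  imports Defs
begin

text \<open>
  On a fixed graph the Koszul complex splits by total weight \<open>n\<close>, and in total weight \<open>n\<close> it is a
  finite complex graded by the weight \<open>r\<close> of its cocontractad factor, which the differential lowers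
  by one. The dimension of its component of degree \<open>r\<close> is the sum over the partitions \<open>I\<close> of the
  product of the weight \<open>r\<close> dimension of the Koszul dual on \<open>\<Gamma>/I\<close> and the coefficient of
  \<open>q\<^sup>n\<^sup>-\<^sup>r\<close> in the product of the weight series on the blocks. The Euler characteristic is thus
  the coefficient of \<open>q\<^sup>n\<close> in the convolution; it equals that of the homology, which is
  one-dimensional for \<open>n = 0\<close> on the graph with one vertex and zero otherwise. For binary generators every
  tree is binary, so the weight on \<open>\<Gamma>\<close> is concentrated in \<open>card (verts \<Gamma>) - 1\<close>, and the second
  identity is a single coefficient of the first.
\<close>

section \<open>Bases of quotient spaces\<close>

text \<open>The complex is available only as a numerator \<open>koszul_space\<close> with a
  denominator \<open>koszul_ker\<close>, and likewise the contractad, so dimensions are counted by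
  sets of representatives (\<open>quot_basis\<close>) and not as differences of dimensions; the
  usual isomorphism theorems appear in that form. On a fixed graph the whole complex may be
  infinite-dimensional when there are generators on the one-vertex graph, which is why the total
  weight is fixed before an Euler characteristic is taken. The Koszul hypothesis, however, concerns
  the unsplit complex; it is carried to one total weight by projections, and this works because
  numerator and denominator are spanned by homogeneous elements and the differential has homogeneous
  matrix entries. The substantial point is the dimension formula: tensors of chosen basis elements
  must stay independent modulo the span of all tensors having a factor in the ideal. No complement
  of that span is at hand, so independence is tested by functionals that annihilate it.\<close>

interpretation fs: vector_space "fscale :: 'k::field \<Rightarrow> ('x \<Rightarrow> 'k) \<Rightarrow> 'x \<Rightarrow> 'k"
  by unfold_locales (auto simp: fscale_def fun_eq_iff algebra_simps)

text \<open>Elements of \<open>T\<close> are added to \<open>B\<close> one at a time; each avoids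
  even the span of \<open>B\<close> and all other elements of \<open>T\<close>. Representatives of a
  quotient and a basis of its denominator thus form one independent set.\<close>

lemma independent_Un_if_independent_mod:
  fixes B T :: "('x \<Rightarrow> 'k::field) set"
  assumes "fs.independent B" "finite T" "\<And>t. t \<in> T \<Longrightarrow> t \<notin> fs.span ((T - {t}) \<union> B)"
  shows "fs.independent (T \<union> B)"
  using assms(2,3)
proof (induction T rule: finite_induct)
  case empty
  then show ?case using assms(1) by simp
next
  case (insert u T)
  have "t \<notin> fs.span ((T - {t}) \<union> B)" if "t \<in> T" for t
  proof
    assume "t \<in> fs.span ((T - {t}) \<union> B)"
    moreover have "(T - {t}) \<union> B \<subseteq> (insert u T - {t}) \<union> B" by auto
    ultimately have "t \<in> fs.span ((insert u T - {t}) \<union> B)" using fs.span_mono by blast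
    then show False using insert.prems that by auto
  qed
  then have "fs.independent (T \<union> B)" using insert.IH by blast
  moreover have "u \<notin> fs.span (T \<union> B)"
    using insert.prems[of u] insert.hyps by auto
  ultimately show ?case by (simp add: fs.independent_insertI)
qed

lemma in_span_finite_subset:
  fixes X :: "('x \<Rightarrow> 'k::field) set"
  assumes "x \<in> fs.span X"
  obtains Y where "finite Y" "Y \<subseteq> X" "x \<in> fs.span Y"
proof -
  obtain t r where t: "finite t" "t \<subseteq> X" "x = (\<Sum>a\<in>t. fscale (r a) a)"
    using assms unfolding fs.span_explicit by auto
  have "x \<in> fs.span t" unfolding t(3) by (intro fs.span_sum fs.span_scale fs.span_base)
  then show thesis using t that by blast
qed

text \<open>Steinitz exchange modulo \<open>B\<close>. The denominator may have infinite dimension,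
  but expressing the finite set \<open>T\<close> through \<open>S\<close> and a basis of
  \<open>B\<close> uses only finitely many vectors \<open>B1\<close> of that basis; the ordinary
  bound for \<open>T \<union> B1\<close> and \<open>S \<union> B1\<close> then loses the summand
  \<open>card B1\<close> on both sides.\<close>

lemma quot_basis_card_bound:
  fixes A B S T :: "('x \<Rightarrow> 'k::field) set"
  assumes B: "fs.subspace B" and S: "finite S" "quot_basis A B S"
    and T: "finite T" "T \<subseteq> A" "\<And>t. t \<in> T \<Longrightarrow> t \<notin> fs.span ((T - {t}) \<union> B)"
  shows "card T \<le> card S"
proof -
  obtain B0 where B0: "B0 \<subseteq> B" "fs.independent B0" "B \<subseteq> fs.span B0"
    by (rule fs.maximal_independent_subset)
  have span_B0: "fs.span (X \<union> B0) = fs.span (X \<union> B)" for X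
  proof (rule antisym)
    show "fs.span (X \<union> B0) \<subseteq> fs.span (X \<union> B)" using B0(1) by (intro fs.span_mono) auto
    have "B \<subseteq> fs.span (X \<union> B0)" using B0(3) fs.span_mono[of B0 "X \<union> B0"] by blast
    then have "X \<union> B \<subseteq> fs.span (X \<union> B0)" by (auto intro: fs.span_base)
    then show "fs.span (X \<union> B) \<subseteq> fs.span (X \<union> B0)" using fs.span_minimal by blast
  qed
  have indep: "fs.independent (T \<union> B0)"
    using B0(2) T(1,3) by (intro independent_Un_if_independent_mod) (auto simp: span_B0)
  have disj: "T \<inter> B0 = {}" using T(3) B0(1) fs.span_base by blast
  have "T \<subseteq> fs.span (S \<union> B0)" using S(2) T(2) by (auto simp: quot_basis_def span_B0)
  then have "\<forall>t\<in>T. \<exists>Y. finite Y \<and> Y \<subseteq> S \<union> B0 \<and> t \<in> fs.span Y"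
    using in_span_finite_subset by (metis subsetD)
  then obtain Y where Y: "\<And>t. t \<in> T \<Longrightarrow> finite (Y t) \<and> Y t \<subseteq> S \<union> B0 \<and> t \<in> fs.span (Y t)"
    by metis
  define B1 where "B1 = (\<Union>t\<in>T. Y t) - S"
  have B1: "finite B1" "B1 \<subseteq> B0" using Y T(1) by (auto simp: B1_def)
  have "t \<in> fs.span (S \<union> B1)" if "t \<in> T" for t
  proof -
    have "Y t \<subseteq> S \<union> B1" using that by (auto simp: B1_def)
    then show ?thesis using Y[OF that] fs.span_mono by blast
  qed
  then have "T \<union> B1 \<subseteq> fs.span (S \<union> B1)" by (auto intro: fs.span_base)
  moreover have "fs.independent (T \<union> B1)"
    using indep B1(2) fs.independent_mono by (metis Un_mono subset_refl)
  ultimately have "card (T \<union> B1) \<le> card (S \<union> B1)"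
    using fs.independent_span_bound[of "S \<union> B1" "T \<union> B1"] S(1) B1(1) by auto
  moreover have "card (T \<union> B1) = card T + card B1"
    using T(1) B1 disj by (intro card_Un_disjoint) auto
  moreover have "card (S \<union> B1) \<le> card S + card B1" by (rule card_Un_le)
  ultimately show ?thesis by linarith
qed

text \<open>The exchange bound in both directions. An infinite \<open>T\<close> is excluded by
  comparing one of its subsets of size \<open>Suc (card S)\<close> with \<open>S\<close>. The Euler
  characteristic can then compare bases that were chosen independently.\<close>

lemma quot_basis_card_unique:
  fixes A B S T :: "('x \<Rightarrow> 'k::field) set"
  assumes B: "fs.subspace B" and S: "finite S" "quot_basis A B S" and T: "quot_basis A B T"
  shows "finite T \<and> card T = card S"
proof -
  have indep: "t \<notin> fs.span ((T' - {t}) \<union> B)" if "T' \<subseteq> T" "t \<in> T'" for T' t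
  proof
    assume "t \<in> fs.span ((T' - {t}) \<union> B)"
    moreover have "fs.span ((T' - {t}) \<union> B) \<subseteq> fs.span ((T - {t}) \<union> B)"
      using that by (intro fs.span_mono) auto
    ultimately show False using T that by (auto simp: quot_basis_def)
  qed
  have le: "card T' \<le> card S" if "finite T'" "T' \<subseteq> T" for T'
    using that T indep by (intro quot_basis_card_bound[OF B S]) (auto simp: quot_basis_def)
  have fin: "finite T"
  proof (rule ccontr)
    assume "infinite T"
    then obtain T' where "T' \<subseteq> T" "finite T'" "card T' = Suc (card S)"
      using infinite_arbitrarily_large by metis
    then show False using le by fastforce
  qed
  moreover have "card S \<le> card T"
    using S by (intro quot_basis_card_bound[OF B fin T]) (auto simp: quot_basis_def)
  ultimately show ?thesis using le[of T] by auto
qed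

text \<open>Extend a basis of \<open>B\<close> to one of \<open>A\<close> and discard the basis of
  \<open>B\<close>.\<close>

lemma quot_basis_exists:
  fixes A B :: "('x \<Rightarrow> 'k::field) set"
  assumes "fs.subspace A" "fs.subspace B" "B \<subseteq> A"
  obtains S where "quot_basis A B S"
proof -
  obtain B0 where B0: "B0 \<subseteq> B" "fs.independent B0" "B \<subseteq> fs.span B0"
    by (rule fs.maximal_independent_subset)
  have "B0 \<subseteq> A" using B0(1) assms(3) by (rule order_trans)
  then obtain B' where B': "B0 \<subseteq> B'" "B' \<subseteq> A" "fs.independent B'" "A \<subseteq> fs.span B'"
    using B0(2) by (rule fs.maximal_independent_subset_extend)
  have "quot_basis A B (B' - B0)"
    unfolding quot_basis_def
  proof (intro conjI ballI)
    show "B' - B0 \<subseteq> A" using B' by auto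
    have "fs.span B' \<subseteq> fs.span (B' - B0 \<union> B)" using B0 by (intro fs.span_mono) auto
    then show "A \<subseteq> fs.span (B' - B0 \<union> B)" using B'(4) by blast
    fix s assume s: "s \<in> B' - B0"
    have "B \<subseteq> fs.span (B' - {s})" using B0(3) B'(1) s fs.span_mono[of B0 "B' - {s}"] by blast
    then have "(B' - B0 - {s}) \<union> B \<subseteq> fs.span (B' - {s})" by (auto intro: fs.span_base)
    then have "fs.span ((B' - B0 - {s}) \<union> B) \<subseteq> fs.span (B' - {s})"
      using fs.span_minimal by blast
    then show "s \<notin> fs.span ((B' - B0 - {s}) \<union> B)"
      using B'(3) s by (auto simp: fs.dependent_def)
  qed
  then show thesis using that by blast
qed

text \<open>If some \<open>u\<close> of \<open>U\<close> were needed to express \<open>w\<close>,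
  exchange would put \<open>u\<close> in the span of \<open>w\<close> and the remaining vectors;
  these lie in \<open>A'\<close> or in \<open>U - {u}\<close>, which contradicts independence modulo
  \<open>A'\<close>.\<close>

lemma span_mod_subspace:
  fixes A' U Y :: "('x \<Rightarrow> 'k::field) set"
  assumes U: "\<And>u. u \<in> U \<Longrightarrow> u \<notin> fs.span ((U - {u}) \<union> A')" and Y: "Y \<subseteq> A'"
    and w: "w \<in> A'" "w \<in> fs.span (U \<union> Y)"
  shows "w \<in> fs.span Y"
proof -
  have *: "w \<in> fs.span Y" if "finite U0" "U0 \<subseteq> U" "w \<in> fs.span (U0 \<union> Y)" for U0
    using that
  proof (induction U0 rule: finite_induct)
    case (insert u U0)
    show ?case
    proof (cases "w \<in> fs.span (U0 \<union> Y)")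
      case True
      then show ?thesis using insert by auto
    next
      case False
      have "u \<in> fs.span (insert w (U0 \<union> Y))"
        using insert.prems(2) False fs.in_span_insert[of w u "U0 \<union> Y"] by simp
      moreover have "insert w (U0 \<union> Y) \<subseteq> (U - {u}) \<union> A'"
        using insert w(1) Y by auto
      ultimately have "u \<in> fs.span ((U - {u}) \<union> A')" using fs.span_mono by blast
      then show ?thesis using U insert.prems by auto
    qed
  qed auto
  obtain Z where Z: "finite Z" "Z \<subseteq> U \<union> Y" "w \<in> fs.span Z"
    using w(2) in_span_finite_subset by metis
  have "fs.span Z \<subseteq> fs.span ((Z \<inter> U) \<union> Y)" using Z(2) by (intro fs.span_mono) auto
  then show ?thesis using *[of "Z \<inter> U"] Z by auto
qed

text \<open>Dimensions of quotients add along \<open>B \<subseteq> A' \<subseteq> A\<close>. For an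
  element of \<open>W\<close> the delicate point is that \<open>U\<close> cannot help to express it,
  which is \<open>span_mod_subspace\<close>.\<close>

lemma quot_basis_trans:
  fixes A A' B U W :: "('x \<Rightarrow> 'k::field) set"
  assumes "fs.subspace A'" "B \<subseteq> A'" "A' \<subseteq> A"
    and U: "quot_basis A A' U" and W: "quot_basis A' B W"
  shows "quot_basis A B (U \<union> W) \<and> U \<inter> W = {}"
proof
  have W_sub: "W \<subseteq> A'" using W by (simp add: quot_basis_def)
  have U_indep: "\<And>u. u \<in> U \<Longrightarrow> u \<notin> fs.span ((U - {u}) \<union> A')"
    using U by (simp add: quot_basis_def)
  show disj: "U \<inter> W = {}" using U_indep W_sub fs.span_base by blast
  show "quot_basis A B (U \<union> W)"
    unfolding quot_basis_def
  proof (intro conjI ballI)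
    show "U \<union> W \<subseteq> A" using U W_sub assms(3) by (auto simp: quot_basis_def)
    have "A' \<subseteq> fs.span (U \<union> W \<union> B)"
      using W fs.span_mono[of "W \<union> B" "U \<union> W \<union> B"] by (auto simp: quot_basis_def)
    then have "U \<union> A' \<subseteq> fs.span (U \<union> W \<union> B)" by (auto intro: fs.span_base)
    then have "fs.span (U \<union> A') \<subseteq> fs.span (U \<union> W \<union> B)" using fs.span_minimal by blast
    then show "A \<subseteq> fs.span (U \<union> W \<union> B)" using U by (auto simp: quot_basis_def)
    fix s assume "s \<in> U \<union> W"
    then show "s \<notin> fs.span ((U \<union> W - {s}) \<union> B)"
    proof
      assume s: "s \<in> U"
      have "fs.span ((U \<union> W - {s}) \<union> B) \<subseteq> fs.span ((U - {s}) \<union> A')"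
        using W_sub assms(2) by (intro fs.span_mono) auto
      then show ?thesis using U_indep s by blast
    next
      assume s: "s \<in> W"
      show ?thesis
      proof
        assume "s \<in> fs.span ((U \<union> W - {s}) \<union> B)"
        moreover have "(U \<union> W - {s}) \<union> B = U \<union> ((W - {s}) \<union> B)" using s disj by auto
        ultimately have "s \<in> fs.span (U \<union> ((W - {s}) \<union> B))" by simp
        moreover have "(W - {s}) \<union> B \<subseteq> A'" "s \<in> A'" using s W_sub assms(2) by auto
        ultimately have "s \<in> fs.span ((W - {s}) \<union> B)"
          using span_mod_subspace[OF U_indep] by metis
        then show False using W s by (auto simp: quot_basis_def)
      qed
    qed
  qed
qed

text \<open>The isomorphism theorem: \<open>f\<close> identifies \<open>A\<close> modulo the
  preimage of \<open>N\<close> with \<open>(f A + N) / N\<close>. For the differential,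
  representatives of chains modulo cycles become representatives of boundaries one degree
  lower.\<close>

lemma quot_basis_image:
  fixes A U :: "('x \<Rightarrow> 'k::field) set" and N :: "('y \<Rightarrow> 'k) set" and f :: "('x \<Rightarrow> 'k) \<Rightarrow> 'y \<Rightarrow> 'k"
  assumes f: "Vector_Spaces.linear fscale fscale f"
    and A: "fs.subspace A" and N: "fs.subspace N"
    and U: "quot_basis A {x \<in> A. f x \<in> N} U"
  shows "quot_basis {f y + z |y z. y \<in> A \<and> z \<in> N} N (f ` U) \<and> inj_on f U"
proof -
  interpret f: Vector_Spaces.linear fscale fscale f by (rule f)
  let ?Z = "{x \<in> A. f x \<in> N}"
  have U_sub: "U \<subseteq> A" using U by (simp add: quot_basis_def)
  have span_sub: "fs.span U' \<subseteq> A" if "U' \<subseteq> U" for U'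
    using that U_sub A fs.span_minimal by blast
  have key: False if u: "u \<in> U" and v: "v \<in> fs.span (U - {u})" and "f u - f v \<in> N" for u v
  proof -
    have "v \<in> A" using v span_sub[of "U - {u}"] by auto
    then have "u - v \<in> ?Z" using that U_sub A fs.subspace_diff by (auto simp: f.diff)
    then have "u - v \<in> fs.span ((U - {u}) \<union> ?Z)" by (intro fs.span_base) simp
    moreover have "v \<in> fs.span ((U - {u}) \<union> ?Z)"
      using v fs.span_mono[of "U - {u}" "(U - {u}) \<union> ?Z"] by auto
    ultimately have "(u - v) + v \<in> fs.span ((U - {u}) \<union> ?Z)" by (rule fs.span_add)
    then show False using U u by (auto simp: quot_basis_def)
  qed
  have inj: "inj_on f U"
  proof (rule inj_onI, rule ccontr)
    fix u v assume "u \<in> U" "v \<in> U" "f u = f v" "u \<noteq> v"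
    then show False using key[of u v] fs.span_base[of v "U - {u}"] fs.subspace_0[OF N] by auto
  qed
  have "quot_basis {f y + z |y z. y \<in> A \<and> z \<in> N} N (f ` U)"
    unfolding quot_basis_def
  proof (intro conjI ballI)
    show "f ` U \<subseteq> {f y + z |y z. y \<in> A \<and> z \<in> N}"
    proof
      fix x assume "x \<in> f ` U"
      then obtain u where "u \<in> U" "x = f u + 0" by auto
      then show "x \<in> {f y + z |y z. y \<in> A \<and> z \<in> N}"
        using U_sub fs.subspace_0[OF N] by blast
    qed
    show "{f y + z |y z. y \<in> A \<and> z \<in> N} \<subseteq> fs.span (f ` U \<union> N)"
    proof
      fix x assume "x \<in> {f y + z |y z. y \<in> A \<and> z \<in> N}"
      then obtain y z where yz: "x = f y + z" "y \<in> A" "z \<in> N" by blast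
      have "y \<in> fs.span (U \<union> ?Z)" using U yz by (auto simp: quot_basis_def)
      then have "f y \<in> fs.span (f ` (U \<union> ?Z))" by (simp add: f.span_image)
      moreover have "fs.span (f ` (U \<union> ?Z)) \<subseteq> fs.span (f ` U \<union> N)"
        by (intro fs.span_mono) auto
      moreover have "z \<in> fs.span (f ` U \<union> N)" using yz(3) by (intro fs.span_base) simp
      ultimately show "x \<in> fs.span (f ` U \<union> N)"
        unfolding yz(1) by (intro fs.span_add) auto
    qed
    fix x assume "x \<in> f ` U"
    then obtain u where u: "u \<in> U" "x = f u" by blast
    show "x \<notin> fs.span ((f ` U - {x}) \<union> N)"
    proof
      assume "x \<in> fs.span ((f ` U - {x}) \<union> N)"
      moreover have "fs.span ((f ` U - {x}) \<union> N) \<subseteq> fs.span (f ` (U - {u}) \<union> N)"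
        using u by (intro fs.span_mono) auto
      ultimately have "f u \<in> fs.span (f ` (U - {u}) \<union> N)" using u by blast
      then obtain p n where pn: "f u = p + n" "p \<in> fs.span (f ` (U - {u}))" "n \<in> fs.span N"
        unfolding fs.span_Un by blast
      then obtain v where v: "v \<in> fs.span (U - {u})" "p = f v"
        by (auto simp: f.span_image)
      have "n \<in> N" using pn(3) N by (metis fs.span_eq_iff)
      then show False using key[OF u(1) v(1)] pn(1) v(2) by simp
    qed
  qed
  then show ?thesis using inj by blast
qed

text \<open>
  Choose bases \<open>U r\<close> of \<open>K r\<close> modulo boundaries. The differential carries \<open>U (r + 1)\<close> to a basis of
  the boundaries in \<open>K r\<close>, so the dimension of \<open>K r / N r\<close> is \<open>card (U r) + card (U (r + 1))\<close> and the
  alternating sum telescopes.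
\<close>

lemma euler_characteristic:
  fixes K N S :: "nat \<Rightarrow> ('x \<Rightarrow> 'k::field) set" and d :: "('x \<Rightarrow> 'k) \<Rightarrow> 'x \<Rightarrow> 'k"
  assumes d: "Vector_Spaces.linear fscale fscale d"
    and K: "\<And>r. fs.subspace (K r)" and N: "\<And>r. fs.subspace (N r)"
    and NK: "\<And>r. N r \<subseteq> K r"
    and dK: "\<And>r x. x \<in> K (Suc r) \<Longrightarrow> d x \<in> K r"
    and exact: "\<And>r. {x \<in> K (Suc r). d x \<in> N r} =
      {d y + z |y z. y \<in> K (Suc (Suc r)) \<and> z \<in> N (Suc r)}"
    and top: "\<And>r. r > n \<Longrightarrow> K r = N r"
    and S: "\<And>r. r \<le> n \<Longrightarrow> finite (S r) \<and> quot_basis (K r) (N r) (S r)"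
    and H: "finite H" "quot_basis (K 0) {d y + z |y z. y \<in> K (Suc 0) \<and> z \<in> N 0} H"
  shows "(\<Sum>r\<le>n. (- 1) ^ r * int (card (S r))) = int (card H)"
proof -
  interpret d: Vector_Spaces.linear fscale fscale d by (rule d)
  define B where "B r = {d y + z |y z. y \<in> K (Suc r) \<and> z \<in> N r}" for r
  have B: "fs.subspace (B r)" for r
  proof -
    have "B r = {x + z |x z. x \<in> d ` K (Suc r) \<and> z \<in> N r}" unfolding B_def by blast
    then show ?thesis
      using fs.subspace_sums[OF d.subspace_image[OF K] N] by simp
  qed
  have NB: "N r \<subseteq> B r" for r
  proof
    fix z assume "z \<in> N r"
    moreover have "0 \<in> K (Suc r)" by (rule fs.subspace_0[OF K])
    moreover have "z = d 0 + z" by (simp add: d.zero)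
    ultimately show "z \<in> B r" unfolding B_def by blast
  qed
  have BK: "B r \<subseteq> K r" for r
    unfolding B_def using dK NK fs.subspace_add[OF K] by blast
  have "\<exists>U. quot_basis (K r) (B r) U" for r
    using quot_basis_exists[OF K B BK] by blast
  then obtain U where U: "\<And>r. quot_basis (K r) (B r) (U r)" by metis
  \<comment> \<open>Exactness is available only from degree one upwards; the defect in degree zero
    is \<open>H\<close>.\<close>
  have exact': "{x \<in> K (Suc r). d x \<in> N r} = B (Suc r)" for r
    using exact unfolding B_def by simp
  have dU: "quot_basis (B r) (N r) (d ` U (Suc r)) \<and> inj_on d (U (Suc r))" for r
    using quot_basis_image[OF d K N, of "Suc r" r "U (Suc r)"] U[of "Suc r"]
    unfolding exact' B_def by simp
  have UdU: "quot_basis (K r) (N r) (U r \<union> d ` U (Suc r)) \<and> U r \<inter> d ` U (Suc r) = {}" for r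
    using quot_basis_trans[OF B NB BK U] dU by blast
  have card_S: "card (S r) = card (U r) + card (U (Suc r))" if "r \<le> n" for r
  proof -
    have "finite (S r)" "quot_basis (K r) (N r) (S r)" using S[OF that] by simp_all
    then have "finite (U r \<union> d ` U (Suc r)) \<and> card (U r \<union> d ` U (Suc r)) = card (S r)"
      by (rule quot_basis_card_unique[OF N _ _ conjunct1[OF UdU]])
    then have *: "finite (U r)" "finite (d ` U (Suc r))"
        "card (U r \<union> d ` U (Suc r)) = card (S r)" by simp_all
    show ?thesis
      using card_Un_disjoint[OF *(1,2) conjunct2[OF UdU]] card_image[OF conjunct2[OF dU]] *(3)
      by simp
  qed
  have U_top: "U r = {}" if "r > n" for r
  proof (rule ccontr)
    assume "U r \<noteq> {}"
    then obtain u where u: "u \<in> U r" by blast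
    then have "u \<in> K r" using U by (auto simp: quot_basis_def)
    then have "u \<in> B r" using top[OF that] NB by blast
    then show False using U[of r] u fs.span_base[of u "(U r - {u}) \<union> B r"]
      by (auto simp: quot_basis_def)
  qed
  \<comment> \<open>Truncation at \<open>m\<close> leaves one boundary term, which is zero for
    \<open>m = n\<close> because \<open>U\<close> is empty above \<open>n\<close>.\<close>
  have "(\<Sum>r\<le>m. (- 1) ^ r * int (card (S r))) = int (card (U 0)) + (- 1) ^ m * int (card (U (Suc m)))"
    if "m \<le> n" for m
    using that by (induction m) (auto simp: card_S algebra_simps)
  then have "(\<Sum>r\<le>n. (- 1) ^ r * int (card (S r))) = int (card (U 0))"
    using U_top[of "Suc n"] by simp
  moreover have "card (U 0) = card H"
    using quot_basis_card_unique[OF B H(1), of "K 0" 0 "U 0"] H(2) U[of 0] by (simp add: B_def)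
  ultimately show ?thesis by simp
qed

section \<open>Finitely supported functions\<close>

definition finsupp :: "('x \<Rightarrow> 'k::zero) \<Rightarrow> bool" where
  "finsupp x \<longleftrightarrow> finite {t. x t \<noteq> 0}"

text \<open>\<open>l\<close> is an arbitrary function, so every functional on finitely supported
  functions has this form. For \<open>x\<close> of infinite support the sum is zero by convention,
  hence the hypotheses of finite support below.\<close>

definition pairing :: "('x \<Rightarrow> 'k) \<Rightarrow> ('x \<Rightarrow> 'k::field) \<Rightarrow> 'k" where
  "pairing l x = (\<Sum>t | x t \<noteq> 0. l t * x t)"

lemma finsupp_zero: "finsupp (0 :: 'x \<Rightarrow> 'k::zero)"
  by (simp add: finsupp_def)

lemma finsupp_add: "finsupp x \<Longrightarrow> finsupp y \<Longrightarrow> finsupp (x + y)"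
  for x y :: "'x \<Rightarrow> 'k::field"
  unfolding finsupp_def
  by (rule finite_subset[of _ "{t. x t \<noteq> 0} \<union> {t. y t \<noteq> 0}"]) auto

lemma finsupp_scale: "finsupp x \<Longrightarrow> finsupp (fscale c x)"
  unfolding finsupp_def fscale_def
  by (rule finite_subset[of _ "{t. x t \<noteq> 0}"]) auto

lemma sum_fun_apply: "(\<Sum>a\<in>A. f a) x = (\<Sum>a\<in>A. f a x)"
  by (induction A rule: infinite_finite_induct) simp_all

lemma pairing_eq_sum:
  assumes "finite A" "\<And>t. x t \<noteq> 0 \<Longrightarrow> t \<in> A"
  shows "pairing l x = (\<Sum>t\<in>A. l t * x t)"
  unfolding pairing_def using assms by (intro sum.mono_neutral_left) auto

lemma pairing_zero [simp]: "pairing l 0 = 0"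
  by (simp add: pairing_def)

lemma pairing_add:
  assumes "finsupp x" "finsupp y"
  shows "pairing l (x + y) = pairing l x + pairing l y"
proof -
  let ?A = "{t. x t \<noteq> 0} \<union> {t. y t \<noteq> 0}"
  have A: "finite ?A" using assms by (simp add: finsupp_def)
  have "pairing l (x + y) = (\<Sum>t\<in>?A. l t * (x + y) t)" by (rule pairing_eq_sum[OF A]) auto
  moreover have "pairing l x = (\<Sum>t\<in>?A. l t * x t)" by (rule pairing_eq_sum[OF A]) auto
  moreover have "pairing l y = (\<Sum>t\<in>?A. l t * y t)" by (rule pairing_eq_sum[OF A]) auto
  ultimately show ?thesis by (simp add: algebra_simps sum.distrib)
qed

lemma pairing_scale:
  assumes "finsupp x"
  shows "pairing l (fscale c x) = c * pairing l x"
proof -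
  have "pairing l (fscale c x) = (\<Sum>t | x t \<noteq> 0. l t * fscale c x t)"
    using assms by (intro pairing_eq_sum) (auto simp: finsupp_def fscale_def)
  then show ?thesis by (simp add: pairing_def fscale_def sum_distrib_left mult.left_commute)
qed

lemma pairing_zero_span:
  fixes X :: "('x \<Rightarrow> 'k::field) set"
  assumes "x \<in> fs.span X" "\<And>b. b \<in> X \<Longrightarrow> finsupp b \<and> pairing l b = 0"
  shows "finsupp x \<and> pairing l x = 0"
  using assms(1)
proof (induction rule: fs.span_induct_alt)
  case base
  show ?case by (simp add: finsupp_def pairing_def)
next
  case (step c b y)
  then have "finsupp (fscale c b)" "pairing l (fscale c b) = 0"
    using assms(2)[of b] by (auto simp: finsupp_scale pairing_scale)
  then show "finsupp (fscale c b + y) \<and> pairing l (fscale c b + y) = 0"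
    using step(2) by (metis finsupp_add pairing_add add_0)
qed

lemma vector_space_pair_field:
  "vector_space_pair (fscale :: 'k::field \<Rightarrow> ('x \<Rightarrow> 'k) \<Rightarrow> 'x \<Rightarrow> 'k) ((*) :: 'k \<Rightarrow> 'k \<Rightarrow> 'k)"
  by unfold_locales (auto simp: algebra_simps)

lemma linear_functional_as_pairing:
  fixes f :: "('x \<Rightarrow> 'k::field) \<Rightarrow> 'k"
  assumes "Vector_Spaces.linear fscale (*) f" "finsupp x"
  shows "f x = pairing (\<lambda>t. f (\<lambda>u. if u = t then 1 else 0)) x"
proof -
  interpret f: Vector_Spaces.linear fscale "(*)" f by (rule assms(1))
  let ?\<delta> = "\<lambda>t u. if u = t then 1 else (0::'k)"
  have "x = (\<Sum>t | x t \<noteq> 0. fscale (x t) (?\<delta> t))"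
  proof
    fix u
    have "(\<Sum>t | x t \<noteq> 0. fscale (x t) (?\<delta> t)) u = (\<Sum>t | x t \<noteq> 0. if u = t then x t else 0)"
      by (auto simp: fscale_def sum_fun_apply intro!: sum.cong)
    also have "\<dots> = x u" using assms(2) by (simp add: finsupp_def sum.delta')
    finally show "x u = (\<Sum>t | x t \<noteq> 0. fscale (x t) (?\<delta> t)) u" by simp
  qed
  then have "f x = f (\<Sum>t | x t \<noteq> 0. fscale (x t) (?\<delta> t))" by simp
  also have "\<dots> = (\<Sum>t | x t \<noteq> 0. x t * f (?\<delta> t))" by (simp add: f.sum f.scale)
  finally show ?thesis by (simp add: pairing_def mult.commute)
qed

text \<open>Extend a basis of \<open>U\<close> by \<open>s\<close> and take a functional that is one
  on \<open>s\<close> and zero on that basis.\<close>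

lemma separating_functional:
  fixes U :: "('x \<Rightarrow> 'k::field) set"
  assumes U: "fs.subspace U" "s \<notin> U"
    and supp: "\<And>x. x \<in> insert s U \<Longrightarrow> finsupp x \<and> (\<forall>t. x t \<noteq> 0 \<longrightarrow> t \<in> W)"
  obtains l where "\<And>t. t \<notin> W \<Longrightarrow> l t = 0" "pairing l s = 1" "\<And>u. u \<in> U \<Longrightarrow> pairing l u = 0"
proof -
  obtain B0 where B0: "B0 \<subseteq> U" "fs.independent B0" "U \<subseteq> fs.span B0"
    by (rule fs.maximal_independent_subset)
  have "fs.span B0 \<subseteq> U" using B0(1) U(1) by (rule fs.span_minimal)
  then have "fs.independent (insert s B0)"
    using U(2) B0(2) by (intro fs.independent_insertI) auto
  then obtain f where f: "Vector_Spaces.linear fscale (*) f"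
      "\<And>b. b \<in> insert s B0 \<Longrightarrow> f b = (if b = s then 1 else 0)"
    using vector_space_pair.linear_independent_extend[OF vector_space_pair_field,
        of "insert s B0" "\<lambda>b. if b = s then 1 else 0"]
    by blast
  interpret f: Vector_Spaces.linear fscale "(*)" f by (rule f(1))
  \<comment> \<open>Cutting \<open>f\<close> off outside \<open>W\<close> changes none of the
    pairings in question, as all vectors involved are supported in \<open>W\<close>; it makes
    \<open>l\<close> blind to everything else.\<close>
  define l where "l t = (if t \<in> W then f (\<lambda>u. if u = t then 1 else 0) else 0)" for t
  have l: "pairing l x = f x" if "x \<in> insert s U" for x
  proof -
    have "finsupp x" "\<forall>t. x t \<noteq> 0 \<longrightarrow> t \<in> W" using supp[OF that] by auto
    then show ?thesis
      unfolding linear_functional_as_pairing[OF f(1) \<open>finsupp x\<close>] pairing_def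
      by (intro sum.cong) (auto simp: l_def)
  qed
  have B0_0: "f b = 0" if "b \<in> B0" for b using f(2)[of b] that B0(1) U(2) by auto
  show thesis
  proof
    show "l t = 0" if "t \<notin> W" for t using that by (simp add: l_def)
    show "pairing l s = 1" using l[of s] f(2)[of s] by simp
    fix u assume u: "u \<in> U"
    then have "u \<in> fs.span B0" using B0(3) by blast
    then have "f u = 0" using B0_0 f.eq_0_on_span by blast
    then show "pairing l u = 0" using l[of u] u by simp
  qed
qed

section \<open>Weight-graded spaces of trees\<close>

definition graded_space :: "('e tree \<Rightarrow> 'k::field) set \<Rightarrow> bool" where
  "graded_space V \<longleftrightarrow> fs.subspace V \<and> (\<forall>x\<in>V. finsupp x \<and> (\<forall>r. weight_part r x \<in> V))"

lemma subspace_of_weight: "fs.subspace (of_weight r :: ('e tree \<Rightarrow> 'k::field) set)"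
  by (rule fs.subspaceI) (auto simp: of_weight_def fscale_def, metis add_0)

lemma weight_part_in_of_weight: "weight_part r x \<in> of_weight r"
  by (simp add: weight_part_def of_weight_def)

lemma sum_weight_parts:
  fixes x :: "'e tree \<Rightarrow> 'k::field"
  assumes "finsupp x"
  shows "x = (\<Sum>r\<in>tree_weight ` {t. x t \<noteq> 0}. weight_part r x)"
proof
  fix t
  let ?R = "tree_weight ` {t. x t \<noteq> 0}"
  have fin: "finite ?R" using assms by (simp add: finsupp_def)
  have "(\<Sum>r\<in>?R. weight_part r x) t = (\<Sum>r\<in>?R. if tree_weight t = r then x t else 0)"
    by (simp add: sum_fun_apply weight_part_def)
  also have "\<dots> = x t" using fin by (auto simp: sum.delta')
  finally show "x t = (\<Sum>r\<in>?R. weight_part r x) t" by simp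
qed

text \<open>Finite support makes each element a finite sum of its weight parts, so spanning may be
  checked weight by weight.\<close>

lemma graded_space_span:
  fixes V X :: "('e tree \<Rightarrow> 'k::field) set"
  assumes "graded_space V" "\<And>r. V \<inter> of_weight r \<subseteq> fs.span X"
  shows "V \<subseteq> fs.span X"
proof
  fix x assume x: "x \<in> V"
  then have "weight_part r x \<in> fs.span X" for r
    using assms weight_part_in_of_weight[of r x] unfolding graded_space_def by blast
  then have "(\<Sum>r\<in>tree_weight ` {t. x t \<noteq> 0}. weight_part r x) \<in> fs.span X"
    by (rule fs.span_sum)
  moreover have "finsupp x" using assms(1) x by (simp add: graded_space_def)
  ultimately show "x \<in> fs.span X" using sum_weight_parts[of x] by simp
qed

lemma graded_space_zero: "graded_space {0 :: 'e tree \<Rightarrow> 'k::field}"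
  by (auto simp: graded_space_def finsupp_zero weight_part_def fun_eq_iff)

text \<open>Separate \<open>s\<close> from the other representatives and from \<open>B\<close>
  inside its own weight, by a functional supported on trees of that weight. It ignores all other
  weights, so it is dual to \<open>s\<close> in the union of all \<open>S r'\<close> at
  once.\<close>

lemma graded_dual_functional:
  fixes A B :: "('e tree \<Rightarrow> 'k::field) set"
  assumes A: "graded_space A" and B: "graded_space B" "B \<subseteq> A"
    and S: "\<And>r. quot_basis (A \<inter> of_weight r) (B \<inter> of_weight r) (S r)"
    and s: "s \<in> S r"
  obtains l where "pairing l s = 1"
    "\<And>r' s'. s' \<in> S r' \<Longrightarrow> s' \<noteq> s \<Longrightarrow> pairing l s' = 0" "\<And>b. b \<in> B \<Longrightarrow> pairing l b = 0"
proof -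
  define U where "U = fs.span ((S r - {s}) \<union> (B \<inter> of_weight r))"
  have A': "fs.subspace (A \<inter> of_weight r)"
    using A subspace_of_weight by (intro fs.subspace_inter) (simp_all add: graded_space_def)
  have S_sub: "S r' \<subseteq> A \<inter> of_weight r'" for r' using S by (simp add: quot_basis_def)
  have U_sub: "U \<subseteq> A \<inter> of_weight r"
    unfolding U_def using S_sub[of r] B(2) A' by (intro fs.span_minimal) auto
  have "s \<notin> U" using S[of r] s by (simp add: U_def quot_basis_def)
  moreover have "finsupp x \<and> (\<forall>t. x t \<noteq> 0 \<longrightarrow> t \<in> {t. tree_weight t = r})" if "x \<in> insert s U" for x
  proof -
    have "x \<in> A \<inter> of_weight r" using that U_sub S_sub[of r] s by auto
    then show ?thesis using A by (simp add: graded_space_def of_weight_def)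
  qed
  moreover have "fs.subspace U" unfolding U_def by (rule fs.subspace_span)
  ultimately obtain l where l: "\<And>t. t \<notin> {t. tree_weight t = r} \<Longrightarrow> l t = 0"
      "pairing l s = 1" "\<And>u. u \<in> U \<Longrightarrow> pairing l u = 0"
    using separating_functional[of U s "{t. tree_weight t = r}"] by blast
  show thesis
  proof
    show "pairing l s = 1" by (rule l(2))
    show "pairing l s' = 0" if "s' \<in> S r'" "s' \<noteq> s" for r' s'
    proof (cases "r' = r")
      case True
      then have "s' \<in> U" unfolding U_def using that by (intro fs.span_base) simp
      then show ?thesis by (rule l(3))
    next
      case False
      have "s' \<in> of_weight r'" using S_sub[of r'] that by auto
      then show ?thesis using l(1) False
        unfolding pairing_def by (intro sum.neutral) (auto simp: of_weight_def)
    qed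
    fix b assume b: "b \<in> B"
    \<comment> \<open>\<open>l\<close> sees only the weight \<open>r\<close> part of
      \<open>b\<close>, and this part lies in \<open>U\<close> because \<open>B\<close> is
      graded.\<close>
    have "weight_part r b \<in> B \<inter> of_weight r"
      using B(1) b weight_part_in_of_weight by (simp add: graded_space_def)
    then have "weight_part r b \<in> U" unfolding U_def by (intro fs.span_base) simp
    then have "pairing l (weight_part r b) = 0" by (rule l(3))
    moreover have "finsupp b" using B(1) b by (simp add: graded_space_def)
    then have "pairing l (weight_part r b) = (\<Sum>t | b t \<noteq> 0. l t * weight_part r b t)"
      by (intro pairing_eq_sum) (auto simp: finsupp_def weight_part_def split: if_splits)
    moreover have "\<dots> = pairing l b"
      unfolding pairing_def using l(1) by (intro sum.cong) (auto simp: weight_part_def)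
    ultimately show "pairing l b = 0" by simp
  qed
qed

section \<open>Tensors\<close>

text \<open>Least elements of distinct blocks differ, so for a partition the sorted list does not
  depend on the choice made by \<open>SOME\<close>.\<close>

definition block_list :: "nat set set \<Rightarrow> nat set list" where
  "block_list I = sort_key Min (SOME Is. set Is = I \<and> distinct Is)"

context
  fixes V :: "nat set" and I :: "nat set set"
  assumes I: "finite V" "partition_on V I"
begin

lemma finite_blocks: "finite I"
  using I by (rule finite_elements)

lemma inj_on_Min_blocks: "inj_on Min I"
proof (rule inj_onI)
  fix G H assume GH: "G \<in> I" "H \<in> I" "Min G = Min H"
  have "finite G" "G \<noteq> {}" "finite H" "H \<noteq> {}"
    using GH I finite_subset[of _ V] by (auto simp: partition_on_def)
  then have "Min G \<in> G \<inter> H" using GH(3) Min_in by (metis IntI)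
  then show "G = H" using partition_onD2[OF I(2)] GH by (auto simp: disjoint_def)
qed

lemma block_list: "set (block_list I) = I" "distinct (block_list I)"
    "sorted_wrt (\<lambda>G H. Min G < Min H) (block_list I)"
proof -
  have "\<exists>Is. set Is = I \<and> distinct Is" using finite_blocks by (rule finite_distinct_list)
  then have "set (SOME Is. set Is = I \<and> distinct Is) = I \<and> distinct (SOME Is. set Is = I \<and> distinct Is)"
    by (rule someI_ex)
  then show set: "set (block_list I) = I" and dist: "distinct (block_list I)"
    by (simp_all add: block_list_def)
  have "sorted (map Min (block_list I))" by (simp add: block_list_def)
  moreover have "distinct (map Min (block_list I))"
    using dist set inj_on_Min_blocks by (simp add: distinct_map)
  ultimately have "sorted_wrt (<) (map Min (block_list I))" by (simp add: strict_sorted_iff)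
  then show "sorted_wrt (\<lambda>G H. Min G < Min H) (block_list I)" by (simp add: sorted_wrt_map)
qed

text \<open>Both lists have strictly increasing least elements, and the same ones. The two
  conditions in \<open>tensor\<close> thereby become one equation between lists.\<close>

lemma sorted_leaves_iff_block_list:
  "sorted_wrt (\<lambda>t u. low t < low u) Fs \<and> leaves ` set Fs = I \<longleftrightarrow> map leaves Fs = block_list I"
proof
  assume Fs: "sorted_wrt (\<lambda>t u. low t < low u) Fs \<and> leaves ` set Fs = I"
  have "sorted_wrt (<) (map Min (map leaves Fs))"
    using Fs by (simp add: sorted_wrt_map low_def[symmetric])
  moreover have "sorted_wrt (<) (map Min (block_list I))"
    using block_list(3) by (simp add: sorted_wrt_map)
  moreover have "Min ` leaves ` set Fs = Min ` I" using Fs by simp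
  then have "set (map Min (map leaves Fs)) = set (map Min (block_list I))"
    by (simp add: image_image block_list(1))
  ultimately have "map Min (map leaves Fs) = map Min (block_list I)"
    by (metis strict_sorted_equal)
  then show "map leaves Fs = block_list I"
    using Fs block_list(1) inj_on_Min_blocks by (subst (asm) inj_on_map_eq_map) auto
next
  assume Fs: "map leaves Fs = block_list I"
  then have "sorted_wrt (\<lambda>G H. Min G < Min H) (map leaves Fs)" using block_list(3) by simp
  moreover have "set (map leaves Fs) = I" using Fs block_list(1) by simp
  ultimately show "sorted_wrt (\<lambda>t u. low t < low u) Fs \<and> leaves ` set Fs = I"
    by (simp add: sorted_wrt_map low_def)
qed

lemma tensor_apply:
  "tensor I c y (S, Fs) =
    (if map leaves Fs = block_list I then c S * (\<Prod>t\<leftarrow>Fs. y (leaves t) t) else 0)"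
  by (simp add: tensor_def sorted_leaves_iff_block_list)

lemma tensor_cong:
  fixes c :: "'e tree \<Rightarrow> 'k::field"
  assumes "\<And>G. G \<in> I \<Longrightarrow> y G = y' G"
  shows "tensor I c y = tensor I c y'"
proof
  fix p :: "'e tree \<times> 'e tree list"
  obtain S Fs where p: "p = (S, Fs)" by (cases p)
  have "(\<Prod>t\<leftarrow>Fs. y (leaves t) t) = (\<Prod>t\<leftarrow>Fs. y' (leaves t) t)"
    if "map leaves Fs = block_list I"
  proof -
    have "leaves ` set Fs = I" using that block_list(1) by (metis set_map)
    then have "map (\<lambda>t. y (leaves t) t) Fs = map (\<lambda>t. y' (leaves t) t) Fs"
      using assms by (intro map_cong) auto
    then show ?thesis by (rule arg_cong)
  qed
  then show "tensor I c y p = tensor I c y' p" by (simp add: p tensor_apply)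
qed

text \<open>At each pair the factor at \<open>G\<close> is read at one tree only, the one with leaf
  set \<open>G\<close>, so the entry is a fixed scalar times one value of \<open>a\<close>.
  Linearity in that factor is immediate from this shape.\<close>

lemma tensor_update:
  fixes c :: "'e tree \<Rightarrow> 'k::field"
  assumes G: "G \<in> I"
  obtains k \<tau> where "\<And>a. tensor I c (y(G := a)) = (\<lambda>p. k p * a (\<tau> p))"
proof -
  have "\<exists>m t. \<forall>a. tensor I c (y(G := a)) p = m * a t" for p
  proof -
    obtain S Fs where p: "p = (S, Fs)" by (cases p)
    show ?thesis
    proof (cases "map leaves Fs = block_list I")
      case True
      then have "G \<in> leaves ` set Fs" using block_list(1) G by (metis set_map)
      then obtain t where t: "t \<in> set Fs" "leaves t = G" by blast
      then obtain xs zs where Fs: "Fs = xs @ t # zs" by (meson split_list)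
      have "distinct (map leaves Fs)" unfolding True by (rule block_list(2))
      then have other: "leaves u \<noteq> G" if "u \<in> set xs \<union> set zs" for u
        using that t(2) Fs by (auto simp: image_iff)
      have "tensor I c (y(G := a)) p =
          (c S * (\<Prod>t\<leftarrow>xs. y (leaves t) t) * (\<Prod>t\<leftarrow>zs. y (leaves t) t)) * a t" for a
      proof -
        define z where "z = y(G := a)"
        have z: "map (\<lambda>t. z (leaves t) t) xs = map (\<lambda>t. y (leaves t) t) xs"
          "map (\<lambda>t. z (leaves t) t) zs = map (\<lambda>t. y (leaves t) t) zs" "z (leaves t) t = a t"
          using other t(2) by (auto simp: z_def)
        have "tensor I c z p = c S * (\<Prod>t\<leftarrow>Fs. z (leaves t) t)"
          unfolding p tensor_apply True by simp
        also have "(\<Prod>t\<leftarrow>Fs. z (leaves t) t) =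
            (\<Prod>t\<leftarrow>xs. y (leaves t) t) * (a t * (\<Prod>t\<leftarrow>zs. y (leaves t) t))"
          unfolding Fs by (simp add: z)
        finally have "tensor I c z p =
            (c S * (\<Prod>t\<leftarrow>xs. y (leaves t) t) * (\<Prod>t\<leftarrow>zs. y (leaves t) t)) * a t"
          by (simp only: mult_ac)
        then show ?thesis unfolding z_def .
      qed
      then show ?thesis by blast
    next
      case False
      then have "\<forall>a. tensor I c (y(G := a)) p = 0 * a undefined" by (simp add: p tensor_apply)
      then show ?thesis by blast
    qed
  qed
  then obtain k \<tau> where "\<And>p a. tensor I c (y(G := a)) p = k p * a (\<tau> p)" by metis
  then show thesis using that by blast
qed

lemma tensor_update_span:
  fixes c :: "'e tree \<Rightarrow> 'k::field"
  assumes G: "G \<in> I" and a: "a \<in> fs.span Y"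
    and Y: "\<And>a'. a' \<in> Y \<Longrightarrow> tensor I c (y(G := a')) \<in> fs.span X"
  shows "tensor I c (y(G := a)) \<in> fs.span X"
proof -
  obtain k \<tau> where k: "\<And>a. tensor I c (y(G := a)) = (\<lambda>p. k p * a (\<tau> p))"
    using tensor_update[OF G] by blast
  show ?thesis using a
  proof (induction rule: fs.span_induct_alt)
    case base
    have "tensor I c (y(G := 0)) = 0" unfolding k by (simp add: fun_eq_iff)
    then show "tensor I c (y(G := 0)) \<in> fs.span X" by (simp add: fs.span_zero)
  next
    case (step m b z)
    have "tensor I c (y(G := fscale m b + z)) =
        fscale m (tensor I c (y(G := b))) + tensor I c (y(G := z))"
      unfolding k by (simp add: fun_eq_iff fscale_def algebra_simps)
    also have "\<dots> \<in> fs.span X"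
      by (rule fs.span_add[OF fs.span_scale[OF Y[OF step(1)]] step(2)])
    finally show "tensor I c (y(G := fscale m b + z)) \<in> fs.span X" .
  qed
qed

text \<open>Multilinearity, with a spanning set that may vary from block to block.\<close>

lemma tensor_in_span:
  fixes c :: "'e tree \<Rightarrow> 'k::field"
  assumes c: "c \<in> fs.span A" and y: "\<And>G. G \<in> I \<Longrightarrow> y G \<in> fs.span (Y G)"
    and X: "\<And>c' y'. c' \<in> A \<Longrightarrow> (\<And>G. G \<in> I \<Longrightarrow> y' G \<in> Y G) \<Longrightarrow> tensor I c' y' \<in> fs.span X"
  shows "tensor I c y \<in> fs.span X"
proof -
  \<comment> \<open>\<open>J\<close> collects the blocks whose factors are known only to lie in the
    span; at all other blocks the factor is already a generator. The induction expands one block of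
    \<open>J\<close> at a time.\<close>
  have *: "tensor I c' y' \<in> fs.span X"
    if "c' \<in> A" "finite J" "J \<subseteq> I" "\<And>G. G \<in> J \<Longrightarrow> y' G \<in> fs.span (Y G)"
      "\<And>G. G \<in> I - J \<Longrightarrow> y' G \<in> Y G" for c' J y'
    using that(2-5)
  proof (induction J arbitrary: y' rule: finite_induct)
    case empty
    then show ?case using X[OF that(1)] by simp
  next
    case (insert H J)
    have "tensor I c' (y'(H := a)) \<in> fs.span X" if a: "a \<in> Y H" for a
    proof (rule insert.IH)
      show "J \<subseteq> I" using insert.prems(1) by simp
      show "(y'(H := a)) G \<in> fs.span (Y G)" if "G \<in> J" for G
        using insert.prems(2)[of G] insert.hyps(2) that by auto
      show "(y'(H := a)) G \<in> Y G" if "G \<in> I - J" for G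
        using insert.prems(3)[of G] a that by auto
    qed
    moreover have "H \<in> I" "y' H \<in> fs.span (Y H)"
      using insert.prems(1) insert.prems(2)[of H] by simp_all
    ultimately have "tensor I c' (y'(H := y' H)) \<in> fs.span X"
      by (metis tensor_update_span)
    then show ?case by simp
  qed
  have A: "tensor I c' y \<in> fs.span X" if "c' \<in> A" for c'
    using *[of c' I y] that y finite_blocks by simp
  show ?thesis using c
  proof (induction rule: fs.span_induct_alt)
    case base
    have "tensor I 0 y = 0" by (simp add: fun_eq_iff tensor_def)
    then show "tensor I 0 y \<in> fs.span X" by (simp add: fs.span_zero)
  next
    case (step m b z)
    have "tensor I (fscale m b + z) y = fscale m (tensor I b y) + tensor I z y"
      by (simp add: fun_eq_iff tensor_def fscale_def algebra_simps)
    then show "tensor I (fscale m b + z) y \<in> fs.span X" using A[OF step(1)] step(2) by (simp add: fs.span_add fs.span_scale)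
  qed
qed

lemma tensor_nonzero_imp:
  assumes "tensor I c y (S, Fs) \<noteq> (0::'k::field)"
  shows "map leaves Fs = block_list I" "c S \<noteq> 0" "\<And>t. t \<in> set Fs \<Longrightarrow> y (leaves t) t \<noteq> 0"
proof -
  have *: "map leaves Fs = block_list I \<and> c S * (\<Prod>t\<leftarrow>Fs. y (leaves t) t) \<noteq> 0"
    using assms by (simp add: tensor_apply split: if_splits)
  then show "map leaves Fs = block_list I" "c S \<noteq> 0" by simp_all
  have "0 \<notin> set (map (\<lambda>t. y (leaves t) t) Fs)" using * by (simp add: prod_list_zero_iff)
  then show "y (leaves t) t \<noteq> 0" if "t \<in> set Fs" for t using that by auto
qed

lemma tensor_support_weight:
  assumes c: "c \<in> of_weight r" and y: "\<And>G. G \<in> I \<Longrightarrow> y G \<in> of_weight (w G)"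
    and nz: "tensor I c y (S, Fs) \<noteq> (0::'k::field)"
  shows "tree_weight S = r" "(\<Sum>t\<leftarrow>Fs. tree_weight t) = (\<Sum>G\<in>I. w G)"
proof -
  note nz' = tensor_nonzero_imp[OF nz]
  show "tree_weight S = r" using c nz'(2) by (simp add: of_weight_def)
  have "leaves t \<in> I" if "t \<in> set Fs" for t
    using that nz'(1) block_list(1) by (metis image_eqI set_map)
  then have "y (leaves t) \<in> of_weight (w (leaves t))" if "t \<in> set Fs" for t
    using that y by simp
  then have "tree_weight t = w (leaves t)" if "t \<in> set Fs" for t
    using that nz'(3)[OF that] unfolding of_weight_def by blast
  then have "map tree_weight Fs = map (\<lambda>t. w (leaves t)) Fs" by simp
  also have "\<dots> = map w (map leaves Fs)" by simp
  also have "\<dots> = map w (block_list I)" unfolding nz'(1) ..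
  finally have "(\<Sum>t\<leftarrow>Fs. tree_weight t) = (\<Sum>G\<leftarrow>block_list I. w G)" by simp
  also have "\<dots> = (\<Sum>G\<in>I. w G)"
    using block_list(1,2) by (metis sum_list_distinct_conv_sum_set)
  finally show "(\<Sum>t\<leftarrow>Fs. tree_weight t) = (\<Sum>G\<in>I. w G)" .
qed

section \<open>Pairing pure tensors with tensor products of functionals\<close>

context
  fixes c :: "'e tree \<Rightarrow> 'k::field" and y :: "nat set \<Rightarrow> 'e tree \<Rightarrow> 'k"
  assumes c: "finsupp c"
    and y: "\<And>G. G \<in> I \<Longrightarrow> finsupp (y G)" "\<And>G t. G \<in> I \<Longrightarrow> y G t \<noteq> 0 \<Longrightarrow> leaves t = G"
begin

text \<open>A pair with non-zero entry is a tree \<open>S\<close> together with one choice of a tree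
  for each block, listed along \<open>block_list I\<close>. Describing supports by choice functions
  makes them finite and prepares the factorisation of sums.\<close>

lemma tensor_support:
  assumes "tensor I c y (S, Fs) \<noteq> 0"
  shows "(S, Fs) \<in> {S. c S \<noteq> 0} \<times> (\<lambda>f. map f (block_list I)) ` (\<Pi>\<^sub>E G\<in>I. {t. y G t \<noteq> 0})"
proof -
  note nz = tensor_nonzero_imp[OF assms]
  have ex: "\<exists>t\<in>set Fs. leaves t = G" if "G \<in> I" for G
    using that nz(1) block_list(1) by (metis (no_types) image_iff set_map)
  \<comment> \<open>The value \<open>undefined\<close> outside \<open>I\<close> makes
    \<open>f\<close> extensional, as membership in \<open>PiE\<close> requires.\<close>
  define f where "f G = (if G \<in> I then SOME t. t \<in> set Fs \<and> leaves t = G else undefined)" for G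
  have inj: "inj_on leaves (set Fs)" using block_list(2) nz(1) by (metis distinct_map)
  have f: "f G \<in> set Fs \<and> leaves (f G) = G" if "G \<in> I" for G
  proof -
    have "\<exists>t. t \<in> set Fs \<and> leaves t = G" using ex[OF that] by blast
    then show ?thesis using someI_ex[of "\<lambda>t. t \<in> set Fs \<and> leaves t = G"] that by (simp add: f_def)
  qed
  have I: "leaves t \<in> I" if "t \<in> set Fs" for t
    using that nz(1) block_list(1) by (metis image_eqI set_map)
  have "map f (block_list I) = map f (map leaves Fs)" unfolding nz(1) ..
  also have "\<dots> = map (\<lambda>t. f (leaves t)) Fs" by simp
  also have "\<dots> = map (\<lambda>t. t) Fs"
  proof (intro map_cong refl)
    fix t assume "t \<in> set Fs"
    then show "f (leaves t) = t" using f[OF I] inj_onD[OF inj] by blast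
  qed
  finally have Fs: "Fs = map f (block_list I)" by simp
  have "y G (f G) \<noteq> 0" if "G \<in> I" for G using f[OF that] nz(3)[of "f G"] by simp
  then have "f \<in> (\<Pi>\<^sub>E G\<in>I. {t. y G t \<noteq> 0})" by (auto simp: f_def)
  then show ?thesis using Fs nz(2) by blast
qed

lemma finite_tensor_support:
  "finite ({S. c S \<noteq> 0} \<times> (\<lambda>f. map f (block_list I)) ` (\<Pi>\<^sub>E G\<in>I. {t. y G t \<noteq> 0}))"
  using c y(1) finite_blocks
  by (intro finite_cartesian_product finite_imageI finite_PiE) (auto simp: finsupp_def)

lemma finsupp_tensor: "finsupp (tensor I c y)"
proof -
  have "{p. tensor I c y p \<noteq> 0} \<subseteq>
      {S. c S \<noteq> 0} \<times> (\<lambda>f. map f (block_list I)) ` (\<Pi>\<^sub>E G\<in>I. {t. y G t \<noteq> 0})"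
    using tensor_support by auto
  then show ?thesis unfolding finsupp_def using finite_tensor_support by (rule finite_subset)
qed

text \<open>A sum over a product of supports factorises. That trees in the support of
  \<open>y G\<close> have leaf set \<open>G\<close> matters here, because \<open>tensor\<close>
  reads off the block from the tree.\<close>

lemma pairing_tensor_tensor:
  "pairing (tensor I \<alpha> \<beta>) (tensor I c y) = pairing \<alpha> c * (\<Prod>G\<in>I. pairing (\<beta> G) (y G))"
proof -
  let ?E = "\<Pi>\<^sub>E G\<in>I. {t. y G t \<noteq> 0}" and ?m = "\<lambda>f. map f (block_list I)"
  have inj: "inj_on ?m ?E"
    using block_list(1) by (intro inj_onI PiE_ext) auto
  have term_eq: "tensor I \<alpha> \<beta> (S, ?m f) * tensor I c y (S, ?m f) =
      (\<alpha> S * c S) * (\<Prod>G\<in>I. \<beta> G (f G) * y G (f G))" if f: "f \<in> ?E" for S f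
  proof -
    have lf: "leaves (f G) = G" if "G \<in> I" for G using f y(2) that by auto
    then have "map leaves (?m f) = block_list I"
      unfolding map_map comp_def using block_list(1) by (intro map_idI) simp
    moreover have "(\<Prod>t\<leftarrow>?m f. z (leaves t) t) = (\<Prod>G\<in>I. z G (f G))"
      for z :: "nat set \<Rightarrow> 'e tree \<Rightarrow> 'k"
    proof -
      have "(\<Prod>t\<leftarrow>?m f. z (leaves t) t) = (\<Prod>G\<leftarrow>block_list I. z (leaves (f G)) (f G))"
        by (simp add: comp_def)
      also have "\<dots> = (\<Prod>G\<in>I. z (leaves (f G)) (f G))"
        using block_list(1,2) by (metis prod.distinct_set_conv_list)
      also have "\<dots> = (\<Prod>G\<in>I. z G (f G))" by (intro prod.cong) (auto simp: lf)
      finally show ?thesis .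
    qed
    ultimately show ?thesis by (simp add: tensor_apply prod.distrib)
  qed
  have "pairing (tensor I \<alpha> \<beta>) (tensor I c y) =
      (\<Sum>p\<in>{S. c S \<noteq> 0} \<times> ?m ` ?E. tensor I \<alpha> \<beta> p * tensor I c y p)"
    using tensor_support by (intro pairing_eq_sum finite_tensor_support) auto
  also have "\<dots> = (\<Sum>S | c S \<noteq> 0. \<Sum>Fs\<in>?m ` ?E. tensor I \<alpha> \<beta> (S, Fs) * tensor I c y (S, Fs))"
    by (simp add: sum.cartesian_product)
  also have "\<dots> = (\<Sum>S | c S \<noteq> 0. \<Sum>f\<in>?E. tensor I \<alpha> \<beta> (S, ?m f) * tensor I c y (S, ?m f))"
    by (simp add: sum.reindex[OF inj] comp_def)
  also have "\<dots> = (\<Sum>S | c S \<noteq> 0. \<Sum>f\<in>?E. (\<alpha> S * c S) * (\<Prod>G\<in>I. \<beta> G (f G) * y G (f G)))"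
    by (intro sum.cong refl term_eq)
  also have "\<dots> = pairing \<alpha> c * (\<Sum>f\<in>?E. \<Prod>G\<in>I. \<beta> G (f G) * y G (f G))"
    by (simp add: pairing_def sum_product)
  also have "(\<Sum>f\<in>?E. \<Prod>G\<in>I. \<beta> G (f G) * y G (f G)) = (\<Prod>G\<in>I. pairing (\<beta> G) (y G))"
    unfolding pairing_def using finite_blocks y(1)
    by (subst prod_sum_PiE) (auto simp: finsupp_def)
  finally show ?thesis .
qed

end

end

text \<open>The leaf sets in a pair determine its partition, so the two supports are
  disjoint.\<close>

lemma pairing_tensor_distinct:
  assumes "I \<noteq> I'"
  shows "pairing (tensor I \<alpha> \<beta>) (tensor I' c y) = 0"
  unfolding pairing_def using assms by (intro sum.neutral) (auto simp: tensor_def)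

section \<open>Homogeneous bases of contraction products\<close>

text \<open>The second entry is the total weight, and not the weight of the upper trees, because the
  differential preserves it while lowering the first entry by one.\<close>

definition grade :: "'e tree \<times> 'e tree list \<Rightarrow> nat \<times> nat" where
  "grade = (\<lambda>(S, Fs). (tree_weight S, tree_weight S + (\<Sum>t\<leftarrow>Fs. tree_weight t)))"

definition grade_part ::
    "nat \<times> nat \<Rightarrow> ('e tree \<times> 'e tree list \<Rightarrow> 'k::field) \<Rightarrow> 'e tree \<times> 'e tree list \<Rightarrow> 'k" where
  "grade_part \<gamma> x = (\<lambda>p. if grade p = \<gamma> then x p else 0)"

definition of_grade :: "nat \<times> nat \<Rightarrow> ('e tree \<times> 'e tree list \<Rightarrow> 'k::field) set" where
  "of_grade \<gamma> = {x. \<forall>p. x p \<noteq> 0 \<longrightarrow> grade p = \<gamma>}"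

lemma linear_grade_part: "Vector_Spaces.linear fscale fscale (grade_part \<gamma>)"
  by (simp add: Vector_Spaces.linear_iff fs.vector_space_axioms)
    (auto simp: grade_part_def fscale_def fun_eq_iff)

lemma grade_part_in_of_grade: "grade_part \<gamma> x \<in> of_grade \<gamma>"
  by (simp add: grade_part_def of_grade_def)

lemma grade_part_of_grade: "x \<in> of_grade \<gamma> \<Longrightarrow> grade_part \<delta> x = (if \<delta> = \<gamma> then x else 0)"
  by (force simp: grade_part_def of_grade_def fun_eq_iff)

lemma subspace_of_grade: "fs.subspace (of_grade \<gamma> :: ('e tree \<times> 'e tree list \<Rightarrow> 'k::field) set)"
  by (rule fs.subspaceI) (auto simp: of_grade_def fscale_def, metis add_0)

text \<open>Projection to a grade is linear and sends each homogeneous generator to itself or to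
  zero.\<close>

lemma grade_part_span:
  fixes X :: "('e tree \<times> 'e tree list \<Rightarrow> 'k::field) set"
  assumes x: "x \<in> fs.span X" and X: "\<And>b. b \<in> X \<Longrightarrow> \<exists>\<gamma>. b \<in> of_grade \<gamma>"
  shows "grade_part \<gamma> x \<in> fs.span (X \<inter> of_grade \<gamma>)"
proof -
  interpret g: Vector_Spaces.linear fscale fscale "grade_part \<gamma> :: _ \<Rightarrow> _ \<Rightarrow> 'k"
    by (rule linear_grade_part)
  have "grade_part \<gamma> b \<in> fs.span (X \<inter> of_grade \<gamma>)" if "b \<in> X" for b
  proof -
    obtain \<delta> where "b \<in> of_grade \<delta>" using X[OF \<open>b \<in> X\<close>] by blast
    then show ?thesis using that fs.span_base[of b "X \<inter> of_grade \<gamma>"] fs.span_zero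
      by (cases "\<gamma> = \<delta>") (auto simp: grade_part_of_grade)
  qed
  then have "fs.span (grade_part \<gamma> ` X) \<subseteq> fs.span (X \<inter> of_grade \<gamma>)"
    by (intro fs.span_minimal fs.subspace_span) blast
  moreover have "grade_part \<gamma> x \<in> fs.span (grade_part \<gamma> ` X)" using x by (simp add: g.span_image)
  ultimately show ?thesis by blast
qed

text \<open>Bases are collected over all weights; this recovers the weight of a single element. The
  chosen tree does not matter for non-zero homogeneous elements, and zero is never a basis
  element.\<close>

definition weight_of :: "('e tree \<Rightarrow> 'k::field) \<Rightarrow> nat" where
  "weight_of x = tree_weight (SOME t. x t \<noteq> 0)"

lemma weight_of_eq:
  assumes "x \<in> of_weight r" "x \<noteq> 0"
  shows "weight_of x = r"
proof -
  have "\<exists>t. x t \<noteq> 0" using assms(2) by (auto simp: fun_eq_iff)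
  then have "x (SOME t. x t \<noteq> 0) \<noteq> 0" by (rule someI_ex)
  then show ?thesis using assms(1) by (simp add: weight_of_def of_weight_def)
qed

lemma zero_notin_quot_basis: "quot_basis A B S \<Longrightarrow> 0 \<notin> S"
  using fs.span_zero by (auto simp: quot_basis_def)

lemma finite_graph_partitions: "finite (verts \<Gamma>) \<Longrightarrow> finite (graph_partitions \<Gamma>)"
  by (rule finite_subset[of _ "{I. partition_on (verts \<Gamma>) I}"])
    (auto simp: graph_partitions_def finitely_many_partition_on)

text \<open>The product of \<open>C\<close> with the quotient \<open>F / N\<close> on one graph.
  \<open>C\<close> is not a quotient; its bases are written modulo \<open>{0}\<close> so that
  \<open>graded_dual_functional\<close> serves both factors.\<close>

locale contraction_bases =
  fixes \<Gamma> :: graph and C F N :: "graph \<Rightarrow> ('e tree \<Rightarrow> 'k::field) set"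
    and A S :: "nat \<Rightarrow> graph \<Rightarrow> ('e tree \<Rightarrow> 'k) set"
  assumes finite_verts: "finite (verts \<Gamma>)"
    and C: "\<And>I. I \<in> graph_partitions \<Gamma> \<Longrightarrow> graded_space (C (contract \<Gamma> I))"
    and F: "\<And>I G. I \<in> graph_partitions \<Gamma> \<Longrightarrow> G \<in> I \<Longrightarrow> graded_space (F (induced \<Gamma> G))"
    and N: "\<And>I G. I \<in> graph_partitions \<Gamma> \<Longrightarrow> G \<in> I \<Longrightarrow> graded_space (N (induced \<Gamma> G))"
    and NF: "\<And>I G. I \<in> graph_partitions \<Gamma> \<Longrightarrow> G \<in> I \<Longrightarrow> N (induced \<Gamma> G) \<subseteq> F (induced \<Gamma> G)"
    and F_leaves: "\<And>I G x t. I \<in> graph_partitions \<Gamma> \<Longrightarrow> G \<in> I \<Longrightarrow> x \<in> F (induced \<Gamma> G) \<Longrightarrow>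
      x t \<noteq> 0 \<Longrightarrow> leaves t = G"
    and A: "\<And>I r. I \<in> graph_partitions \<Gamma> \<Longrightarrow>
      quot_basis (C (contract \<Gamma> I) \<inter> of_weight r) ({0} \<inter> of_weight r) (A r (contract \<Gamma> I))"
    and S: "\<And>I G r. I \<in> graph_partitions \<Gamma> \<Longrightarrow> G \<in> I \<Longrightarrow>
      quot_basis (F (induced \<Gamma> G) \<inter> of_weight r) (N (induced \<Gamma> G) \<inter> of_weight r)
        (S r (induced \<Gamma> G))"
begin

text \<open>\<open>PiE\<close> fixes \<open>y\<close> outside \<open>I\<close>, where the tensor
  does not depend on it; otherwise one tensor would have many indices. Cardinalities are computed on
  indices and transferred by injectivity.\<close>

definition basis_index :: "nat \<times> nat \<Rightarrow>
    (nat set set \<times> ('e tree \<Rightarrow> 'k) \<times> (nat set \<Rightarrow> 'e tree \<Rightarrow> 'k)) set" where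
  "basis_index = (\<lambda>(r, n). SIGMA I:graph_partitions \<Gamma>. A r (contract \<Gamma> I) \<times>
    {y \<in> \<Pi>\<^sub>E G\<in>I. \<Union>s. S s (induced \<Gamma> G). r + (\<Sum>G\<in>I. weight_of (y G)) = n})"

abbreviation basis_tensor where "basis_tensor \<equiv> (\<lambda>(I, c, y). tensor I c y)"

lemma partition: "I \<in> graph_partitions \<Gamma> \<Longrightarrow> partition_on (verts \<Gamma>) I"
  by (simp add: graph_partitions_def)

lemma A_sub: "I \<in> graph_partitions \<Gamma> \<Longrightarrow> A r (contract \<Gamma> I) \<subseteq> C (contract \<Gamma> I) \<inter> of_weight r"
  using A by (simp add: quot_basis_def)

lemma S_sub: "I \<in> graph_partitions \<Gamma> \<Longrightarrow> G \<in> I \<Longrightarrow>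
    S r (induced \<Gamma> G) \<subseteq> F (induced \<Gamma> G) \<inter> of_weight r"
  using S by (simp add: quot_basis_def)

lemma weight_of_S:
  assumes "I \<in> graph_partitions \<Gamma>" "G \<in> I" "x \<in> S s (induced \<Gamma> G)"
  shows "weight_of x = s"
  using assms S_sub[of I G s] zero_notin_quot_basis[OF S[of I G s]] by (metis IntD2 subsetD weight_of_eq)

lemma span_A:
  assumes "I \<in> graph_partitions \<Gamma>"
  shows "C (contract \<Gamma> I) \<subseteq> fs.span (\<Union>r. A r (contract \<Gamma> I))"
proof (rule graded_space_span[OF C[OF assms]])
  fix r
  have "C (contract \<Gamma> I) \<inter> of_weight r \<subseteq> fs.span (A r (contract \<Gamma> I) \<union> ({0} \<inter> of_weight r))"
    using A[OF assms] by (simp add: quot_basis_def)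
  also have "\<dots> \<subseteq> fs.span (insert 0 (\<Union>r. A r (contract \<Gamma> I)))"
    by (intro fs.span_mono) auto
  also have "\<dots> = fs.span (\<Union>r. A r (contract \<Gamma> I))" by (rule fs.span_insert_0)
  finally show "C (contract \<Gamma> I) \<inter> of_weight r \<subseteq> fs.span (\<Union>r. A r (contract \<Gamma> I))" .
qed

text \<open>Homogeneous generators of \<open>F\<close> adapted to the quotient: each is a chosen
  representative or belongs to \<open>N\<close>.\<close>

definition upper_generators :: "nat set \<Rightarrow> ('e tree \<Rightarrow> 'k) set" where
  "upper_generators G = (\<Union>s. S s (induced \<Gamma> G) \<union> (N (induced \<Gamma> G) \<inter> of_weight s))"

lemma span_upper_generators:
  assumes "I \<in> graph_partitions \<Gamma>" "G \<in> I"
  shows "F (induced \<Gamma> G) \<subseteq> fs.span (upper_generators G)"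
proof (rule graded_space_span[OF F[OF assms]])
  fix r
  have "F (induced \<Gamma> G) \<inter> of_weight r \<subseteq>
      fs.span (S r (induced \<Gamma> G) \<union> (N (induced \<Gamma> G) \<inter> of_weight r))"
    using S[OF assms] by (simp add: quot_basis_def)
  also have "\<dots> \<subseteq> fs.span (upper_generators G)"
    unfolding upper_generators_def by (intro fs.span_mono) auto
  finally show "F (induced \<Gamma> G) \<inter> of_weight r \<subseteq> fs.span (upper_generators G)" .
qed

lemma span_N:
  assumes "I \<in> graph_partitions \<Gamma>" "G \<in> I"
  shows "N (induced \<Gamma> G) \<subseteq> fs.span (\<Union>s. N (induced \<Gamma> G) \<inter> of_weight s)"
proof (rule graded_space_span[OF N[OF assms]])
  fix r
  have "N (induced \<Gamma> G) \<inter> of_weight r \<subseteq> (\<Union>s. N (induced \<Gamma> G) \<inter> of_weight s)" by blast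
  also have "\<dots> \<subseteq> fs.span \<dots>" by (rule fs.span_superset)
  finally show "N (induced \<Gamma> G) \<inter> of_weight r \<subseteq> fs.span (\<Union>s. N (induced \<Gamma> G) \<inter> of_weight s)" .
qed

lemma upper_generators:
  assumes "I \<in> graph_partitions \<Gamma>" "G \<in> I" "x \<in> upper_generators G"
  shows "x \<in> F (induced \<Gamma> G)" "\<exists>s. x \<in> of_weight s"
  using assms S_sub[OF assms(1,2)] NF[OF assms(1,2)] by (auto simp: upper_generators_def)

text \<open>Homogeneous generators of the kernel. Its defining tensors may have mixed grades,
  whereas projection to a grade calls for homogeneous generators.\<close>

definition null_tensors :: "('e tree \<times> 'e tree list \<Rightarrow> 'k) set" where
  "null_tensors = {tensor I c y | I c y. I \<in> graph_partitions \<Gamma> \<and>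
    c \<in> (\<Union>r. A r (contract \<Gamma> I)) \<and> (\<forall>G\<in>I. y G \<in> upper_generators G) \<and>
    (\<exists>G\<in>I. y G \<in> N (induced \<Gamma> G))}"

definition basis_tensors :: "('e tree \<times> 'e tree list \<Rightarrow> 'k) set" where
  "basis_tensors = (\<Union>\<gamma>. basis_tensor ` basis_index \<gamma>)"

lemma tensor_of_grade:
  assumes I: "I \<in> graph_partitions \<Gamma>" and c: "c \<in> of_weight r"
    and y: "\<And>G. G \<in> I \<Longrightarrow> y G \<in> of_weight (w G)"
  shows "tensor I c y \<in> of_grade (r, r + (\<Sum>G\<in>I. w G))"
  unfolding of_grade_def
proof (intro CollectI allI impI)
  fix p assume nz: "tensor I c y p \<noteq> 0"
  obtain T Fs where p: "p = (T, Fs)" by (cases p)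
  show "grade p = (r, r + (\<Sum>G\<in>I. w G))"
    using tensor_support_weight[OF finite_verts partition[OF I] c y nz[unfolded p]]
    by (simp add: grade_def p)
qed

lemma basis_tensor_of_grade:
  assumes "i \<in> basis_index \<gamma>"
  shows "basis_tensor i \<in> of_grade \<gamma>"
proof -
  obtain r n I c y where \<gamma>: "\<gamma> = (r, n)" and i: "i = (I, c, y)" by (cases \<gamma>, cases i)
  have I: "I \<in> graph_partitions \<Gamma>" and c: "c \<in> A r (contract \<Gamma> I)"
    and y: "\<And>G. G \<in> I \<Longrightarrow> y G \<in> (\<Union>s. S s (induced \<Gamma> G))"
    and n: "r + (\<Sum>G\<in>I. weight_of (y G)) = n"
    using assms by (auto simp: \<gamma> i basis_index_def)
  have "y G \<in> of_weight (weight_of (y G))" if G: "G \<in> I" for G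
  proof -
    obtain s where "y G \<in> S s (induced \<Gamma> G)" using y[OF G] by blast
    then show ?thesis using weight_of_S[OF I G] S_sub[OF I G, of s] by auto
  qed
  then show ?thesis
    using tensor_of_grade[OF I, of c r y "\<lambda>G. weight_of (y G)"] A_sub[OF I] c n
    by (auto simp: \<gamma> i)
qed

lemma null_tensor_of_grade:
  assumes "b \<in> null_tensors"
  shows "\<exists>\<gamma>. b \<in> of_grade \<gamma>"
proof -
  obtain I c y r where b: "b = tensor I c y" and I: "I \<in> graph_partitions \<Gamma>"
    and c: "c \<in> A r (contract \<Gamma> I)" and y: "\<And>G. G \<in> I \<Longrightarrow> y G \<in> upper_generators G"
    using assms by (auto simp: null_tensors_def)
  have "\<forall>G\<in>I. \<exists>s. y G \<in> of_weight s" using upper_generators(2)[OF I] y by blast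
  then obtain w where "\<And>G. G \<in> I \<Longrightarrow> y G \<in> of_weight (w G)" by metis
  then have "b \<in> of_grade (r, r + (\<Sum>G\<in>I. w G))"
    unfolding b using A_sub[OF I] c by (intro tensor_of_grade[OF I]) auto
  then show ?thesis by blast
qed

lemma generator_of_grade: "b \<in> basis_tensors \<union> null_tensors \<Longrightarrow> \<exists>\<gamma>. b \<in> of_grade \<gamma>"
  using basis_tensor_of_grade null_tensor_of_grade unfolding basis_tensors_def by blast

text \<open>By multilinearity all factors may be taken among the generators. Then either some upper
  factor is in \<open>N\<close>, which gives a null tensor, or every upper factor is a chosen
  representative, which gives a basis tensor.\<close>

lemma contraction_product_subset:
  "contraction_product C F \<Gamma> \<subseteq> fs.span (basis_tensors \<union> null_tensors)"
  unfolding contraction_product_def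
proof (rule fs.span_minimal[OF _ fs.subspace_span], clarify)
  fix I c y
  assume I: "I \<in> graph_partitions \<Gamma>" and c: "c \<in> C (contract \<Gamma> I)"
    and y: "\<forall>G\<in>I. y G \<in> F (induced \<Gamma> G)"
  note P = finite_verts partition[OF I]
  show "tensor I c y \<in> fs.span (basis_tensors \<union> null_tensors)"
  proof (rule tensor_in_span[OF P])
    show "c \<in> fs.span (\<Union>r. A r (contract \<Gamma> I))" using span_A[OF I] c by blast
    show "y G \<in> fs.span (upper_generators G)" if "G \<in> I" for G
      using span_upper_generators[OF I that] y that by blast
    fix c' y' assume c': "c' \<in> (\<Union>r. A r (contract \<Gamma> I))"
      and y': "\<And>G. G \<in> I \<Longrightarrow> y' G \<in> upper_generators G"
    have "tensor I c' y' \<in> basis_tensors \<union> null_tensors"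
    proof (cases "\<exists>G\<in>I. y' G \<in> N (induced \<Gamma> G)")
      case True
      then have "tensor I c' y' \<in> null_tensors" unfolding null_tensors_def using I c' y' by blast
      then show ?thesis by blast
    next
      case False
      obtain r where r: "c' \<in> A r (contract \<Gamma> I)" using c' by blast
      have "y' G \<in> (\<Union>s. S s (induced \<Gamma> G))" if "G \<in> I" for G
        using y'[OF that] False that by (auto simp: upper_generators_def)
      \<comment> \<open>Restricting \<open>y'\<close> to \<open>I\<close> makes it an admissible
        index without changing the tensor.\<close>
      then have "(I, c', restrict y' I) \<in> basis_index (r, r + (\<Sum>G\<in>I. weight_of (y' G)))"
        using I r by (simp add: basis_index_def)
      then have "tensor I c' (restrict y' I) \<in> basis_tensors"
        unfolding basis_tensors_def by (intro UN_I[OF UNIV_I] image_eqI[rotated]) auto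
      moreover have "tensor I c' (restrict y' I) = tensor I c' y'"
        by (rule tensor_cong[OF P]) simp
      ultimately show ?thesis by simp
    qed
    then show "tensor I c' y' \<in> fs.span (basis_tensors \<union> null_tensors)" by (rule fs.span_base)
  qed
qed

lemma contraction_product_ker_subset:
  "contraction_product_ker C F N \<Gamma> \<subseteq> fs.span null_tensors"
  unfolding contraction_product_ker_def
proof (rule fs.span_minimal[OF _ fs.subspace_span], clarify)
  fix I c y H
  assume I: "I \<in> graph_partitions \<Gamma>" and c: "c \<in> C (contract \<Gamma> I)"
    and y: "\<forall>G\<in>I. y G \<in> F (induced \<Gamma> G)" and H: "H \<in> I" "y H \<in> N (induced \<Gamma> H)"
  note P = finite_verts partition[OF I]
  let ?Y = "\<lambda>G. if G = H then (\<Union>s. N (induced \<Gamma> G) \<inter> of_weight s) else upper_generators G"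
  show "tensor I c y \<in> fs.span null_tensors"
  proof (rule tensor_in_span[OF P])
    show "c \<in> fs.span (\<Union>r. A r (contract \<Gamma> I))" using span_A[OF I] c by blast
    show "y G \<in> fs.span (?Y G)" if "G \<in> I" for G
      using span_upper_generators[OF I that] span_N[OF I that] y H that
      by (cases "G = H") (simp_all, blast+)
    fix c' y' assume c': "c' \<in> (\<Union>r. A r (contract \<Gamma> I))"
      and y': "\<And>G. G \<in> I \<Longrightarrow> y' G \<in> ?Y G"
    have "y' G \<in> upper_generators G" if "G \<in> I" for G
      using y'[OF that] by (auto simp: upper_generators_def split: if_splits)
    moreover have "y' H \<in> N (induced \<Gamma> H)" using y'[OF H(1)] by auto
    ultimately have "tensor I c' y' \<in> null_tensors"
      unfolding null_tensors_def using I c' H(1) by blast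
    then show "tensor I c' y' \<in> fs.span null_tensors" by (rule fs.span_base)
  qed
qed

lemma null_tensors_subset: "null_tensors \<subseteq> contraction_product_ker C F N \<Gamma>"
proof
  fix b assume "b \<in> null_tensors"
  then obtain I c y r where b: "b = tensor I c y" and I: "I \<in> graph_partitions \<Gamma>"
    and c: "c \<in> A r (contract \<Gamma> I)" and y: "\<forall>G\<in>I. y G \<in> upper_generators G"
      "\<exists>G\<in>I. y G \<in> N (induced \<Gamma> G)"
    unfolding null_tensors_def by blast
  have "\<forall>G\<in>I. y G \<in> F (induced \<Gamma> G)" using y(1) upper_generators(1)[OF I] by blast
  moreover have "c \<in> C (contract \<Gamma> I)" using A_sub[OF I] c by blast
  ultimately show "b \<in> contraction_product_ker C F N \<Gamma>"
    unfolding contraction_product_ker_def b using I y(2) by (intro fs.span_base) blast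
qed

lemma contraction_product_ker_le:
  "contraction_product_ker C F N \<Gamma> \<subseteq> contraction_product C F \<Gamma>"
  unfolding contraction_product_ker_def contraction_product_def by (intro fs.span_mono) blast

lemma basis_tensors_subset: "basis_tensors \<subseteq> contraction_product C F \<Gamma>"
proof
  fix b assume "b \<in> basis_tensors"
  then obtain r n I c y where b: "b = tensor I c y" and i: "(I, c, y) \<in> basis_index (r, n)"
    by (auto simp: basis_tensors_def)
  then have I: "I \<in> graph_partitions \<Gamma>" and c: "c \<in> A r (contract \<Gamma> I)"
    and y: "\<And>G. G \<in> I \<Longrightarrow> y G \<in> (\<Union>s. S s (induced \<Gamma> G))"
    by (auto simp: basis_index_def)
  have "\<forall>G\<in>I. y G \<in> F (induced \<Gamma> G)" using y S_sub[OF I] by blast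
  moreover have "c \<in> C (contract \<Gamma> I)" using A_sub[OF I] c by blast
  ultimately show "b \<in> contraction_product C F \<Gamma>"
    unfolding contraction_product_def b using I by (intro fs.span_base) blast
qed

text \<open>A space spanned by homogeneous tensors contains the homogeneous components of its
  elements. This allows the quotient to be treated one grade at a time.\<close>

lemma grade_part_contraction_product:
  assumes "x \<in> contraction_product C F \<Gamma>"
  shows "grade_part \<gamma> x \<in> contraction_product C F \<Gamma>"
proof -
  have "grade_part \<gamma> x \<in> fs.span ((basis_tensors \<union> null_tensors) \<inter> of_grade \<gamma>)"
    using assms contraction_product_subset generator_of_grade by (intro grade_part_span) blast+
  moreover have "fs.span ((basis_tensors \<union> null_tensors) \<inter> of_grade \<gamma>) \<subseteq> contraction_product C F \<Gamma>"
    using basis_tensors_subset null_tensors_subset contraction_product_ker_le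
    by (intro fs.span_minimal) (auto simp: contraction_product_def)
  ultimately show ?thesis by blast
qed

lemma grade_part_contraction_product_ker:
  assumes "x \<in> contraction_product_ker C F N \<Gamma>"
  shows "grade_part \<gamma> x \<in> contraction_product_ker C F N \<Gamma>"
proof -
  have "grade_part \<gamma> x \<in> fs.span (null_tensors \<inter> of_grade \<gamma>)"
    using assms contraction_product_ker_subset null_tensor_of_grade
    by (intro grade_part_span) blast+
  moreover have "fs.span (null_tensors \<inter> of_grade \<gamma>) \<subseteq> contraction_product_ker C F N \<Gamma>"
    using null_tensors_subset
    by (intro fs.span_minimal) (auto simp: contraction_product_ker_def)
  ultimately show ?thesis by blast
qed

text \<open>
  A tensor product of functionals that are dual to the basis elements of the factors vanishes on all
  other basis tensors and on the kernel, which gives linear independence.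
\<close>

lemma dual_functional:
  assumes "i \<in> basis_index \<gamma>"
  obtains l where "pairing l (basis_tensor i) = 1"
    "\<And>j \<delta>. j \<in> basis_index \<delta> \<Longrightarrow> j \<noteq> i \<Longrightarrow> finsupp (basis_tensor j) \<and> pairing l (basis_tensor j) = 0"
    "\<And>x. x \<in> contraction_product_ker C F N \<Gamma> \<Longrightarrow> pairing l x = 0"
proof -
  obtain r n I c y where \<gamma>: "\<gamma> = (r, n)" and i: "i = (I, c, y)" by (cases \<gamma>, cases i)
  have I: "I \<in> graph_partitions \<Gamma>" and c: "c \<in> A r (contract \<Gamma> I)"
    and y: "y \<in> (\<Pi>\<^sub>E G\<in>I. \<Union>s. S s (induced \<Gamma> G))"
    using assms by (auto simp: \<gamma> i basis_index_def)
  note P = finite_verts partition[OF I]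
  obtain \<alpha> where \<alpha>: "pairing \<alpha> c = 1"
      "\<And>r' c'. c' \<in> A r' (contract \<Gamma> I) \<Longrightarrow> c' \<noteq> c \<Longrightarrow> pairing \<alpha> c' = 0"
    using graded_dual_functional[OF C[OF I] graded_space_zero _ A[OF I] c]
      C[OF I] fs.subspace_0 by (auto simp: graded_space_def)
  have "\<exists>b. pairing b (y G) = 1 \<and> (\<forall>s. \<forall>z\<in>S s (induced \<Gamma> G). z \<noteq> y G \<longrightarrow> pairing b z = 0) \<and>
      (\<forall>z\<in>N (induced \<Gamma> G). pairing b z = 0)" if G: "G \<in> I" for G
  proof -
    obtain s where "y G \<in> S s (induced \<Gamma> G)" using y G by blast
    then show ?thesis
      using graded_dual_functional[OF F[OF I G] N[OF I G] NF[OF I G] S[OF I G]] by metis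
  qed
  then obtain \<beta> where \<beta>: "\<And>G. G \<in> I \<Longrightarrow> pairing (\<beta> G) (y G) = 1"
      "\<And>G s z. G \<in> I \<Longrightarrow> z \<in> S s (induced \<Gamma> G) \<Longrightarrow> z \<noteq> y G \<Longrightarrow> pairing (\<beta> G) z = 0"
      "\<And>G z. G \<in> I \<Longrightarrow> z \<in> N (induced \<Gamma> G) \<Longrightarrow> pairing (\<beta> G) z = 0"
    by metis
  \<comment> \<open>Stated for arbitrary tensors of the product, since it is applied both to basis
    tensors and to the generators of the kernel.\<close>
  have tensor: "finsupp (tensor J c' y') \<and> pairing (tensor I \<alpha> \<beta>) (tensor J c' y') =
      (if J = I then pairing \<alpha> c' * (\<Prod>G\<in>I. pairing (\<beta> G) (y' G)) else 0)"
    if "J \<in> graph_partitions \<Gamma>" "c' \<in> C (contract \<Gamma> J)" "\<And>G. G \<in> J \<Longrightarrow> y' G \<in> F (induced \<Gamma> G)"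
    for J c' y'
  proof -
    have c': "finsupp c'" using C[OF that(1)] that(2) by (simp add: graded_space_def)
    have y': "finsupp (y' G)" if "G \<in> J" for G
      using F[OF \<open>J \<in> graph_partitions \<Gamma>\<close> that] that \<open>\<And>G. G \<in> J \<Longrightarrow> y' G \<in> F (induced \<Gamma> G)\<close>
      by (simp add: graded_space_def)
    have lv: "leaves t = G" if "G \<in> J" "y' G t \<noteq> 0" for G t
      using F_leaves[OF \<open>J \<in> graph_partitions \<Gamma>\<close> that(1)] that \<open>\<And>G. G \<in> J \<Longrightarrow> y' G \<in> F (induced \<Gamma> G)\<close>
      by blast
    have "finsupp (tensor J c' y')"
      by (rule finsupp_tensor[OF finite_verts partition[OF that(1)] c' y' lv])
    moreover have "pairing (tensor J \<alpha> \<beta>) (tensor J c' y') =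
        pairing \<alpha> c' * (\<Prod>G\<in>J. pairing (\<beta> G) (y' G))"
      by (rule pairing_tensor_tensor[OF finite_verts partition[OF that(1)] c' y' lv])
    ultimately show ?thesis using pairing_tensor_distinct[of I J] by auto
  qed
  have index: "finsupp (basis_tensor j) \<and> pairing (tensor I \<alpha> \<beta>) (basis_tensor j) = (if j = i then 1 else 0)"
    if "j \<in> basis_index \<delta>" for j \<delta>
  proof -
    obtain r' n' J c' y' where \<delta>: "\<delta> = (r', n')" and j: "j = (J, c', y')" by (cases \<delta>, cases j)
    have J: "J \<in> graph_partitions \<Gamma>" and c': "c' \<in> A r' (contract \<Gamma> J)"
      and y': "y' \<in> (\<Pi>\<^sub>E G\<in>J. \<Union>s. S s (induced \<Gamma> G))"
      using that by (auto simp: \<delta> j basis_index_def)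
    have *: "finsupp (tensor J c' y') \<and> pairing (tensor I \<alpha> \<beta>) (tensor J c' y') =
        (if J = I then pairing \<alpha> c' * (\<Prod>G\<in>I. pairing (\<beta> G) (y' G)) else 0)"
      using A_sub[OF J] S_sub[OF J] c' y' by (intro tensor[OF J]) blast+
    \<comment> \<open>Distinct indices differ in the partition, in the lower factor, or in the upper
      factor at some block; each difference makes the pairing vanish.\<close>
    consider "J \<noteq> I" | "J = I" "c' \<noteq> c" | "J = I" "c' = c" "y' \<noteq> y" | "j = i"
      by (auto simp: i j)
    then show ?thesis
    proof cases
      case 3
      then obtain G where G: "G \<in> I" "y' G \<noteq> y G" using y y' by (metis PiE_ext)
      then obtain s where "y' G \<in> S s (induced \<Gamma> G)" using y' 3(1) by blast
      then have "pairing (\<beta> G) (y' G) = 0" using \<beta>(2) G by blast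
      moreover have "finite I" using P by (rule finite_blocks)
      ultimately have "(\<Prod>G\<in>I. pairing (\<beta> G) (y' G)) = 0" using G(1) by (auto intro: prod_zero)
      then show ?thesis using * 3 by (simp add: i j)
    next
      case 4
      then show ?thesis using * \<alpha>(1) \<beta>(1) by (simp add: i j)
    next
      case 2
      then have "pairing \<alpha> c' = 0" using \<alpha>(2) c' by blast
      then show ?thesis using * 2 by (simp add: i j)
    qed (use * in \<open>simp add: i j\<close>)
  qed
  show thesis
  proof
    show "pairing (tensor I \<alpha> \<beta>) (basis_tensor i) = 1" using index[OF assms] by simp
    show "finsupp (basis_tensor j) \<and> pairing (tensor I \<alpha> \<beta>) (basis_tensor j) = 0"
      if "j \<in> basis_index \<delta>" "j \<noteq> i" for j \<delta>
      using index[OF that(1)] that(2) by simp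
    fix x assume "x \<in> contraction_product_ker C F N \<Gamma>"
    then show "pairing (tensor I \<alpha> \<beta>) x = 0"
      unfolding contraction_product_ker_def
    proof (rule conjunct2[OF pairing_zero_span])
      fix b assume "b \<in> {tensor I c y |I c y. I \<in> graph_partitions \<Gamma> \<and> c \<in> C (contract \<Gamma> I) \<and>
        (\<forall>G\<in>I. y G \<in> F (induced \<Gamma> G)) \<and> (\<exists>G\<in>I. y G \<in> N (induced \<Gamma> G))}"
      then obtain J c' y' H where b: "b = tensor J c' y'" and J: "J \<in> graph_partitions \<Gamma>"
        "c' \<in> C (contract \<Gamma> J)" "\<And>G. G \<in> J \<Longrightarrow> y' G \<in> F (induced \<Gamma> G)"
        and H: "H \<in> J" "y' H \<in> N (induced \<Gamma> H)" by blast
      have "(\<Prod>G\<in>I. pairing (\<beta> G) (y' G)) = 0" if "J = I"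
      proof -
        have "H \<in> I" "pairing (\<beta> H) (y' H) = 0" "finite I"
          using \<beta>(3) H that finite_blocks[OF P] by auto
        then show ?thesis by (auto intro: prod_zero)
      qed
      then show "finsupp b \<and> pairing (tensor I \<alpha> \<beta>) b = 0"
        using tensor[OF J] by (auto simp: b)
    qed
  qed
qed

text \<open>A tensor with two indices would take the values one and zero under the same dual
  functional.\<close>

lemma inj_on_basis_tensor: "inj_on basis_tensor (basis_index \<gamma>)"
proof (rule inj_onI, rule ccontr)
  fix i j assume ij: "i \<in> basis_index \<gamma>" "j \<in> basis_index \<gamma>" "basis_tensor i = basis_tensor j" "i \<noteq> j"
  obtain l where "pairing l (basis_tensor i) = 1"
    "\<And>j \<delta>. j \<in> basis_index \<delta> \<Longrightarrow> j \<noteq> i \<Longrightarrow> finsupp (basis_tensor j) \<and> pairing l (basis_tensor j) = 0"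
    using dual_functional[OF ij(1)] by metis
  then show False using ij by (metis zero_neq_one)
qed

text \<open>The dimension formula in one grade: expansion into homogeneous generators gives
  spanning, the dual functionals give independence modulo the kernel.\<close>

lemma quot_basis_contraction_product:
  "quot_basis (contraction_product C F \<Gamma> \<inter> of_grade \<gamma>)
    (contraction_product_ker C F N \<Gamma> \<inter> of_grade \<gamma>) (basis_tensor ` basis_index \<gamma>)"
  unfolding quot_basis_def
proof (intro conjI ballI)
  show "basis_tensor ` basis_index \<gamma> \<subseteq> contraction_product C F \<Gamma> \<inter> of_grade \<gamma>"
    using basis_tensors_subset basis_tensor_of_grade unfolding basis_tensors_def by blast
  show "contraction_product C F \<Gamma> \<inter> of_grade \<gamma> \<subseteq>
      fs.span (basis_tensor ` basis_index \<gamma> \<union> (contraction_product_ker C F N \<Gamma> \<inter> of_grade \<gamma>))"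
  proof
    fix x assume x: "x \<in> contraction_product C F \<Gamma> \<inter> of_grade \<gamma>"
    have "grade_part \<gamma> x \<in> fs.span ((basis_tensors \<union> null_tensors) \<inter> of_grade \<gamma>)"
      using x contraction_product_subset generator_of_grade by (intro grade_part_span) blast+
    moreover have "grade_part \<gamma> x = x" using x grade_part_of_grade[of x \<gamma> \<gamma>] by simp
    moreover have "(basis_tensors \<union> null_tensors) \<inter> of_grade \<gamma> \<subseteq>
        insert 0 (basis_tensor ` basis_index \<gamma> \<union> (contraction_product_ker C F N \<Gamma> \<inter> of_grade \<gamma>))"
    proof
      fix b assume b: "b \<in> (basis_tensors \<union> null_tensors) \<inter> of_grade \<gamma>"
      show "b \<in> insert 0 (basis_tensor ` basis_index \<gamma> \<union> (contraction_product_ker C F N \<Gamma> \<inter> of_grade \<gamma>))"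
      proof (cases "b \<in> null_tensors")
        case True
        then show ?thesis using b null_tensors_subset by blast
      next
        case False
        then obtain \<delta> i where i: "i \<in> basis_index \<delta>" "b = basis_tensor i"
          using b unfolding basis_tensors_def by blast
        have b\<delta>: "b \<in> of_grade \<delta>" unfolding i(2) by (rule basis_tensor_of_grade[OF i(1)])
        show ?thesis
        proof (cases "\<delta> = \<gamma>")
          case True
          then show ?thesis using i by blast
        next
          case False
          then have "b = 0"
            using grade_part_of_grade[of b \<gamma> \<gamma>] grade_part_of_grade[OF b\<delta>, of \<gamma>] b by simp
          then show ?thesis by blast
        qed
      qed
    qed
    then have "fs.span ((basis_tensors \<union> null_tensors) \<inter> of_grade \<gamma>) \<subseteq>
        fs.span (basis_tensor ` basis_index \<gamma> \<union> (contraction_product_ker C F N \<Gamma> \<inter> of_grade \<gamma>))"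
      by (metis fs.span_mono fs.span_insert_0)
    ultimately show "x \<in> fs.span (basis_tensor ` basis_index \<gamma> \<union> (contraction_product_ker C F N \<Gamma> \<inter> of_grade \<gamma>))"
      by auto
  qed
  fix b assume "b \<in> basis_tensor ` basis_index \<gamma>"
  then obtain i where i: "i \<in> basis_index \<gamma>" "b = basis_tensor i" by blast
  obtain l where l: "pairing l (basis_tensor i) = 1"
    "\<And>j \<delta>. j \<in> basis_index \<delta> \<Longrightarrow> j \<noteq> i \<Longrightarrow> finsupp (basis_tensor j) \<and> pairing l (basis_tensor j) = 0"
    "\<And>x. x \<in> contraction_product_ker C F N \<Gamma> \<Longrightarrow> pairing l x = 0"
    using dual_functional[OF i(1)] by metis
  \<comment> \<open>With the zero functional the span lemma yields just finite support, which the
    pairing argument below requires.\<close>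
  have fin: "finsupp x" if "x \<in> contraction_product_ker C F N \<Gamma>" for x
    using that unfolding contraction_product_ker_def
  proof (rule conjunct1[OF pairing_zero_span[where l = 0]])
    fix b assume "b \<in> {tensor I c y |I c y. I \<in> graph_partitions \<Gamma> \<and> c \<in> C (contract \<Gamma> I) \<and>
        (\<forall>G\<in>I. y G \<in> F (induced \<Gamma> G)) \<and> (\<exists>G\<in>I. y G \<in> N (induced \<Gamma> G))}"
    then obtain J c' y' where b: "b = tensor J c' y'" and J: "J \<in> graph_partitions \<Gamma>"
        "c' \<in> C (contract \<Gamma> J)" "\<And>G. G \<in> J \<Longrightarrow> y' G \<in> F (induced \<Gamma> G)" by blast
    have c': "finsupp c'" using C[OF J(1)] J(2) by (simp add: graded_space_def)
    have y': "finsupp (y' G)" if "G \<in> J" for G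
      using F[OF J(1) that] J(3)[OF that] by (simp add: graded_space_def)
    have "finsupp b" unfolding b
      by (rule finsupp_tensor[OF finite_verts partition[OF J(1)] c' y' F_leaves[OF J(1) _ J(3)]])
    then show "finsupp b \<and> pairing 0 b = 0" by (simp add: pairing_def)
  qed
  show "b \<notin> fs.span ((basis_tensor ` basis_index \<gamma> - {b}) \<union> (contraction_product_ker C F N \<Gamma> \<inter> of_grade \<gamma>))"
  proof
    assume "b \<in> fs.span ((basis_tensor ` basis_index \<gamma> - {b}) \<union> (contraction_product_ker C F N \<Gamma> \<inter> of_grade \<gamma>))"
    then have "pairing l b = 0"
    proof (rule conjunct2[OF pairing_zero_span])
      fix b' assume "b' \<in> (basis_tensor ` basis_index \<gamma> - {b}) \<union> (contraction_product_ker C F N \<Gamma> \<inter> of_grade \<gamma>)"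
      then show "finsupp b' \<and> pairing l b' = 0"
      proof
        assume "b' \<in> basis_tensor ` basis_index \<gamma> - {b}"
        then obtain j where "j \<in> basis_index \<gamma>" "b' = basis_tensor j" "j \<noteq> i" using i(2) by blast
        then show ?thesis using l(2) by blast
      next
        assume "b' \<in> contraction_product_ker C F N \<Gamma> \<inter> of_grade \<gamma>"
        then show ?thesis using l(3) fin by blast
      qed
    qed
    then show False using l(1) i(2) by simp
  qed
qed

end

section \<open>Contractions and restrictions of connected graphs\<close>

definition adjacency :: "graph \<Rightarrow> nat set \<Rightarrow> (nat \<times> nat) set" where
  "adjacency \<Gamma> G = {(a, b). a \<in> G \<and> b \<in> G \<and> {a, b} \<in> edges \<Gamma>}"

lemma connected_in_iff: "connected_in \<Gamma> G \<longleftrightarrow> (\<forall>u\<in>G. \<forall>v\<in>G. (u, v) \<in> (adjacency \<Gamma> G)\<^sup>*)"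
  by (simp add: connected_in_def adjacency_def)

lemma sym_adjacency: "sym (adjacency \<Gamma> G)"
  by (auto simp: adjacency_def sym_def insert_commute)

lemma adjacency_mono: "G \<subseteq> H \<Longrightarrow> (adjacency \<Gamma> G)\<^sup>* \<subseteq> (adjacency \<Gamma> H)\<^sup>*"
  by (intro rtrancl_mono) (auto simp: adjacency_def)

lemma tube_Un:
  assumes "tube \<Gamma> G" "tube \<Gamma> H" "a \<in> G" "b \<in> H" "{a, b} \<in> edges \<Gamma>"
  shows "tube \<Gamma> (G \<union> H)"
proof -
  let ?R = "(adjacency \<Gamma> (G \<union> H))\<^sup>*"
  have ab: "(a, b) \<in> ?R" using assms by (intro r_into_rtrancl) (auto simp: adjacency_def)
  have to_a: "(a, u) \<in> ?R" if "u \<in> G \<union> H" for u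
    using that
  proof
    assume "u \<in> G"
    then have "(a, u) \<in> (adjacency \<Gamma> G)\<^sup>*"
      using assms(1,3) by (auto simp: tube_def connected_in_iff)
    then show ?thesis using adjacency_mono[of G "G \<union> H" \<Gamma>] by auto
  next
    assume "u \<in> H"
    then have "(b, u) \<in> (adjacency \<Gamma> H)\<^sup>*"
      using assms(2,4) by (auto simp: tube_def connected_in_iff)
    then have "(b, u) \<in> ?R" using adjacency_mono[of H "G \<union> H" \<Gamma>] by auto
    then show ?thesis using ab by (rule rtrancl_trans[rotated])
  qed
  have "(u, v) \<in> ?R" if "u \<in> G \<union> H" "v \<in> G \<union> H" for u v
  proof -
    have "(u, a) \<in> ?R" using to_a[OF that(1)] sym_rtrancl[OF sym_adjacency] by (metis symD)
    then show ?thesis using to_a[OF that(2)] by (rule rtrancl_trans)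
  qed
  then show ?thesis using assms(1,2) by (auto simp: tube_def connected_in_iff)
qed

text \<open>A path in the union projects to a path of blocks: an edge inside a block projects to a
  point, and an edge between two blocks makes their union a tube. Stating this for disjoint tubes
  whose union is a tube covers contractions by partitions as well as the graphs of incoming edges in
  trees.\<close>

lemma contract_in_connected_graphs:
  assumes \<Gamma>: "simple_graph \<Gamma>" and J: "disjoint J" "\<And>G. G \<in> J \<Longrightarrow> tube \<Gamma> G" "tube \<Gamma> (\<Union>J)"
  shows "contract \<Gamma> J \<in> connected_graphs" "card (verts (contract \<Gamma> J)) = card J"
proof -
  have fin: "finite (\<Union>J)"
    using \<Gamma> J(3) finite_subset by (auto simp: tube_def simple_graph_def)
  have part: "partition_on (\<Union>J) J"
    using J(1,2) by (auto simp: partition_on_def tube_def)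
  note P = fin part
  have inj: "inj_on Min J" by (rule inj_on_Min_blocks[OF P])
  show "card (verts (contract \<Gamma> J)) = card J" by (simp add: contract_def card_image[OF inj])
  have finJ: "finite J" by (rule finite_blocks[OF P])
  have simple: "simple_graph (contract \<Gamma> J)"
    unfolding simple_graph_def
  proof (intro conjI ballI)
    show "finite (verts (contract \<Gamma> J))" using finJ by (simp add: contract_def)
    fix e assume "e \<in> edges (contract \<Gamma> J)"
    then obtain G H where GH: "e = {Min G, Min H}" "G \<in> J" "H \<in> J" "G \<noteq> H"
      by (auto simp: contract_def)
    then show "e \<subseteq> verts (contract \<Gamma> J)" by (simp add: contract_def)
    have "Min G \<noteq> Min H" using inj_onD[OF inj _ GH(2,3)] GH(4) by blast
    then show "card e = 2" by (simp add: GH(1))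
  qed
  let ?D = "adjacency (contract \<Gamma> J) (Min ` J)"
  have path: "\<forall>H\<in>J. b \<in> H \<longrightarrow> (Min G, Min H) \<in> ?D\<^sup>*"
    if "(a, b) \<in> (adjacency \<Gamma> (\<Union>J))\<^sup>*" and G: "G \<in> J" "a \<in> G" for a b G
    using that(1)
  proof (induction rule: rtrancl_induct)
    case base
    show ?case
    proof (intro ballI impI)
      fix H assume "H \<in> J" "a \<in> H"
      then have "H = G" using disjointD[OF J(1)] G by blast
      then show "(Min G, Min H) \<in> ?D\<^sup>*" by simp
    qed
  next
    case (step b c)
    show ?case
    proof (intro ballI impI)
      fix H assume H: "H \<in> J" "c \<in> H"
      obtain H' where H': "H' \<in> J" "b \<in> H'" using step(2) by (auto simp: adjacency_def)
      then have *: "(Min G, Min H') \<in> ?D\<^sup>*" using step(3) by blast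
      show "(Min G, Min H) \<in> ?D\<^sup>*"
      proof (cases "H = H'")
        case False
        have "{b, c} \<in> edges \<Gamma>" using step(2) by (simp add: adjacency_def)
        then have "tube \<Gamma> (H' \<union> H)" using tube_Un[OF J(2)[OF H'(1)] J(2)[OF H(1)] H'(2) H(2)] by blast
        then have "{Min H', Min H} \<in> edges (contract \<Gamma> J)"
          unfolding contract_def using H(1) H'(1) False by auto
        then have "(Min H', Min H) \<in> ?D" using H(1) H'(1) by (simp add: adjacency_def)
        then show ?thesis using * by (rule rtrancl_into_rtrancl[rotated])
      qed (use * in simp)
    qed
  qed
  have "connected_in (contract \<Gamma> J) (Min ` J)"
    unfolding connected_in_iff
  proof (intro ballI)
    fix u v assume "u \<in> Min ` J" "v \<in> Min ` J"
    then obtain G H where GH: "G \<in> J" "u = Min G" "H \<in> J" "v = Min H" by blast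
    obtain a b where ab: "a \<in> G" "b \<in> H" using J(2)[OF GH(1)] J(2)[OF GH(3)] by (auto simp: tube_def)
    then have "(a, b) \<in> (adjacency \<Gamma> (\<Union>J))\<^sup>*"
      using J(3) GH by (auto simp: tube_def connected_in_iff)
    then show "(u, v) \<in> ?D\<^sup>*" using path[OF _ GH(1) ab(1)] ab(2) GH by blast
  qed
  moreover have "J \<noteq> {}" using J(3) by (auto simp: tube_def)
  ultimately show "contract \<Gamma> J \<in> connected_graphs"
    using simple by (simp add: connected_graphs_def tube_def) (simp add: contract_def)
qed

lemma contract_partition_connected:
  assumes "\<Gamma> \<in> connected_graphs" "I \<in> graph_partitions \<Gamma>"
  shows "contract \<Gamma> I \<in> connected_graphs" "card (verts (contract \<Gamma> I)) = card I"
proof -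
  have I: "partition_on (verts \<Gamma>) I" "\<And>G. G \<in> I \<Longrightarrow> tube \<Gamma> G"
    using assms(2) by (auto simp: graph_partitions_def)
  have "\<Union>I = verts \<Gamma>" "disjoint I" using I(1) by (auto simp: partition_on_def)
  then show "contract \<Gamma> I \<in> connected_graphs" "card (verts (contract \<Gamma> I)) = card I"
    using assms(1) I(2) contract_in_connected_graphs[of \<Gamma> I] by (auto simp: connected_graphs_def)
qed

lemma induced_in_connected_graphs:
  assumes "simple_graph \<Gamma>" "tube \<Gamma> G"
  shows "induced \<Gamma> G \<in> connected_graphs"
proof -
  have "adjacency (induced \<Gamma> G) G = adjacency \<Gamma> G" by (auto simp: adjacency_def induced_def)
  moreover have "finite G" using assms finite_subset by (auto simp: simple_graph_def tube_def)
  ultimately show ?thesis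
    using assms by (auto simp: connected_graphs_def simple_graph_def tube_def connected_in_iff induced_def)
qed

lemma finite_verts_connected: "\<Gamma> \<in> connected_graphs \<Longrightarrow> finite (verts \<Gamma>)"
  by (simp add: connected_graphs_def simple_graph_def)

section \<open>Weights of grafted trees\<close>

lemma finite_leaves: "finite (leaves t)"
  by (induction t) auto

lemma decorated_leaves_nonempty: "decorated E \<Gamma> t \<Longrightarrow> leaves t \<noteq> {}"
proof (induction t)
  case (Vertex d e ts)
  then obtain u where "u \<in> set ts" by (cases ts) auto
  then show ?case using Vertex by auto
qed simp

lemma sum_leaves_disjoint:
  assumes "sorted_wrt (\<lambda>t u. leaves t \<inter> leaves u = {} \<and> low t < low u) ts"
  shows "(\<Sum>n\<in>(\<Union>t\<in>set ts. leaves t). h n) = (\<Sum>t\<leftarrow>ts. \<Sum>n\<in>leaves t. h n)"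
  using assms
proof (induction ts)
  case (Cons t ts)
  have "leaves t \<inter> (\<Union>u\<in>set ts. leaves u) = {}" using Cons.prems by auto
  then show ?case using Cons by (simp add: sum.union_disjoint finite_leaves)
qed simp

text \<open>Siblings in a decorated tree have disjoint leaf sets, so each leaf occurs once and the
  tree grafted there is counted once.\<close>

lemma tree_weight_graft:
  assumes "decorated E \<Gamma> S"
  shows "tree_weight (graft S Fs) = tree_weight S + (\<Sum>n\<in>leaves S. tree_weight (plug Fs n))"
  using assms
proof (induction S)
  case (Vertex d e ts)
  have "(\<Sum>t\<leftarrow>ts. tree_weight (graft t Fs)) =
      (\<Sum>t\<leftarrow>ts. tree_weight t + (\<Sum>n\<in>leaves t. tree_weight (plug Fs n)))"
    using Vertex by (intro arg_cong[of _ _ sum_list] map_cong) auto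
  also have "\<dots> = (\<Sum>t\<leftarrow>ts. tree_weight t) + (\<Sum>t\<leftarrow>ts. \<Sum>n\<in>leaves t. tree_weight (plug Fs n))"
    by (rule sum_list_addf)
  also have "(\<Sum>t\<leftarrow>ts. \<Sum>n\<in>leaves t. tree_weight (plug Fs n)) =
      (\<Sum>n\<in>(\<Union>t\<in>set ts. leaves t). tree_weight (plug Fs n))"
    using Vertex.prems by (intro sum_leaves_disjoint[symmetric]) simp
  finally show ?case by (simp add: comp_def)
qed simp

lemma sum_plug:
  assumes "distinct (map low Cs)"
  shows "(\<Sum>n\<in>low ` set Cs. h (plug Cs n)) = (\<Sum>t\<leftarrow>Cs. h t)"
  using assms
proof (induction Cs)
  case (Cons t Cs)
  have "(\<Sum>n\<in>low ` set Cs. h (plug (t # Cs) n)) = (\<Sum>n\<in>low ` set Cs. h (plug Cs n))"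
    using Cons.prems by (intro sum.cong) (auto simp: plug_def)
  moreover have "h (plug (t # Cs) (low t)) = h t" by (simp add: plug_def)
  ultimately show ?case using Cons by simp
qed simp

lemma low_Vertex:
  assumes "ts \<noteq> []" "\<And>t. t \<in> set ts \<Longrightarrow> leaves t \<noteq> {}"
  shows "low (Vertex d e ts) = Min (low ` set ts)"
  unfolding low_def[of "Vertex d e ts"]
proof (rule Min_eqI)
  show "finite (leaves (Vertex d e ts))" by (rule finite_leaves)
  have ne: "low ` set ts \<noteq> {}" "finite (low ` set ts)" using assms(1) by auto
  show "Min (low ` set ts) \<le> n" if "n \<in> leaves (Vertex d e ts)" for n
  proof -
    obtain t where t: "t \<in> set ts" "n \<in> leaves t" using \<open>n \<in> leaves (Vertex d e ts)\<close> by auto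
    have "Min (low ` set ts) \<le> low t" using t(1) ne by simp
    also have "low t \<le> n" unfolding low_def by (rule Min_le[OF finite_leaves t(2)])
    finally show ?thesis .
  qed
  obtain t where t: "t \<in> set ts" "Min (low ` set ts) = low t" using Min_in[OF ne(2,1)] by auto
  then have "low t \<in> leaves t" unfolding low_def by (intro Min_in finite_leaves assms(2))
  then show "Min (low ` set ts) \<in> leaves (Vertex d e ts)" using t by auto
qed

text \<open>Moving the root vertex of one upper tree to the top of \<open>S\<close> raises the
  weight of \<open>S\<close> by one and keeps the total. The corolla has arbitrary degree and
  decoration here; in the differential its degree is shifted.\<close>

lemma grade_koszul_diff_source:
  assumes SF: "(S, Fs) \<in> two_level E' E \<Gamma>" and i: "i < length Fs" "Fs ! i = Vertex d e ts"
    and Cs: "Cs = (map (\<lambda>t. Leaf (low t)) Fs)[i := Vertex d' e' (map (\<lambda>t. Leaf (low t)) ts)]"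
  shows "grade (graft S Cs, sort_key low (take i Fs @ ts @ drop (Suc i) Fs)) =
    (Suc (fst (grade (S, Fs))), snd (grade (S, Fs)))"
proof -
  have sorted: "sorted_wrt (\<lambda>t u. low t < low u) Fs"
    and S: "decorated E' (contract \<Gamma> (leaves ` set Fs)) S"
    and leaves_S: "leaves S = verts (contract \<Gamma> (leaves ` set Fs))"
    and Fs: "\<And>t. t \<in> set Fs \<Longrightarrow> decorated E (induced \<Gamma> (leaves t)) t"
    using SF by (auto simp: two_level_def trees_def)
  have dec: "decorated E (induced \<Gamma> (leaves (Fs ! i))) (Vertex d e ts)"
    using Fs[OF nth_mem[OF i(1)]] unfolding i(2) .
  \<comment> \<open>Grafting finds its place by least leaves, so the corolla must have the same
    least leaf as the tree it replaces.\<close>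
  have "low (Vertex d' e' (map (\<lambda>t. Leaf (low t)) ts)) = low (Fs ! i)"
  proof -
    have ne: "ts \<noteq> []" "\<And>t. t \<in> set ts \<Longrightarrow> leaves t \<noteq> {}"
      using dec decorated_leaves_nonempty[of E "induced \<Gamma> (leaves (Fs ! i))"] by auto
    have "(\<Union>t\<in>set ts. {low t}) = low ` set ts" by auto
    then have "low (Vertex d' e' (map (\<lambda>t. Leaf (low t)) ts)) = Min (low ` set ts)"
      unfolding low_def[of "Vertex d' e' (map (\<lambda>t. Leaf (low t)) ts)"] by simp
    then show ?thesis using low_Vertex[OF ne] i(2) by simp
  qed
  then have low_Cs: "map low Cs = map low Fs"
    by (simp add: Cs map_update comp_def low_def[of "Leaf _"] list_update_same_conv i(1))
  have "sorted_wrt (<) (map low Fs)" using sorted by (simp add: sorted_wrt_map)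
  then have dist: "distinct (map low Cs)" unfolding low_Cs by (simp add: strict_sorted_iff)
  have "leaves S = low ` set Fs" by (simp add: leaves_S contract_def image_image low_def)
  also have "\<dots> = low ` set Cs" using low_Cs by (metis set_map)
  finally have "(\<Sum>n\<in>leaves S. tree_weight (plug Cs n)) = (\<Sum>t\<leftarrow>Cs. tree_weight t)"
    using sum_plug[OF dist, of tree_weight] by simp
  also have "map tree_weight Cs = (map (\<lambda>t. 0) Fs)[i := 1]"
    by (simp add: Cs map_update comp_def)
  also have "sum_list \<dots> = 1"
    using i(1) by (simp add: sum_list_update)
  finally have 1: "tree_weight (graft S Cs) = Suc (tree_weight S)"
    by (simp add: tree_weight_graft[OF S])
  have "(\<Sum>t\<leftarrow>sort_key low (take i Fs @ ts @ drop (Suc i) Fs). tree_weight t) =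
      (\<Sum>t\<leftarrow>take i Fs @ ts @ drop (Suc i) Fs. tree_weight t)"
    by (metis mset_map mset_sort sum_mset_sum_list)
  moreover have "(\<Sum>t\<leftarrow>Fs. tree_weight t) =
      (\<Sum>t\<leftarrow>take i Fs. tree_weight t) + tree_weight (Fs ! i) + (\<Sum>t\<leftarrow>drop (Suc i) Fs. tree_weight t)"
    using id_take_nth_drop[OF i(1)] by (metis (no_types) add.assoc map_append list.map(2) sum_list.Cons sum_list_append)
  ultimately show ?thesis using i(2) by (simp add: grade_def 1)
qed

text \<open>The differential as a sparse matrix, a shape from which linearity and the shift of
  grades can be read off. Entries are zero at leaves and at inadmissible pairs, and the shift is
  claimed for non-zero entries only.\<close>

lemma koszul_diff_matrix:
  fixes E :: "('k::field, 'e::ab_group_add) collection"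
  obtains M :: "'e tree \<times> 'e tree list \<Rightarrow> nat \<Rightarrow> 'k"
    and q :: "'e tree \<times> 'e tree list \<Rightarrow> nat \<Rightarrow> 'e tree \<times> 'e tree list"
  where "\<And>x p. koszul_diff E \<Gamma> x p = (\<Sum>i<length (snd p). M p i * x (q p i))"
    and "\<And>p i. i < length (snd p) \<Longrightarrow> M p i \<noteq> 0 \<Longrightarrow>
      grade (q p i) = (Suc (fst (grade p)), snd (grade p))"
proof -
  define Cs where "Cs Fs i d e ts =
      (map (\<lambda>t. Leaf (low t)) Fs)[i := Vertex (d + 1) e (map (\<lambda>t. Leaf (low t)) ts)]"
    for Fs ts :: "'e tree list" and i d and e :: 'e
  define block where "block t = (Suc (low t), tree_degree t)" for t :: "'e tree"
  define M :: "'e tree \<times> 'e tree list \<Rightarrow> nat \<Rightarrow> 'k" where "M = (\<lambda>(S, Fs) i.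
    if (S, Fs) \<in> two_level (suspension E) E \<Gamma> then case Fs ! i of Leaf n \<Rightarrow> 0 | Vertex d e ts \<Rightarrow>
      graft_sign S (Cs Fs i d e ts) * parity_sign (tree_degree S) *
        koszul_sign (map block (take i Fs) @ (0, d) # map block ts @ map block (drop (Suc i) Fs))
    else 0)"
  define q :: "'e tree \<times> 'e tree list \<Rightarrow> nat \<Rightarrow> 'e tree \<times> 'e tree list" where "q = (\<lambda>(S, Fs) i.
    case Fs ! i of Leaf n \<Rightarrow> (S, Fs) | Vertex d e ts \<Rightarrow>
      (graft S (Cs Fs i d e ts), sort_key low (take i Fs @ ts @ drop (Suc i) Fs)))"
  show thesis
  proof
    fix x :: "'e tree \<times> 'e tree list \<Rightarrow> 'k" and p :: "'e tree \<times> 'e tree list"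
    obtain S Fs where p: "p = (S, Fs)" by (cases p)
    show "koszul_diff E \<Gamma> x p = (\<Sum>i<length (snd p). M p i * x (q p i))"
    proof (cases "(S, Fs) \<in> two_level (suspension E) E \<Gamma>")
      case True
      have "koszul_diff E \<Gamma> x (S, Fs) = (\<Sum>i<length Fs. M (S, Fs) i * x (q (S, Fs) i))"
        unfolding koszul_diff_def prod.case if_P[OF True]
      proof (rule sum.cong[OF refl])
        fix i
        show "(case Fs ! i of Leaf n \<Rightarrow> 0 | Vertex d e ts \<Rightarrow>
          (let corolla = Vertex (d + 1) e (map (\<lambda>t. Leaf (low t)) ts);
               Cs = (map (\<lambda>t. Leaf (low t)) Fs)[i := corolla];
               Gs = sort_key low (take i Fs @ ts @ drop (Suc i) Fs);
               block = (\<lambda>t. (Suc (low t), tree_degree t))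
           in graft_sign S Cs * parity_sign (tree_degree S) *
              koszul_sign (map block (take i Fs) @ (0, d) # map block ts @
                map block (drop (Suc i) Fs)) *
              x (graft S Cs, Gs))) = M (S, Fs) i * x (q (S, Fs) i)"
          using True by (cases "Fs ! i")
            (simp_all add: M_def q_def Cs_def block_def[abs_def] Let_def)
      qed
      then show ?thesis by (simp add: p)
    next
      case False
      then show ?thesis by (simp add: p koszul_diff_def M_def)
    qed
  next
    fix p :: "'e tree \<times> 'e tree list" and i
    obtain S Fs where p: "p = (S, Fs)" by (cases p)
    assume i: "i < length (snd p)" and nz: "M p i \<noteq> 0"
    have SF: "(S, Fs) \<in> two_level (suspension E) E \<Gamma>"
      using nz by (auto simp: p M_def split: if_splits)
    obtain d e ts where Fi: "Fs ! i = Vertex d e ts"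
      using nz SF by (cases "Fs ! i") (auto simp: p M_def)
    show "grade (q p i) = (Suc (fst (grade p)), snd (grade p))"
      using grade_koszul_diff_source[OF SF _ Fi, of "Cs Fs i d e ts" "d + 1" e] i Fi
      by (simp add: p q_def Cs_def)
  qed
qed

lemma linear_koszul_diff: "Vector_Spaces.linear fscale fscale (koszul_diff E \<Gamma>)"
proof (rule koszul_diff_matrix[of E \<Gamma>])
  fix M q
  assume M: "\<And>x p. koszul_diff E \<Gamma> x p = (\<Sum>i<length (snd p). M p i * x (q p i))"
  show ?thesis
    unfolding Vector_Spaces.linear_iff
    by (simp add: fs.vector_space_axioms M fun_eq_iff fscale_def sum.distrib
        sum_distrib_left algebra_simps)
qed

text \<open>A non-zero entry leads from grade \<open>(Suc r, n)\<close> to grade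
  \<open>(r, n)\<close>, so nothing issues from lower weight zero.\<close>

lemma koszul_diff_grade_part:
  fixes E :: "('k::field, 'e::ab_group_add) collection"
  shows "koszul_diff E \<Gamma> (grade_part (Suc r, n) x) = grade_part (r, n) (koszul_diff E \<Gamma> x)"
  "koszul_diff E \<Gamma> (grade_part (0, n) x) = 0"
proof (rule_tac [!] koszul_diff_matrix[of E \<Gamma>])
  fix M q
  assume M: "\<And>x p. koszul_diff E \<Gamma> x p = (\<Sum>i<length (snd p). M p i * x (q p i))"
    and q: "\<And>p i. i < length (snd p) \<Longrightarrow> M p i \<noteq> 0 \<Longrightarrow>
      grade (q p i) = (Suc (fst (grade p)), snd (grade p))"
  show "koszul_diff E \<Gamma> (grade_part (Suc r, n) x) = grade_part (r, n) (koszul_diff E \<Gamma> x)"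
  proof
    fix p :: "'e tree \<times> 'e tree list"
    have "M p i * grade_part (Suc r, n) x (q p i) =
        (if grade p = (r, n) then M p i * x (q p i) else 0)" if "i < length (snd p)" for i
      using q[OF that] by (cases "M p i = 0"; cases "grade p") (auto simp: grade_part_def)
    then have "koszul_diff E \<Gamma> (grade_part (Suc r, n) x) p =
        (\<Sum>i<length (snd p). if grade p = (r, n) then M p i * x (q p i) else 0)"
      unfolding M by (intro sum.cong) auto
    then show "koszul_diff E \<Gamma> (grade_part (Suc r, n) x) p = grade_part (r, n) (koszul_diff E \<Gamma> x) p"
      by (simp add: M grade_part_def)
  qed
  show "koszul_diff E \<Gamma> (grade_part (0, n) x) = 0"
  proof
    fix p :: "'e tree \<times> 'e tree list"
    have "M p i * grade_part (0, n) x (q p i) = 0" if "i < length (snd p)" for i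
      using q[OF that] by (cases "M p i = 0") (auto simp: grade_part_def)
    then show "koszul_diff E \<Gamma> (grade_part (0, n) x) p = 0 p"
      unfolding M by (simp add: sum.neutral)
  qed
qed

section \<open>Binary generators\<close>

text \<open>A basis cannot contain zero. Hence no tree has a vertex decorated from a zero
  component.\<close>

lemma some_basis_zero:
  assumes "vector_space sc"
  shows "some_basis sc {0} = {}"
proof -
  interpret vector_space sc by (rule assms)
  have "some_basis sc {0} \<subseteq> {0} \<and> independent (some_basis sc {0}) \<and> span (some_basis sc {0}) = {0}"
    unfolding some_basis_def by (rule someI[of _ "{}"]) (simp add: independent_empty)
  then show ?thesis using dependent_zero by (metis insertI1 subset_singletonD)
qed

text \<open>A vertex without exactly two incoming edges would need a basis element of a zero
  component. The tube property is carried through the induction because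
  \<open>generated_by_binary\<close> speaks of connected graphs only, and connectedness of the graph
  of incoming edges rests on the leaf sets of the subtrees being tubes.\<close>

lemma decorated_binary_weight:
  assumes \<Gamma>: "simple_graph \<Gamma>" and E: "generated_by_binary E" "vector_space (scl E)"
    and t: "decorated E \<Gamma> t"
  shows "tube \<Gamma> (leaves t) \<and> card (leaves t) = Suc (tree_weight t)"
  using t
proof (induction t)
  case (Leaf n)
  then show ?case by (simp add: tube_def connected_in_iff)
next
  case (Vertex d e ts)
  let ?J = "leaves ` set ts"
  have IH: "tube \<Gamma> (leaves t)" "card (leaves t) = Suc (tree_weight t)" if "t \<in> set ts" for t
    using Vertex that by auto
  have sorted: "sorted_wrt (\<lambda>t u. leaves t \<inter> leaves u = {} \<and> low t < low u) ts"
    and tube: "tube \<Gamma> (\<Union>?J)" and e: "e \<in> some_basis (scl E) (cmp E (contract \<Gamma> ?J) d)"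
    using Vertex.prems by simp_all
  have disj: "leaves t \<inter> leaves u = {}" if "i < j" "j < length ts" "t = ts ! i" "u = ts ! j" for i j t u
    using sorted that by (simp add: sorted_wrt_iff_nth_less)
  have disj': "leaves (ts ! i) \<inter> leaves (ts ! j) = {}" if "i \<noteq> j" "i < length ts" "j < length ts" for i j
    using disj[of i j] disj[of j i] that by (cases "i < j") (auto simp: Int_commute)
  have ne: "leaves t \<noteq> {}" if "t \<in> set ts" for t using IH(1)[OF that] by (simp add: tube_def)
  have "disjoint ?J"
  proof (rule disjointI)
    fix G H assume GH: "G \<in> ?J" "H \<in> ?J" "G \<noteq> H"
    obtain i where i: "i < length ts" "G = leaves (ts ! i)"
      using GH(1) by (auto simp: in_set_conv_nth)
    obtain j where j: "j < length ts" "H = leaves (ts ! j)"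
      using GH(2) by (auto simp: in_set_conv_nth)
    have "i \<noteq> j" using GH(3) i j by auto
    then show "G \<inter> H = {}" using disj' i j by simp
  qed
  then have conn: "contract \<Gamma> ?J \<in> connected_graphs" "card (verts (contract \<Gamma> ?J)) = card ?J"
    using contract_in_connected_graphs[OF \<Gamma> _ _ tube] IH(1) by auto
  have "card (verts (contract \<Gamma> ?J)) = 2"
  proof (rule ccontr)
    assume "card (verts (contract \<Gamma> ?J)) \<noteq> 2"
    then have "cmp E (contract \<Gamma> ?J) d = {0}" using E(1) conn(1) by (simp add: generated_by_binary_def)
    then show False using e some_basis_zero[OF E(2)] by simp
  qed
  moreover have "distinct (map leaves ts)"
    unfolding distinct_conv_nth
  proof (intro allI impI)
    fix i j assume "i < length (map leaves ts)" "j < length (map leaves ts)" "i \<noteq> j"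
    then show "map leaves ts ! i \<noteq> map leaves ts ! j" using disj'[of i j] ne[of "ts ! i"] by auto
  qed
  then have "card ?J = length ts" using distinct_card[of "map leaves ts"] by simp
  ultimately have len: "length ts = 2" using conn(2) by simp
  have "card (leaves (Vertex d e ts)) = (\<Sum>n\<in>(\<Union>t\<in>set ts. leaves t). 1)" by simp
  also have "\<dots> = (\<Sum>t\<leftarrow>ts. \<Sum>n\<in>leaves t. 1)" by (rule sum_leaves_disjoint[OF sorted])
  also have "\<dots> = (\<Sum>t\<leftarrow>ts. 1 + tree_weight t)"
    using IH(2) by (intro arg_cong[of _ _ sum_list] map_cong) auto
  also have "\<dots> = (\<Sum>t\<leftarrow>ts. 1) + (\<Sum>t\<leftarrow>ts. tree_weight t)" by (rule sum_list_addf)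
  also have "(\<Sum>t\<leftarrow>ts. 1) = (2::nat)" using len by (simp add: sum_list_triv)
  finally show ?case using tube by simp
qed

section \<open>The dimension of the Koszul dual\<close>

text \<open>The generator, normalised at \<open>l0\<close>, of the one-dimensional space of
  alternating functions of an enumeration. The permutation is unique when the entries are
  distinct.\<close>

definition enumeration_sign :: "nat list \<Rightarrow> nat list \<Rightarrow> 'k::field" where
  "enumeration_sign l0 l =
    of_int (sign (THE p. p permutes {..<length l0} \<and> permute_list p l0 = l))"

lemma permute_list_inj:
  assumes "distinct l" "p permutes {..<length l}" "q permutes {..<length l}"
    and "permute_list p l = permute_list q l"
  shows "p = q"
proof
  fix i
  show "p i = q i"
  proof (cases "i < length l")
    case True
    have "l ! p i = l ! q i" using assms(2-4) True by (metis permute_list_nth)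
    moreover have "p i < length l" "q i < length l"
      using True permutes_in_image[OF assms(2), of i] permutes_in_image[OF assms(3), of i] by auto
    ultimately show ?thesis using assms(1) by (simp add: nth_eq_iff_index_eq)
  next
    case False
    then show ?thesis using permutes_not_in[OF assms(2), of i] permutes_not_in[OF assms(3), of i] by simp
  qed
qed

lemma enumeration_sign_permute_list:
  assumes "distinct l" "p permutes {..<length l}"
  shows "enumeration_sign l (permute_list p l) = of_int (sign p)"
proof -
  have "(THE q. q permutes {..<length l} \<and> permute_list q l = permute_list p l) = p"
    using assms permute_list_inj by (intro the_equality) auto
  then show ?thesis by (simp add: enumeration_sign_def)
qed

lemma enumeration_eq_permute_list:
  assumes "distinct l" "distinct l'" "set l = set l'"
  obtains p where "p permutes {..<length l}" "l' = permute_list p l"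
proof -
  have "mset l' = mset l" using assms by (simp add: set_eq_iff_mset_eq_distinct)
  then show thesis using mset_eq_permutation that by metis
qed

lemma enumeration_sign_permute:
  assumes "distinct l0" "distinct l" "set l = set l0" "p permutes {..<length l}"
  shows "enumeration_sign l0 (permute_list p l) = of_int (sign p) * (enumeration_sign l0 l :: 'k::field)"
proof -
  obtain q where q: "q permutes {..<length l0}" "l = permute_list q l0"
    using enumeration_eq_permute_list[of l0 l] assms(1-3) by metis
  have p: "p permutes {..<length l0}" using assms(4) q(2) by simp
  have "permute_list p l = permute_list (q \<circ> p) l0" using permute_list_compose[OF p] q(2) by metis
  moreover have "(q \<circ> p) permutes {..<length l0}" using p q(1) by (rule permutes_compose)
  moreover have "sign (q \<circ> p) = sign q * sign p"
    using p q(1) by (intro sign_compose permutes_imp_permutation[of "{..<length l0}"]) auto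
  moreover have "enumeration_sign l0 (permute_list s l0) = (of_int (sign s) :: 'k)"
    if "s permutes {..<length l0}" for s
    using assms(1) that by (rule enumeration_sign_permute_list)
  ultimately show ?thesis using q by (simp add: mult.commute)
qed

lemma finite_dim_independent:
  fixes V X :: "('x \<Rightarrow> 'k::field) set"
  assumes "finite_dim V" "fs.independent X" "X \<subseteq> V"
  shows "finite X"
proof -
  obtain B where "finite B" "V \<subseteq> fs.span B" using assms(1) by (auto simp: finite_dim_def)
  then show ?thesis using fs.independent_span_bound[of B X] assms by blast
qed

lemma quot_basis_zero_iff:
  fixes V A :: "('x \<Rightarrow> 'k::field) set"
  shows "quot_basis V ({0} \<inter> W) A \<longleftrightarrow> A \<subseteq> V \<and> V \<subseteq> fs.span A \<and> fs.independent A"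
proof -
  have "fs.span (X \<union> ({0} \<inter> W)) = fs.span X" for X :: "('x \<Rightarrow> 'k) set"
    by (cases "0 \<in> W") (simp_all)
  then show ?thesis by (auto simp: quot_basis_def fs.dependent_def)
qed

text \<open>Fixing an enumeration \<open>l0\<close> turns the weight component into the ordinary
  linear dual of \<open>V r \<Gamma>\<close>, in which \<open>A\<close> has dual elements
  \<open>\<phi> a\<close>. Finiteness of \<open>A\<close> is a conclusion: these elements are
  independent in a space assumed finite-dimensional.\<close>

lemma koszul_dual_weight_dim_eq_card:
  fixes E :: "('k::field, 'e::ab_group_add) collection" and R
  defines "V r \<Gamma> \<equiv> koszul_dual_co E R \<Gamma> \<inter> of_weight r"
  assumes fin: "finite (verts \<Gamma>)" and fd: "finite_dim (koszul_dual_weight E R r \<Gamma>)"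
    and V: "fs.subspace (V r \<Gamma>)"
    and A: "A \<subseteq> V r \<Gamma>" "V r \<Gamma> \<subseteq> fs.span A" "fs.independent A"
  shows "finite A" "card A = koszul_dual_weight_dim E R r \<Gamma>"
proof -
  define W where "W = koszul_dual_weight E R r \<Gamma>"
  define l0 where "l0 = sorted_list_of_set (verts \<Gamma>)"
  have l0: "distinct l0" "set l0 = verts \<Gamma>" using fin by (auto simp: l0_def)
  define \<phi> where "\<phi> a = (\<lambda>(l, x). if distinct l \<and> set l = verts \<Gamma> \<and> x \<in> V r \<Gamma>
    then enumeration_sign l0 l * fs.representation A x a else (0::'k))" for a
  have sign_l0: "enumeration_sign l0 l0 = (1::'k)"
    using enumeration_sign_permute_list[OF l0(1) permutes_id] by simp
  have W_iff: "\<psi> \<in> W \<longleftrightarrow>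
    (\<forall>l x. \<psi> (l, x) \<noteq> 0 \<longrightarrow> distinct l \<and> set l = verts \<Gamma> \<and> x \<in> V r \<Gamma>) \<and>
    (\<forall>l p x. p permutes {..<length l} \<longrightarrow> \<psi> (permute_list p l, x) = of_int (sign p) * \<psi> (l, x)) \<and>
    (\<forall>l. \<forall>x\<in>V r \<Gamma>. \<forall>y\<in>V r \<Gamma>. \<psi> (l, x + y) = \<psi> (l, x) + \<psi> (l, y)) \<and>
    (\<forall>l a. \<forall>x\<in>V r \<Gamma>. \<psi> (l, fscale a x) = a * \<psi> (l, x))" for \<psi>
    unfolding W_def koszul_dual_weight_def V_def Let_def by blast
  have span_A: "x \<in> fs.span A" if "x \<in> V r \<Gamma>" for x using that A(2) by blast
  have \<phi>_W: "\<phi> a \<in> W" for a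
    unfolding W_iff
  proof (intro conjI allI ballI impI)
    fix l x assume "\<phi> a (l, x) \<noteq> 0"
    then show "distinct l" "set l = verts \<Gamma>" "x \<in> V r \<Gamma>" by (auto simp: \<phi>_def split: if_splits)
  next
    fix l :: "nat list" and p x assume p: "p permutes {..<length l}"
    show "\<phi> a (permute_list p l, x) = of_int (sign p) * \<phi> a (l, x)"
      using p l0 by (auto simp: \<phi>_def enumeration_sign_permute mult.assoc)
  next
    fix l x y assume xy: "x \<in> V r \<Gamma>" "y \<in> V r \<Gamma>"
    then have "x + y \<in> V r \<Gamma>" using V by (simp add: fs.subspace_add)
    then show "\<phi> a (l, x + y) = \<phi> a (l, x) + \<phi> a (l, y)"
      using xy fs.representation_add[OF A(3) span_A span_A, of y x] by (simp add: \<phi>_def algebra_simps)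
  next
    fix l c x assume x: "x \<in> V r \<Gamma>"
    then have "fscale c x \<in> V r \<Gamma>" using V by (simp add: fs.subspace_scale)
    then show "\<phi> a (l, fscale c x) = c * \<phi> a (l, x)"
      using x fs.representation_scale[OF A(3) span_A, of x c] by (simp add: \<phi>_def)
  qed
  have \<phi>_l0: "\<phi> a (l0, b) = (if a = b then 1 else 0)" if "b \<in> A" for a b
    using that A(1) l0 fs.representation_basis[OF A(3) that] by (auto simp: \<phi>_def sign_l0)
  have inj: "inj_on \<phi> A"
  proof (rule inj_onI)
    fix a b assume "a \<in> A" "b \<in> A" "\<phi> a = \<phi> b"
    then show "a = b" using \<phi>_l0[of a a] \<phi>_l0[of a b] by (metis zero_neq_one)
  qed
  have indep: "fs.independent (\<phi> ` A)"
    unfolding fs.dependent_def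
  proof
    assume "\<exists>f\<in>\<phi> ` A. f \<in> fs.span (\<phi> ` A - {f})"
    then obtain a where a: "a \<in> A" "\<phi> a \<in> fs.span (\<phi> ` A - {\<phi> a})" by blast
    \<comment> \<open>Evaluation at \<open>(l0, a)\<close> separates \<open>\<phi> a\<close> from
      the other dual elements.\<close>
    have "fs.span (\<phi> ` A - {\<phi> a}) \<subseteq> {\<psi>. \<psi> (l0, a) = 0}"
    proof (rule fs.span_minimal)
      show "\<phi> ` A - {\<phi> a} \<subseteq> {\<psi>. \<psi> (l0, a) = 0}" using \<phi>_l0[OF a(1)] by auto
      show "fs.subspace {\<psi>. \<psi> (l0, a) = 0}" by (rule fs.subspaceI) (auto simp: fscale_def)
    qed
    then show False using a \<phi>_l0[OF a(1), of a] by auto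
  qed
  have "finite (\<phi> ` A)"
    using fd[folded W_def] indep by (rule finite_dim_independent) (auto simp: \<phi>_W)
  then show finA: "finite A" using inj by (simp add: finite_image_iff)
  have "W \<subseteq> fs.span (\<phi> ` A)"
  proof
    fix \<psi> assume \<psi>: "\<psi> \<in> W"
    have scale: "\<psi> (l, fscale c x) = c * \<psi> (l, x)" if "x \<in> V r \<Gamma>" for l c x
      using \<psi> that unfolding W_iff by blast
    have add: "\<psi> (l, x + y) = \<psi> (l, x) + \<psi> (l, y)" if "x \<in> V r \<Gamma>" "y \<in> V r \<Gamma>" for l x y
      using \<psi> that unfolding W_iff by blast
    have zero: "\<psi> (l, 0) = 0" for l
      using scale[of 0 l 0] fs.subspace_0[OF V] by (simp add: fs.scale_zero_left)
    have sum: "\<psi> (l, \<Sum>b\<in>B. fscale (c b) b) = (\<Sum>b\<in>B. c b * \<psi> (l, b))"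
      if "finite B" "B \<subseteq> A" for l c B
      using that
    proof (induction B rule: finite_induct)
      case empty
      show ?case unfolding sum.empty by (rule zero)
    next
      case (insert b B)
      have "b \<in> V r \<Gamma>" "fscale (c b) b \<in> V r \<Gamma>" "(\<Sum>b\<in>B. fscale (c b) b) \<in> V r \<Gamma>"
        using insert.prems A(1) V
        by (auto intro!: fs.subspace_sum fs.subspace_scale)
      then have "\<psi> (l, fscale (c b) b + (\<Sum>b\<in>B. fscale (c b) b)) =
          c b * \<psi> (l, b) + (\<Sum>b\<in>B. c b * \<psi> (l, b))"
        using insert.IH insert.prems by (simp only: add scale insert_subset)
      then show ?case unfolding sum.insert[OF insert.hyps] .
    qed
    \<comment> \<open>The coefficients are the values on the basis at the reference enumeration. Any
      other enumeration arises from \<open>l0\<close> by a permutation, which contributes the same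
      sign on both sides.\<close>
    have "\<psi> = (\<Sum>a\<in>A. fscale (\<psi> (l0, a)) (\<phi> a))"
    proof
      fix lx :: "nat list \<times> ('e tree \<Rightarrow> 'k)"
      obtain l x where lx: "lx = (l, x)" by (cases lx)
      show "\<psi> lx = (\<Sum>a\<in>A. fscale (\<psi> (l0, a)) (\<phi> a)) lx"
      proof (cases "distinct l \<and> set l = verts \<Gamma> \<and> x \<in> V r \<Gamma>")
        case True
        then obtain p where p: "p permutes {..<length l0}" "l = permute_list p l0"
          using enumeration_eq_permute_list[of l0 l] l0 by metis
        have sign: "enumeration_sign l0 l = (of_int (sign p) :: 'k)"
          unfolding p(2) by (rule enumeration_sign_permute_list[OF l0(1) p(1)])
        have "\<psi> (l, x) = of_int (sign p) * \<psi> (l0, x)"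
          using \<psi> p unfolding W_iff by blast
        also have "\<psi> (l0, x) = \<psi> (l0, \<Sum>a\<in>A. fscale (fs.representation A x a) a)"
          using fs.sum_representation_eq[OF A(3) span_A finA order_refl] True by simp
        also have "\<dots> = (\<Sum>a\<in>A. fs.representation A x a * \<psi> (l0, a))" by (rule sum[OF finA order_refl])
        finally have "\<psi> (l, x) = (\<Sum>a\<in>A. \<psi> (l0, a) * (enumeration_sign l0 l * fs.representation A x a))"
          by (simp add: sign sum_distrib_left mult_ac)
        then show ?thesis using True by (simp add: lx sum_fun_apply fscale_def \<phi>_def)
      next
        case False
        then have "\<psi> (l, x) = 0" using \<psi> unfolding W_iff by blast
        moreover have "\<phi> a (l, x) = 0" for a by (simp only: \<phi>_def prod.case if_not_P[OF False])
        ultimately show ?thesis by (simp add: lx sum_fun_apply fscale_def)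
      qed
    qed
    then show "\<psi> \<in> fs.span (\<phi> ` A)"
      by (metis (no_types, lifting) fs.span_sum fs.span_scale fs.span_base imageI)
  qed
  then have "card (\<phi> ` A) = fs.dim W"
    using indep \<phi>_W by (intro fs.basis_card_eq_dim) auto
  then show "card A = koszul_dual_weight_dim E R r \<Gamma>"
    using card_image[OF inj] by (simp add: koszul_dual_weight_dim_def W_def)
qed

section \<open>Generating functions of products\<close>

text \<open>Multiplying generating functions counts choice functions by total weight. Finiteness is
  part of the induction, as the sets \<open>W i\<close> may be infinite and only their pieces of
  fixed weight are assumed finite.\<close>

lemma weight_generating_function_prod:
  fixes W :: "'i \<Rightarrow> 'a set" and w :: "'a \<Rightarrow> nat"
  assumes "finite I" "\<And>i s. i \<in> I \<Longrightarrow> finite {x \<in> W i. w x = s}"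
  shows "finite {y \<in> PiE I W. (\<Sum>i\<in>I. w (y i)) = n} \<and>
    fps_nth (\<Prod>i\<in>I. Abs_fps (\<lambda>s. int (card {x \<in> W i. w x = s}))) n =
      int (card {y \<in> PiE I W. (\<Sum>i\<in>I. w (y i)) = n})"
  using assms
proof (induction I arbitrary: n rule: finite_induct)
  case empty
  show ?case
  proof (cases "n = 0")
    case True
    then have "{y \<in> PiE {} W. (\<Sum>i\<in>{}. w (y i)) = n} = {\<lambda>_. undefined}" by auto
    then show ?thesis using True by simp
  next
    case False
    then show ?thesis by simp
  qed
next
  case (insert j I)
  define T where "T m = {y \<in> PiE I W. (\<Sum>i\<in>I. w (y i)) = m}" for m
  have T: "finite (T m)" "fps_nth (\<Prod>i\<in>I. Abs_fps (\<lambda>s. int (card {x \<in> W i. w x = s}))) m = int (card (T m))" for m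
    using insert.IH[of m] insert.prems by (auto simp: T_def)
  let ?f = "\<lambda>(x, y). y(j := x)"
  let ?P = "\<lambda>s. {x \<in> W j. w x = s} \<times> T (n - s)"
  have sum_upd: "(\<Sum>i\<in>insert j I. w ((y(j := x)) i)) = w x + (\<Sum>i\<in>I. w (y i))" for x y
  proof -
    have "(\<Sum>i\<in>I. w ((y(j := x)) i)) = (\<Sum>i\<in>I. w (y i))"
      using insert.hyps(2) by (intro sum.cong) auto
    then show ?thesis using insert.hyps by simp
  qed
  \<comment> \<open>Split off the value at \<open>j\<close> and sort by its weight \<open>s\<close>;
    the remaining function has weight \<open>n - s\<close>, and \<open>s \<le> n\<close> keeps the
    subtraction exact.\<close>
  have eq: "{y \<in> PiE (insert j I) W. (\<Sum>i\<in>insert j I. w (y i)) = n} = ?f ` (\<Union>s\<in>{..n}. ?P s)"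
  proof (intro equalityI subsetI)
    fix z assume z: "z \<in> {y \<in> PiE (insert j I) W. (\<Sum>i\<in>insert j I. w (y i)) = n}"
    then obtain x y where xy: "z = y(j := x)" "x \<in> W j" "y \<in> PiE I W"
      by (auto simp: PiE_insert_eq)
    then have "w x + (\<Sum>i\<in>I. w (y i)) = n" using z sum_upd[of y x] by simp
    then have "(x, y) \<in> ?P (w x)" "w x \<le> n" using xy by (auto simp: T_def)
    then show "z \<in> ?f ` (\<Union>s\<in>{..n}. ?P s)" using xy(1) by force
  next
    fix z assume "z \<in> ?f ` (\<Union>s\<in>{..n}. ?P s)"
    then obtain s x y where xy: "z = y(j := x)" "x \<in> W j" "w x = s" "y \<in> T (n - s)" "s \<le> n" by auto
    then show "z \<in> {y \<in> PiE (insert j I) W. (\<Sum>i\<in>insert j I. w (y i)) = n}"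
      using sum_upd[of y x] by (auto simp: T_def PiE_insert_eq)
  qed
  have inj: "inj_on ?f (\<Union>s\<in>{..n}. ?P s)"
  proof (rule inj_onI, clarsimp simp: T_def)
    fix x y x' y' assume y: "y \<in> PiE I W" "y' \<in> PiE I W" and eq: "y(j := x) = y'(j := x')"
    have "y i = y' i" if "i \<in> I" for i using fun_cong[OF eq, of i] insert.hyps(2) that by (cases "i = j") auto
    then show "x = x' \<and> y = y'" using fun_cong[OF eq, of j] y by (auto intro: PiE_ext)
  qed
  have fin: "finite (?P s)" for s using insert.prems T(1) by auto
  have "card (\<Union>s\<in>{..n}. ?P s) = (\<Sum>s\<le>n. card (?P s))"
    using fin by (intro card_UN_disjoint) auto
  then have "card {y \<in> PiE (insert j I) W. (\<Sum>i\<in>insert j I. w (y i)) = n} =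
      (\<Sum>s\<le>n. card {x \<in> W j. w x = s} * card (T (n - s)))"
    unfolding eq by (simp add: card_image[OF inj] card_cartesian_product)
  moreover have "fps_nth (\<Prod>i\<in>insert j I. Abs_fps (\<lambda>s. int (card {x \<in> W i. w x = s}))) n =
      (\<Sum>s\<le>n. int (card {x \<in> W j. w x = s}) * int (card (T (n - s))))"
    using insert.hyps by (simp add: fps_mult_nth T(2) atMost_atLeast0)
  moreover have "finite {y \<in> PiE (insert j I) W. (\<Sum>i\<in>insert j I. w (y i)) = n}"
    unfolding eq using fin by (intro finite_imageI finite_UN_I) auto
  ultimately show ?case by simp
qed

section \<open>Weight gradings of quadratic data\<close>

lemma linear_weight_part: "Vector_Spaces.linear fscale fscale (weight_part r)"
  by (simp add: Vector_Spaces.linear_iff fs.vector_space_axioms)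
    (auto simp: weight_part_def fscale_def fun_eq_iff)

lemma subspace_graded_space: "graded_space V \<Longrightarrow> fs.subspace V"
  by (simp add: graded_space_def)

lemma graded_space_free_space: "graded_space (free_space E \<Gamma>)"
  unfolding graded_space_def
proof (intro conjI ballI allI)
  show "fs.subspace (free_space E \<Gamma>)"
  proof (rule fs.subspaceI)
    show "0 \<in> free_space E \<Gamma>" by (simp add: free_space_def)
    fix x y assume xy: "x \<in> free_space E \<Gamma>" "y \<in> free_space E \<Gamma>"
    then have "finsupp (x + y)" by (intro finsupp_add) (simp_all add: free_space_def finsupp_def)
    then show "x + y \<in> free_space E \<Gamma>"
      using xy by (auto simp: free_space_def finsupp_def) (metis add_0)
  next
    fix c x assume x: "x \<in> free_space E \<Gamma>"
    then have "finsupp (fscale c x)" by (intro finsupp_scale) (simp add: free_space_def finsupp_def)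
    then show "fscale c x \<in> free_space E \<Gamma>"
      using x by (auto simp: free_space_def finsupp_def fscale_def)
  qed
  fix x r assume x: "x \<in> free_space E \<Gamma>"
  then show "finsupp x" by (simp add: free_space_def finsupp_def)
  have "finite {t. weight_part r x t \<noteq> 0}"
    by (rule finite_subset[of _ "{t. x t \<noteq> 0}"]) (use x in \<open>auto simp: weight_part_def free_space_def\<close>)
  then show "weight_part r x \<in> free_space E \<Gamma>"
    using x by (auto simp: free_space_def weight_part_def split: if_splits)
qed

lemma relation_ideal_subset: "relation_ideal E R \<Gamma> \<subseteq> free_space E \<Gamma>"
  by (auto simp: relation_ideal_def)

text \<open>Each ideal in the intersection is closed under weight parts; intersecting with the free
  space supplies finite support.\<close>

lemma graded_space_relation_ideal:
  assumes \<Gamma>: "\<Gamma> \<in> connected_graphs"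
  shows "graded_space (relation_ideal E R \<Gamma>)"
proof -
  define \<J> where "\<J> = {J. contractad_ideal E J \<and> (\<forall>\<Delta>\<in>connected_graphs. R \<Delta> \<subseteq> J \<Delta>)}"
  have eq: "relation_ideal E R \<Gamma> = free_space E \<Gamma> \<inter> (\<Inter>J\<in>\<J>. J \<Gamma>)"
    by (auto simp: relation_ideal_def \<J>_def)
  have sub: "fs.subspace (J \<Gamma>)" "\<And>x r. x \<in> J \<Gamma> \<Longrightarrow> weight_part r x \<in> J \<Gamma>" if "J \<in> \<J>" for J
    using that \<Gamma> by (auto simp: \<J>_def contractad_ideal_def subcollection_def)
  have F: "fs.subspace (free_space E \<Gamma>)"
    by (rule subspace_graded_space[OF graded_space_free_space])
  have "fs.subspace (\<Inter>J\<in>\<J>. J \<Gamma>)"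
    using sub(1) by (auto intro!: fs.subspace_Inter)
  then have "fs.subspace (relation_ideal E R \<Gamma>)" unfolding eq using F by (rule fs.subspace_inter[rotated])
  moreover have "finsupp x \<and> weight_part r x \<in> relation_ideal E R \<Gamma>" if "x \<in> relation_ideal E R \<Gamma>" for x r
    using that graded_space_free_space[of E \<Gamma>] sub(2) unfolding eq graded_space_def by blast
  ultimately show ?thesis by (simp add: graded_space_def)
qed

lemma koszul_dual_co_subset:
  assumes \<Gamma>: "\<Gamma> \<in> connected_graphs"
  shows "koszul_dual_co E R \<Gamma> \<subseteq> free_space (suspension E) \<Gamma>"
  unfolding koszul_dual_co_def quadratic_cocontractad_def
proof (rule fs.span_minimal)
  show "fs.subspace (free_space (suspension E) \<Gamma>)"
    by (rule subspace_graded_space[OF graded_space_free_space])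
  show "\<Union> {C \<Gamma> |C. sub_cocontractad (suspension E) C \<and> (\<forall>\<Delta>\<in>connected_graphs. \<forall>x\<in>C \<Delta>.
      weight_part 2 x \<in> suspended_relations R \<Delta>)} \<subseteq> free_space (suspension E) \<Gamma>"
    using \<Gamma> unfolding sub_cocontractad_def subcollection_def by blast
qed

text \<open>Every sub-cocontractad in the sum is closed under weight parts, and a linear projection
  maps the span of a stable set into that span.\<close>

lemma graded_space_koszul_dual_co:
  fixes E :: "('k::field, 'e::ab_group_add) collection"
  assumes \<Gamma>: "\<Gamma> \<in> connected_graphs"
  shows "graded_space (koszul_dual_co E R \<Gamma>)"
proof -
  define X where "X = \<Union> {C \<Gamma> |C. sub_cocontractad (suspension E) C \<and>
    (\<forall>\<Delta>\<in>connected_graphs. \<forall>x\<in>C \<Delta>. weight_part 2 x \<in> suspended_relations R \<Delta>)}"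
  have eq: "koszul_dual_co E R \<Gamma> = fs.span X"
    by (simp add: koszul_dual_co_def quadratic_cocontractad_def X_def)
  have X: "weight_part r ` X \<subseteq> X" for r
  proof (rule image_subsetI)
    fix x assume "x \<in> X"
    then obtain C where C: "x \<in> C \<Gamma>" "sub_cocontractad (suspension E) C"
        "\<forall>\<Delta>\<in>connected_graphs. \<forall>x\<in>C \<Delta>. weight_part 2 x \<in> suspended_relations R \<Delta>"
      unfolding X_def by blast
    then have "weight_part r x \<in> C \<Gamma>"
      using \<Gamma> by (simp add: sub_cocontractad_def subcollection_def)
    then show "weight_part r x \<in> X" unfolding X_def using C(2,3) by blast
  qed
  have "weight_part r x \<in> fs.span X" if "x \<in> fs.span X" for x r
  proof -
    interpret w: Vector_Spaces.linear fscale fscale "weight_part r :: _ \<Rightarrow> _ \<Rightarrow> 'k"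
      by (rule linear_weight_part)
    have "weight_part r x \<in> fs.span (weight_part r ` X)" using that by (simp add: w.span_image)
    then show ?thesis using fs.span_mono[OF X] by blast
  qed
  moreover have "finsupp x" if "x \<in> koszul_dual_co E R \<Gamma>" for x
    using that koszul_dual_co_subset[OF \<Gamma>, of E R] by (auto simp: free_space_def finsupp_def)
  ultimately show ?thesis by (simp add: graded_space_def eq fs.subspace_span)
qed

section \<open>The Euler characteristic of the Koszul complex\<close>

lemma of_gradeD: "x \<in> of_grade \<gamma> \<Longrightarrow> x p \<noteq> 0 \<Longrightarrow> grade p = \<gamma>"
  unfolding of_grade_def by blast

text \<open>The augmentation reads one coefficient, at a bare leaf paired with a list of one bare
  leaf, and this pair has grade \<open>(0, 0)\<close>.\<close>

lemma augmentation_of_grade: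
  fixes x :: "'e tree \<times> 'e tree list \<Rightarrow> 'k::field"
  assumes "x \<in> of_grade (r, n)" "augmentation \<Gamma> x \<noteq> 0"
  shows "r = 0 \<and> n = 0 \<and> card (verts \<Gamma>) = 1"
proof -
  have 1: "card (verts \<Gamma>) = 1" using assms(2) by (auto simp: augmentation_def split: if_splits)
  let ?p = "(Leaf (the_elem (verts \<Gamma>)), [Leaf (the_elem (verts \<Gamma>))]) :: 'e tree \<times> 'e tree list"
  have "x ?p \<noteq> 0" using assms(2) 1 by (auto simp: augmentation_def fun_eq_iff)
  then have "grade ?p = (r, n)" using of_gradeD[OF assms(1), of ?p] by blast
  then show ?thesis using 1 by (simp add: grade_def)
qed

lemma augmentation_grade_part: "augmentation \<Gamma> (grade_part (0, 0) x) = augmentation \<Gamma> x"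
  by (simp add: augmentation_def grade_part_def grade_def)

lemma augmentation_add: "augmentation \<Gamma> (x + y) = augmentation \<Gamma> x + augmentation \<Gamma> y"
  by (simp add: augmentation_def fun_eq_iff)

lemma augmentation_scale: "augmentation \<Gamma> (fscale c x) = fscale c (augmentation \<Gamma> x)"
  by (simp add: augmentation_def fun_eq_iff fscale_def)

text \<open>The total weight includes that of the lower tree, so the complex of total weight
  \<open>n\<close> stops at degree \<open>n\<close>.\<close>

lemma of_grade_empty: "r > n \<Longrightarrow> of_grade (r, n) = {0}"
  by (force simp: of_grade_def grade_def fun_eq_iff split: prod.splits)

locale koszul_data =
  fixes E :: "('k::field, 'e::ab_group_add) collection"
    and R :: "graph \<Rightarrow> ('e tree \<Rightarrow> 'k) set"
  assumes contractad_finite: "\<And>\<Gamma> r. \<Gamma> \<in> connected_graphs \<Longrightarrow> contractad_finite E R r \<Gamma>"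
    and dual_finite: "\<And>\<Gamma> r. \<Gamma> \<in> connected_graphs \<Longrightarrow> finite_dim (koszul_dual_weight E R r \<Gamma>)"
    and koszul: "koszul E R"
begin

definition dual_basis :: "nat \<Rightarrow> graph \<Rightarrow> ('e tree \<Rightarrow> 'k) set" where
  "dual_basis r \<Gamma> =
    (SOME A. quot_basis (koszul_dual_co E R \<Gamma> \<inter> of_weight r) ({0} \<inter> of_weight r) A)"

text \<open>The same choice as in \<open>quot_dim\<close>, so its cardinality is the weight
  dimension without any comparison of bases.\<close>

definition quotient_basis :: "nat \<Rightarrow> graph \<Rightarrow> ('e tree \<Rightarrow> 'k) set" where
  "quotient_basis r \<Gamma> = (SOME S. finite S \<and>
    quot_basis (free_space E \<Gamma> \<inter> of_weight r) (relation_ideal E R \<Gamma> \<inter> of_weight r) S)"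

lemma dual_basis:
  assumes \<Gamma>: "\<Gamma> \<in> connected_graphs"
  shows "quot_basis (koszul_dual_co E R \<Gamma> \<inter> of_weight r) ({0} \<inter> of_weight r) (dual_basis r \<Gamma>)"
    "finite (dual_basis r \<Gamma>)" "card (dual_basis r \<Gamma>) = koszul_dual_weight_dim E R r \<Gamma>"
proof -
  let ?V = "koszul_dual_co E R \<Gamma> \<inter> of_weight r"
  have V: "fs.subspace ?V"
    using graded_space_koszul_dual_co[OF \<Gamma>, of E R] subspace_of_weight
    by (intro fs.subspace_inter) (auto simp: graded_space_def)
  have zero: "({0} \<inter> of_weight r :: ('e tree \<Rightarrow> 'k) set) = {0}"
    by (auto simp: of_weight_def)
  have "\<exists>A. quot_basis ?V ({0} \<inter> of_weight r) A"
  proof -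
    have "fs.subspace ({0} \<inter> of_weight r :: ('e tree \<Rightarrow> 'k) set)" unfolding zero by (rule fs.subspace_single_0)
    moreover have "{0} \<inter> of_weight r \<subseteq> ?V" unfolding zero using fs.subspace_0[OF V] by blast
    ultimately show ?thesis using quot_basis_exists[OF V] by blast
  qed
  then show *: "quot_basis ?V ({0} \<inter> of_weight r) (dual_basis r \<Gamma>)"
    unfolding dual_basis_def by (rule someI_ex)
  then have A: "dual_basis r \<Gamma> \<subseteq> ?V" "?V \<subseteq> fs.span (dual_basis r \<Gamma>)"
      "fs.independent (dual_basis r \<Gamma>)"
    by (simp_all add: quot_basis_zero_iff)
  show "finite (dual_basis r \<Gamma>)" "card (dual_basis r \<Gamma>) = koszul_dual_weight_dim E R r \<Gamma>"
    using koszul_dual_weight_dim_eq_card[OF finite_verts_connected[OF \<Gamma>] dual_finite[OF \<Gamma>] V A] .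
qed

lemma quotient_basis:
  assumes \<Gamma>: "\<Gamma> \<in> connected_graphs"
  shows "quot_basis (free_space E \<Gamma> \<inter> of_weight r) (relation_ideal E R \<Gamma> \<inter> of_weight r)
      (quotient_basis r \<Gamma>)"
    "finite (quotient_basis r \<Gamma>)" "card (quotient_basis r \<Gamma>) = contractad_weight_dim E R r \<Gamma>"
proof -
  have ex: "\<exists>S. finite S \<and>
      quot_basis (free_space E \<Gamma> \<inter> of_weight r) (relation_ideal E R \<Gamma> \<inter> of_weight r) S"
    using contractad_finite[OF \<Gamma>, of r] by (simp add: contractad_finite_def quot_finite_dim_def)
  then have "finite (quotient_basis r \<Gamma>) \<and>
      quot_basis (free_space E \<Gamma> \<inter> of_weight r) (relation_ideal E R \<Gamma> \<inter> of_weight r)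
        (quotient_basis r \<Gamma>)"
    unfolding quotient_basis_def by (rule someI_ex)
  then show "finite (quotient_basis r \<Gamma>)"
    "quot_basis (free_space E \<Gamma> \<inter> of_weight r) (relation_ideal E R \<Gamma> \<inter> of_weight r)
      (quotient_basis r \<Gamma>)" by simp_all
  show "card (quotient_basis r \<Gamma>) = contractad_weight_dim E R r \<Gamma>"
    using ex by (simp add: contractad_weight_dim_def quot_dim_def quot_finite_dim_def quotient_basis_def)
qed

lemma block_connected:
  assumes "\<Gamma> \<in> connected_graphs" "I \<in> graph_partitions \<Gamma>" "G \<in> I"
  shows "induced \<Gamma> G \<in> connected_graphs"
  using assms induced_in_connected_graphs by (auto simp: connected_graphs_def graph_partitions_def)

section \<open>The Koszul complex on a fixed connected graph\<close>

context
  fixes \<Gamma> :: graph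
  assumes \<Gamma>: "\<Gamma> \<in> connected_graphs"
begin

interpretation contraction_bases \<Gamma> "koszul_dual_co E R" "free_space E" "relation_ideal E R"
  dual_basis quotient_basis
proof
  show "finite (verts \<Gamma>)" by (rule finite_verts_connected[OF \<Gamma>])
  fix I assume I: "I \<in> graph_partitions \<Gamma>"
  have conn: "contract \<Gamma> I \<in> connected_graphs" by (rule contract_partition_connected(1)[OF \<Gamma> I])
  show "graded_space (koszul_dual_co E R (contract \<Gamma> I))" by (rule graded_space_koszul_dual_co[OF conn])
  show "quot_basis (koszul_dual_co E R (contract \<Gamma> I) \<inter> of_weight r) ({0} \<inter> of_weight r)
      (dual_basis r (contract \<Gamma> I))" for r by (rule dual_basis(1)[OF conn])
  fix G assume G: "G \<in> I"
  have conn: "induced \<Gamma> G \<in> connected_graphs" by (rule block_connected[OF \<Gamma> I G])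
  show "graded_space (free_space E (induced \<Gamma> G))" by (rule graded_space_free_space)
  show "graded_space (relation_ideal E R (induced \<Gamma> G))" by (rule graded_space_relation_ideal[OF conn])
  show "relation_ideal E R (induced \<Gamma> G) \<subseteq> free_space E (induced \<Gamma> G)" by (rule relation_ideal_subset)
  show "quot_basis (free_space E (induced \<Gamma> G) \<inter> of_weight r)
      (relation_ideal E R (induced \<Gamma> G) \<inter> of_weight r) (quotient_basis r (induced \<Gamma> G))" for r
    by (rule quotient_basis(1)[OF conn])
  show "leaves t = G" if "x \<in> free_space E (induced \<Gamma> G)" "x t \<noteq> 0" for x t
    using that by (auto simp: free_space_def trees_def induced_def)
qed

text \<open>For each partition the lower factor and the family of upper factors are chosen
  independently; the lower factor takes \<open>r\<close> of the total weight \<open>n\<close> and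
  leaves \<open>n - r\<close> to be distributed over the blocks.\<close>

lemma card_basis_index:
  assumes "r \<le> n"
  shows "finite (basis_index (r, n))"
    "card (basis_index (r, n)) = (\<Sum>I\<in>graph_partitions \<Gamma>. card (dual_basis r (contract \<Gamma> I)) *
      card {y \<in> \<Pi>\<^sub>E G\<in>I. \<Union>s. quotient_basis s (induced \<Gamma> G). (\<Sum>G\<in>I. weight_of (y G)) = n - r})"
    "\<And>I. I \<in> graph_partitions \<Gamma> \<Longrightarrow>
      int (card {y \<in> \<Pi>\<^sub>E G\<in>I. \<Union>s. quotient_basis s (induced \<Gamma> G). (\<Sum>G\<in>I. weight_of (y G)) = n - r}) =
        fps_nth (\<Prod>G\<in>I. weight_series (contractad_weight_dim E R) (induced \<Gamma> G)) (n - r)"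
proof -
  let ?Y = "\<lambda>I. {y \<in> \<Pi>\<^sub>E G\<in>I. \<Union>s. quotient_basis s (induced \<Gamma> G). (\<Sum>G\<in>I. weight_of (y G)) = n - r}"
  have fibre: "{x \<in> \<Union>s. quotient_basis s (induced \<Gamma> G). weight_of x = s} = quotient_basis s (induced \<Gamma> G)"
    if "I \<in> graph_partitions \<Gamma>" "G \<in> I" for I G s
    using weight_of_S[OF that] by blast
  have gf: "finite (?Y I) \<and>
      fps_nth (\<Prod>G\<in>I. Abs_fps (\<lambda>s. int (card {x \<in> \<Union>s. quotient_basis s (induced \<Gamma> G). weight_of x = s}))) (n - r)
        = int (card (?Y I))" if I: "I \<in> graph_partitions \<Gamma>" for I
  proof (rule weight_generating_function_prod)
    show "finite I" by (rule finite_blocks[OF finite_verts partition[OF I]])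
    show "finite {x \<in> \<Union>s. quotient_basis s (induced \<Gamma> G). weight_of x = s}" if "G \<in> I" for G s
      unfolding fibre[OF I that] by (rule quotient_basis(2)[OF block_connected[OF \<Gamma> I that]])
  qed
  have "Abs_fps (\<lambda>s. int (card {x \<in> \<Union>s. quotient_basis s (induced \<Gamma> G). weight_of x = s})) =
      weight_series (contractad_weight_dim E R) (induced \<Gamma> G)"
    if I: "I \<in> graph_partitions \<Gamma>" and G: "G \<in> I" for I G
    unfolding fibre[OF I G] weight_series_def quotient_basis(3)[OF block_connected[OF \<Gamma> I G]] ..
  then have prod_eq: "(\<Prod>G\<in>I. Abs_fps (\<lambda>s. int (card {x \<in> \<Union>s. quotient_basis s (induced \<Gamma> G). weight_of x = s}))) =
      (\<Prod>G\<in>I. weight_series (contractad_weight_dim E R) (induced \<Gamma> G))"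
    if "I \<in> graph_partitions \<Gamma>" for I
    using that by (intro prod.cong) auto
  show "int (card (?Y I)) = fps_nth (\<Prod>G\<in>I. weight_series (contractad_weight_dim E R) (induced \<Gamma> G)) (n - r)"
    if "I \<in> graph_partitions \<Gamma>" for I
    using conjunct2[OF gf[OF that]] unfolding prod_eq[OF that] by simp
  have eq: "basis_index (r, n) = (SIGMA I:graph_partitions \<Gamma>. dual_basis r (contract \<Gamma> I) \<times> ?Y I)"
    using assms by (auto simp: basis_index_def)
  have fin: "finite (dual_basis r (contract \<Gamma> I) \<times> ?Y I)" if "I \<in> graph_partitions \<Gamma>" for I
    using gf[OF that] dual_basis(2)[OF contract_partition_connected(1)[OF \<Gamma> that]]
    by (intro finite_cartesian_product) auto
  show "finite (basis_index (r, n))"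
    unfolding eq by (rule finite_SigmaI[OF finite_graph_partitions[OF finite_verts] fin])
  show "card (basis_index (r, n)) = (\<Sum>I\<in>graph_partitions \<Gamma>. card (dual_basis r (contract \<Gamma> I)) * card (?Y I))"
    unfolding eq using fin finite_graph_partitions[OF finite_verts]
    by (subst card_SigmaI) (auto simp: card_cartesian_product)
qed

text \<open>
  The Koszul hypothesis equates the boundaries with the cycles of augmentation zero. This already
  contains that the differential preserves \<open>koszul_space\<close> and \<open>koszul_ker\<close> and squares to zero
  modulo \<open>koszul_ker\<close>, so no computation with signs is needed.
\<close>

lemma koszul_euler_characteristic:
  "(\<Sum>r\<le>n. (- 1) ^ r * int (card (basis_index (r, n)))) = (if n = 0 \<and> card (verts \<Gamma>) = 1 then 1 else 0)"
proof -
  let ?d = "koszul_diff E \<Gamma>"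
  let ?X = "koszul_space E R \<Gamma>" and ?Y = "koszul_ker E R \<Gamma>"
  interpret d: Vector_Spaces.linear fscale fscale "koszul_diff E \<Gamma>" by (rule linear_koszul_diff)
  have X_eq: "?X = contraction_product (koszul_dual_co E R) (free_space E) \<Gamma>"
    and Y_eq: "?Y = contraction_product_ker (koszul_dual_co E R) (free_space E) (relation_ideal E R) \<Gamma>"
    by (simp_all add: koszul_space_def koszul_ker_def)
  have X: "fs.subspace ?X" unfolding X_eq contraction_product_def by (rule fs.subspace_span)
  have Y: "fs.subspace ?Y" unfolding Y_eq contraction_product_ker_def by (rule fs.subspace_span)
  have YX: "?Y \<subseteq> ?X" unfolding X_eq Y_eq by (rule contraction_product_ker_le)
  have X_part: "grade_part \<gamma> x \<in> ?X \<inter> of_grade \<gamma>" if "x \<in> ?X" for x \<gamma>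
    using that grade_part_contraction_product grade_part_in_of_grade unfolding X_eq by blast
  have Y_part: "grade_part \<gamma> x \<in> ?Y \<inter> of_grade \<gamma>" if "x \<in> ?Y" for x \<gamma>
    using that grade_part_contraction_product_ker grade_part_in_of_grade unfolding Y_eq by blast
  have boundary: "?d y + z \<in> ?X \<and> ?d (?d y + z) \<in> ?Y \<and> augmentation \<Gamma> (?d y + z) = 0"
    if "y \<in> ?X" "z \<in> ?Y" for y z
  proof -
    have "?d y + z \<in> koszul_boundaries E R \<Gamma>" using that by (auto simp: koszul_boundaries_def)
    then show ?thesis using koszul \<Gamma> by (simp add: koszul_def koszul_cycles_def)
  qed
  have cycle: "\<exists>y z. y \<in> ?X \<and> z \<in> ?Y \<and> x = ?d y + z"
    if "x \<in> ?X" "?d x \<in> ?Y" "augmentation \<Gamma> x = 0" for x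
  proof -
    have "x \<in> {x \<in> koszul_cycles E R \<Gamma>. augmentation \<Gamma> x = 0}"
      using that by (simp add: koszul_cycles_def)
    then have "x \<in> koszul_boundaries E R \<Gamma>" using koszul \<Gamma> by (simp add: koszul_def)
    then show ?thesis by (auto simp: koszul_boundaries_def)
  qed
  have d_X: "?d y \<in> ?X" if "y \<in> ?X" for y
    using boundary[OF that fs.subspace_0[OF Y]] by simp
  have d_grade: "?d x \<in> of_grade (r, n)" if "x \<in> of_grade (Suc r, n)" for x r
  proof -
    have "grade_part (Suc r, n) x = x" using that grade_part_of_grade by metis
    then have "?d x = grade_part (r, n) (?d x)" using koszul_diff_grade_part(1)[of E \<Gamma> r n x] by simp
    then show ?thesis using grade_part_in_of_grade by metis
  qed
  have grade_add: "x + y \<in> of_grade \<gamma>" if "x \<in> of_grade \<gamma>" "y \<in> of_grade \<gamma>"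
    for x y :: "'e tree \<times> 'e tree list \<Rightarrow> 'k" and \<gamma>
    using subspace_of_grade that by (rule fs.subspace_add)
  have d_grade_0: "?d x = 0" if "x \<in> of_grade (0, n)" for x
  proof -
    have "grade_part (0, n) x = x" using that grade_part_of_grade by metis
    then show ?thesis using koszul_diff_grade_part(2)[of E \<Gamma> n x] by simp
  qed
  \<comment> \<open>The hypothesis yields \<open>y\<close> and \<open>z\<close> of mixed grades;
    projecting the equation to grade \<open>(r, n)\<close> replaces them by homogeneous
    ones.\<close>
  have graded_cycle: "x \<in> {?d y + z |y z. y \<in> ?X \<inter> of_grade (Suc r, n) \<and> z \<in> ?Y \<inter> of_grade (r, n)}"
    if x: "x \<in> ?X" "x \<in> of_grade (r, n)" "?d x \<in> ?Y" "augmentation \<Gamma> x = 0" for x r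
  proof -
    obtain y z where yz: "y \<in> ?X" "z \<in> ?Y" "x = ?d y + z" using cycle x by metis
    interpret g: Vector_Spaces.linear fscale fscale "grade_part (r, n) :: _ \<Rightarrow> _ \<Rightarrow> 'k"
      by (rule linear_grade_part)
    have "x = grade_part (r, n) x" using x(2) grade_part_of_grade by metis
    also have "\<dots> = ?d (grade_part (Suc r, n) y) + grade_part (r, n) z"
      unfolding yz(3) g.add koszul_diff_grade_part ..
    finally show ?thesis using X_part[OF yz(1)] Y_part[OF yz(2)] by blast
  qed
  define H_exists where "H_exists \<longleftrightarrow> n = 0 \<and> card (verts \<Gamma>) = 1"
  let ?K = "\<lambda>r. ?X \<inter> of_grade (r, n)" and ?N = "\<lambda>r. ?Y \<inter> of_grade (r, n)"
  let ?B = "{?d y + z |y z. y \<in> ?K (Suc 0) \<and> z \<in> ?N 0}"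
  have K: "fs.subspace (?K r)" and N: "fs.subspace (?N r)" for r
    using X Y subspace_of_grade by (auto intro!: fs.subspace_inter)
  \<comment> \<open>On lower weight zero the differential vanishes, so every element is a cycle and
    the boundaries are cut out by the augmentation alone.\<close>
  have B_eq: "?B = {x \<in> ?K 0. augmentation \<Gamma> x = 0}"
  proof (intro equalityI subsetI)
    fix x assume "x \<in> ?B"
    then obtain y z where yz: "x = ?d y + z" "y \<in> ?K (Suc 0)" "z \<in> ?N 0" by blast
    then have "x \<in> of_grade (0, n)" using d_grade grade_add by simp
    then show "x \<in> {x \<in> ?K 0. augmentation \<Gamma> x = 0}" using boundary yz by auto
  next
    fix x assume "x \<in> {x \<in> ?K 0. augmentation \<Gamma> x = 0}"
    then have x: "x \<in> ?X" "x \<in> of_grade (0, n)" "augmentation \<Gamma> x = 0" by auto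
    have "?d x \<in> ?Y" using d_grade_0[OF x(2)] fs.subspace_0[OF Y] by simp
    then show "x \<in> ?B" using graded_cycle[of x 0] x by simp
  qed
  have "\<exists>H. finite H \<and> quot_basis (?K 0) ?B H \<and> card H = (if H_exists then 1 else 0)"
  proof (cases H_exists)
    case False
    then have "augmentation \<Gamma> x = 0" if "x \<in> ?K 0" for x
      using augmentation_of_grade[of x 0 n \<Gamma>] that unfolding H_exists_def by blast
    then have "?B = ?K 0" unfolding B_eq by blast
    moreover have "quot_basis (?K 0) (?K 0) {}" using fs.span_superset by (simp add: quot_basis_def)
    ultimately show ?thesis using False by (intro exI[of _ "{}"]) simp
  next
    case True
    then have n: "n = 0" and 1: "card (verts \<Gamma>) = 1" by (simp_all add: H_exists_def)
    \<comment> \<open>Surjectivity of the augmentation provides a cycle of augmentation one. Its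
      component of grade \<open>(0, 0)\<close> has the same augmentation and represents the
      one-dimensional homology.\<close>
    have "(\<lambda>_. 1) \<in> augmentation \<Gamma> ` koszul_cycles E R \<Gamma>"
      using koszul \<Gamma> 1 by (simp add: koszul_def unit_space_def)
    then obtain x where x: "x \<in> ?X" "augmentation \<Gamma> x = (\<lambda>_. 1)" by (auto simp: koszul_cycles_def)
    define x0 where "x0 = grade_part (0, n) x"
    have x0: "x0 \<in> ?K 0" using X_part[OF x(1)] by (simp add: x0_def)
    have aug: "augmentation \<Gamma> x0 = (\<lambda>_. 1)" unfolding x0_def n augmentation_grade_part by (rule x(2))
    define B where "B = ?B"
    have B': "B = {x \<in> ?K 0. augmentation \<Gamma> x = 0}" unfolding B_def by (rule B_eq)
    have B: "fs.subspace B"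
      unfolding B' using K[of 0]
      by (intro fs.subspaceI)
        (auto simp: fs.subspace_def augmentation_add augmentation_scale augmentation_def fscale_def fun_eq_iff split: if_splits)
    have "quot_basis (?K 0) B {x0}"
      unfolding quot_basis_def
    proof (intro conjI ballI)
      show "{x0} \<subseteq> ?K 0" using x0 by simp
      show "?K 0 \<subseteq> fs.span ({x0} \<union> B)"
      proof
        fix y assume y: "y \<in> ?K 0"
        \<comment> \<open>\<open>c\<close> cancels the augmentation of \<open>y\<close>, since
          \<open>x0\<close> has augmentation one.\<close>
        define c where "c = - augmentation \<Gamma> y ()"
        have "augmentation \<Gamma> (y + fscale c x0) = 0"
          unfolding augmentation_add augmentation_scale aug by (simp add: fun_eq_iff c_def fscale_def)
        moreover have "y + fscale c x0 \<in> ?K 0"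
          by (rule fs.subspace_add[OF K y fs.subspace_scale[OF K x0]])
        ultimately have "y + fscale c x0 \<in> B" unfolding B' by blast
        then have 1: "y + fscale c x0 \<in> fs.span ({x0} \<union> B)"
          by (rule fs.span_base[OF UnI2])
        have "fscale c x0 \<in> fs.span ({x0} \<union> B)" by (rule fs.span_scale[OF fs.span_base]) simp
        then have "y + fscale c x0 - fscale c x0 \<in> fs.span ({x0} \<union> B)"
          by (rule fs.span_diff[OF 1])
        moreover have "y + fscale c x0 - fscale c x0 = y" by (rule add_diff_cancel_right')
        ultimately show "y \<in> fs.span ({x0} \<union> B)" by simp
      qed
      fix s assume "s \<in> {x0}"
      moreover have span_B: "fs.span B = B" using B by (simp only: fs.span_eq_iff)
      have "x0 \<notin> fs.span B" unfolding span_B unfolding B' using aug by (simp add: fun_eq_iff)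
      ultimately show "s \<notin> fs.span (({x0} - {s}) \<union> B)" by simp
    qed
    then have "quot_basis (?K 0) ?B {x0}" unfolding B_def .
    then show ?thesis using True by (intro exI[of _ "{x0}"]) simp
  qed
  then obtain H where H: "finite H" "quot_basis (?K 0) ?B H" "card H = (if H_exists then 1 else 0)"
    by (elim exE conjE)
  have "(\<Sum>r\<le>n. (- 1) ^ r * int (card (basis_tensor ` basis_index (r, n)))) = int (card H)"
  proof (rule euler_characteristic[where K = ?K and N = ?N and d = ?d])
    show "Vector_Spaces.linear fscale fscale ?d" by (rule linear_koszul_diff)
    show "fs.subspace (?K r)" "fs.subspace (?N r)" for r by (rule K N)+
    show "finite H" "quot_basis (?K 0) ?B H" by (rule H(1) H(2))+
    show "?N r \<subseteq> ?K r" for r using YX by blast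
    show "?d x \<in> ?K r" if "x \<in> ?K (Suc r)" for r x using that d_X d_grade by blast
    show "{x \<in> ?K (Suc r). ?d x \<in> ?N r} =
        {?d y + z |y z. y \<in> ?K (Suc (Suc r)) \<and> z \<in> ?N (Suc r)}" for r
    proof (intro equalityI subsetI)
      fix x assume "x \<in> {x \<in> ?K (Suc r). ?d x \<in> ?N r}"
      then have x: "x \<in> ?X" "x \<in> of_grade (Suc r, n)" "?d x \<in> ?Y" by auto
      \<comment> \<open>The augmentation lives in grade \<open>(0, 0)\<close> and so vanishes in
        lower weight \<open>Suc r\<close>.\<close>
      moreover have "augmentation \<Gamma> x = 0" using augmentation_of_grade[OF x(2)] by blast
      ultimately show "x \<in> {?d y + z |y z. y \<in> ?K (Suc (Suc r)) \<and> z \<in> ?N (Suc r)}"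
        by (rule graded_cycle)
    next
      fix x assume "x \<in> {?d y + z |y z. y \<in> ?K (Suc (Suc r)) \<and> z \<in> ?N (Suc r)}"
      then obtain y z where yz: "x = ?d y + z" "y \<in> ?K (Suc (Suc r))" "z \<in> ?N (Suc r)" by blast
      then have "x \<in> of_grade (Suc r, n)" using d_grade grade_add by simp
      then show "x \<in> {x \<in> ?K (Suc r). ?d x \<in> ?N r}" using boundary[of y z] yz d_grade by auto
    qed
    show "?K r = ?N r" if "r > n" for r
      unfolding of_grade_empty[OF that] using fs.subspace_0[OF X] fs.subspace_0[OF Y] by blast
    show "finite (basis_tensor ` basis_index (r, n)) \<and>
        quot_basis (?K r) (?N r) (basis_tensor ` basis_index (r, n))" if "r \<le> n" for r
      using card_basis_index(1)[OF that] quot_basis_contraction_product unfolding X_eq Y_eq by blast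
  qed
  then show ?thesis unfolding H(3) H_exists_def by (simp add: card_image[OF inj_on_basis_tensor])
qed

text \<open>In the coefficient of \<open>q^n\<close>, the substitution of \<open>-q\<close> supplies
  the signs of the Euler characteristic, and exchanging the sums over partitions and lower weights
  collects the dimension in each degree.\<close>

lemma graphic_conv_weight_series:
  "graphic_conv (weight_series_neg (koszul_dual_weight_dim E R))
    (weight_series (contractad_weight_dim E R)) \<Gamma> = graphic_unit \<Gamma>"
proof (rule fps_ext)
  fix n
  let ?D = "\<lambda>I r. card (dual_basis r (contract \<Gamma> I))"
  let ?P = "\<lambda>I. \<Prod>G\<in>I. weight_series (contractad_weight_dim E R) (induced \<Gamma> G)"
  have "fps_nth (weight_series_neg (koszul_dual_weight_dim E R) (contract \<Gamma> I)) r = (- 1) ^ r * int (?D I r)"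
    if "I \<in> graph_partitions \<Gamma>" for I r
    using dual_basis(3)[OF contract_partition_connected(1)[OF \<Gamma> that]]
    by (simp add: weight_series_neg_def weight_series_def fps_compose_uminus')
  then have "fps_nth (graphic_conv (weight_series_neg (koszul_dual_weight_dim E R))
      (weight_series (contractad_weight_dim E R)) \<Gamma>) n =
      (\<Sum>I\<in>graph_partitions \<Gamma>. \<Sum>r\<le>n. ((- 1) ^ r * int (?D I r)) * fps_nth (?P I) (n - r))"
    unfolding graphic_conv_def fps_sum_nth fps_mult_nth
    by (intro sum.cong) (auto simp: atMost_atLeast0)
  also have "\<dots> = (\<Sum>r\<le>n. (- 1) ^ r * (\<Sum>I\<in>graph_partitions \<Gamma>. int (?D I r) * fps_nth (?P I) (n - r)))"
    unfolding sum_distrib_left by (subst sum.swap) (simp add: mult.assoc)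
  also have "\<dots> = (\<Sum>r\<le>n. (- 1) ^ r * int (card (basis_index (r, n))))"
    using card_basis_index by (intro sum.cong) auto
  also have "\<dots> = fps_nth (graphic_unit \<Gamma>) n"
    unfolding koszul_euler_characteristic by (simp add: graphic_unit_def)
  finally show "fps_nth (graphic_conv (weight_series_neg (koszul_dual_weight_dim E R))
      (weight_series (contractad_weight_dim E R)) \<Gamma>) n = fps_nth (graphic_unit \<Gamma>) n" .
qed

end

end

section \<open>Binary generators and unweighted dimensions\<close>

lemma of_weight_disjoint: "x \<in> of_weight r \<Longrightarrow> x \<in> of_weight s \<Longrightarrow> r \<noteq> s \<Longrightarrow> x = 0"
  by (auto simp: of_weight_def fun_eq_iff)

lemma free_space_binary:
  assumes "generated_by_binary E" "vector_space (scl E)" "\<Gamma> \<in> connected_graphs"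
  shows "free_space E \<Gamma> \<subseteq> of_weight (card (verts \<Gamma>) - 1)"
  using decorated_binary_weight[OF _ assms(1,2)] assms(3)
  by (fastforce simp: free_space_def of_weight_def trees_def connected_graphs_def)

lemma quot_dim_zero: "quot_dim {0 :: 'x \<Rightarrow> 'k::field} {0} = 0"
proof -
  have "S = {}" if "quot_basis {0} {0} S" for S :: "('x \<Rightarrow> 'k::field) set"
    using zero_notin_quot_basis[OF that] that by (auto simp: quot_basis_def)
  moreover have "quot_basis {0} {0} ({} :: ('x \<Rightarrow> 'k::field) set)"
    by (simp add: quot_basis_def)
  ultimately have "(SOME S :: ('x \<Rightarrow> 'k::field) set. finite S \<and> quot_basis {0} {0} S) = {}"
    by (intro some_equality) auto
  then show ?thesis by (simp add: quot_dim_def)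
qed

lemma contractad_weight_dim_binary:
  assumes "generated_by_binary E" "vector_space (scl E)" "\<Gamma> \<in> connected_graphs"
  shows "contractad_weight_dim E R r \<Gamma> =
    (if r = card (verts \<Gamma>) - 1 then contractad_dim E R \<Gamma> else 0)"
proof -
  note F = free_space_binary[OF assms]
  have zero: "0 \<in> free_space E \<Gamma>" "0 \<in> relation_ideal E R \<Gamma>" "0 \<in> of_weight r"
    using graded_space_free_space[of E \<Gamma>] graded_space_relation_ideal[OF assms(3), of E R]
      subspace_of_weight fs.subspace_0 by (auto simp: graded_space_def)
  show ?thesis
  proof (cases "r = card (verts \<Gamma>) - 1")
    case True
    then have "free_space E \<Gamma> \<inter> of_weight r = free_space E \<Gamma>"
      "relation_ideal E R \<Gamma> \<inter> of_weight r = relation_ideal E R \<Gamma>"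
      using F relation_ideal_subset[of E R \<Gamma>] by auto
    then show ?thesis using True by (simp add: contractad_weight_dim_def contractad_dim_def)
  next
    case False
    have "free_space E \<Gamma> \<inter> of_weight r = {0}"
      using F zero of_weight_disjoint[OF _ _ False] by blast
    moreover have "relation_ideal E R \<Gamma> \<inter> of_weight r = {0}"
      using calculation zero relation_ideal_subset[of E R \<Gamma>] by blast
    ultimately show ?thesis using False by (simp add: contractad_weight_dim_def quot_dim_zero)
  qed
qed

lemma koszul_dual_weight_dim_binary:
  fixes E :: "('k::field, 'e::ab_group_add) collection"
  assumes "generated_by_binary E" "vector_space (scl E)" "\<Gamma> \<in> connected_graphs"
  shows "koszul_dual_weight_dim E R r \<Gamma> =
    (if r = card (verts \<Gamma>) - 1 then koszul_dual_dim E R \<Gamma> else 0)"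
proof -
  let ?m = "card (verts \<Gamma>) - 1"
  \<comment> \<open>Suspension shifts degrees and leaves the supporting graphs alone, so the
    cogenerators are binary as well.\<close>
  have "generated_by_binary (suspension E)" "vector_space (scl (suspension E))"
    using assms(1,2) by (auto simp: generated_by_binary_def suspension_def)
  then have C: "koszul_dual_co E R \<Gamma> \<subseteq> of_weight ?m"
    using koszul_dual_co_subset[OF assms(3), of E R] free_space_binary[OF _ _ assms(3), of "suspension E"]
    by blast
  have zero: "koszul_dual_weight E R s \<Gamma> \<subseteq> {0}" if s: "s \<noteq> ?m" for s
  proof
    fix \<phi> assume \<phi>: "\<phi> \<in> koszul_dual_weight E R s \<Gamma>"
    have "\<phi> (l, x) = 0" for l x
    proof (rule ccontr)
      assume nz: "\<phi> (l, x) \<noteq> 0"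
      then have x: "x \<in> koszul_dual_co E R \<Gamma> \<inter> of_weight s"
        using \<phi> by (simp add: koszul_dual_weight_def Let_def)
      then have "x = 0" using C of_weight_disjoint[OF _ _ s] by blast
      \<comment> \<open>The only possible argument is zero, where linearity forces the value
        zero.\<close>
      moreover have "\<phi> (l, fscale 0 x) = 0 * \<phi> (l, x)"
        using \<phi> x unfolding koszul_dual_weight_def Let_def by blast
      ultimately show False using nz by simp
    qed
    then show "\<phi> \<in> {0}" by (auto simp: fun_eq_iff)
  qed
  show ?thesis
  proof (cases "r = ?m")
    case True
    have "koszul_dual_weight E R ?m \<Gamma> \<subseteq> (\<Union>s. koszul_dual_weight E R s \<Gamma>)" by blast
    \<comment> \<open>Other weights contribute at most the zero function, which does not enlarge the
      span.\<close>
    moreover have "(\<Union>s. koszul_dual_weight E R s \<Gamma>) \<subseteq> insert 0 (koszul_dual_weight E R ?m \<Gamma>)"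
    proof (rule UN_least)
      fix s
      show "koszul_dual_weight E R s \<Gamma> \<subseteq> insert 0 (koszul_dual_weight E R ?m \<Gamma>)"
        using zero[of s] by (cases "s = ?m") auto
    qed
    ultimately have "koszul_dual E R \<Gamma> = fs.span (koszul_dual_weight E R ?m \<Gamma>)"
      unfolding koszul_dual_def by (metis fs.span_mono fs.span_insert_0 subset_antisym)
    then show ?thesis using True by (simp add: koszul_dual_weight_dim_def koszul_dual_dim_def)
  next
    case False
    have "fs.dim (koszul_dual_weight E R r \<Gamma>) \<le> card ({} :: (nat list \<times> ('e tree \<Rightarrow> 'k) \<Rightarrow> 'k) set)"
      using zero[OF False] by (intro fs.dim_le_card) auto
    then show ?thesis using False by (simp add: koszul_dual_weight_dim_def)
  qed
qed

lemma weight_series_single: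
  assumes "\<And>r. dm r \<Gamma> = (if r = m then b else 0)"
  shows "weight_series dm \<Gamma> = fps_const (int b) * fps_X ^ m"
    "weight_series_neg dm \<Gamma> = fps_const ((- 1) ^ m * int b) * fps_X ^ m"
  by (rule fps_ext, simp add: weight_series_neg_def weight_series_def fps_compose_uminus' assms
      fps_X_power_nth)+

lemma prod_fps_monomial:
  fixes b :: "'i \<Rightarrow> int"
  shows "(\<Prod>i\<in>I. fps_const (b i) * fps_X ^ m i) = fps_const (\<Prod>i\<in>I. b i) * fps_X ^ (\<Sum>i\<in>I. m i)"
proof -
  have "(\<Prod>i\<in>I. fps_const (b i)) = fps_const (\<Prod>i\<in>I. b i)"
    by (induction I rule: infinite_finite_induct) simp_all
  then show ?thesis by (simp add: prod.distrib power_sum)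
qed

text \<open>This makes the exponent of \<open>q\<close> in the summands of the binary case
  independent of the partition. \<open>I\<close> and its blocks are non-empty, so the truncated
  subtractions are exact.\<close>

lemma sum_card_blocks:
  assumes \<Gamma>: "\<Gamma> \<in> connected_graphs" and I: "I \<in> graph_partitions \<Gamma>"
  shows "(card I - 1) + (\<Sum>G\<in>I. card G - 1) = card (verts \<Gamma>) - 1"
proof -
  have P: "partition_on (verts \<Gamma>) I" using I by (simp add: graph_partitions_def)
  note fin = finite_verts_connected[OF \<Gamma>]
  have finI: "finite I" by (rule finite_blocks[OF fin P])
  have block: "finite G \<and> G \<noteq> {}" if "G \<in> I" for G
    using that P finite_subset[OF _ fin, of G] by (auto simp: partition_on_def)
  have "verts \<Gamma> \<noteq> {}" using \<Gamma> by (simp add: connected_graphs_def tube_def)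
  then have "I \<noteq> {}" using P by (auto simp: partition_on_def)
  then have "card I > 0" using finI by (simp add: card_gt_0_iff)
  have "card (verts \<Gamma>) = (\<Sum>G\<in>I. card G)"
    using P block card_Union_disjoint[of I] by (auto simp: partition_on_def disjoint_def pairwise_def disjnt_def)
  also have "\<dots> = (\<Sum>G\<in>I. (card G - 1) + 1)"
    using block by (intro sum.cong) (auto simp: Suc_leI card_gt_0_iff)
  also have "\<dots> = (\<Sum>G\<in>I. card G - 1) + card I" by (simp only: sum.distrib) simp
  finally show ?thesis using \<open>card I > 0\<close> by simp
qed

lemma dim_unit_space:
  "fs.dim (unit_space \<Gamma> :: (unit \<Rightarrow> 'k::field) set) = (if card (verts \<Gamma>) = 1 then 1 else 0)"
proof (cases "card (verts \<Gamma>) = 1")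
  case True
  let ?b = "\<lambda>_::unit. 1::'k"
  have "x = fscale (x ()) ?b" for x by (simp add: fscale_def fun_eq_iff)
  then have "UNIV \<subseteq> fs.span {?b}" by (metis fs.span_base fs.span_scale singletonI subsetI)
  moreover have "?b \<noteq> 0" by (simp add: fun_eq_iff)
  ultimately have "card {?b} = fs.dim (UNIV :: (unit \<Rightarrow> 'k) set)"
    by (intro fs.basis_card_eq_dim) auto
  then show ?thesis using True by (simp add: unit_space_def)
next
  case False
  have "fs.dim {0 :: unit \<Rightarrow> 'k} \<le> card ({} :: (unit \<Rightarrow> 'k) set)" by (intro fs.dim_le_card) auto
  then show ?thesis using False by (simp add: unit_space_def)
qed

theorem theorem2p1p8:
  fixes E :: "('k::field, 'e::ab_group_add) collection"
    and R :: "graph \<Rightarrow> ('e tree \<Rightarrow> 'k) set"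
  assumes "quadratic_data E R"
    and "\<And>\<Gamma> r. \<Gamma> \<in> connected_graphs \<Longrightarrow> contractad_finite E R r \<Gamma>"
    and "\<And>\<Gamma> r. \<Gamma> \<in> connected_graphs \<Longrightarrow> finite_dim (koszul_dual_weight E R r \<Gamma>)"
    and "koszul E R"
  shows "(\<forall>\<Gamma>\<in>connected_graphs.
      graphic_conv (weight_series_neg (koszul_dual_weight_dim E R))
          (weight_series (contractad_weight_dim E R)) \<Gamma> =
        of_nat (vector_space.dim fscale (unit_space \<Gamma> :: (unit \<Rightarrow> 'k) set)) \<and>
      of_nat (vector_space.dim fscale (unit_space \<Gamma> :: (unit \<Rightarrow> 'k) set)) =
        (graphic_unit \<Gamma> :: int fps)) \<and>
    (generated_by_binary E \<longrightarrow> (\<forall>\<Gamma>\<in>connected_graphs.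
      graphic_conv (\<lambda>\<Gamma>. (- 1) ^ (card (verts \<Gamma>) - 1) * int (koszul_dual_dim E R \<Gamma>))
          (\<lambda>\<Gamma>. int (contractad_dim E R \<Gamma>)) \<Gamma> = graphic_unit \<Gamma>))"
proof -
  interpret koszul_data E R using assms(2-4) by unfold_locales
  have E: "vector_space (scl E)" using assms(1) by (simp add: quadratic_data_def graphical_collection_def)
  have unit: "of_nat (fs.dim (unit_space \<Gamma> :: (unit \<Rightarrow> 'k) set)) = (graphic_unit \<Gamma> :: int fps)" for \<Gamma>
    unfolding dim_unit_space by (simp add: graphic_unit_def)
  have binary: "graphic_conv (\<lambda>\<Gamma>. (- 1) ^ (card (verts \<Gamma>) - 1) * int (koszul_dual_dim E R \<Gamma>))
      (\<lambda>\<Gamma>. int (contractad_dim E R \<Gamma>)) \<Gamma> = graphic_unit \<Gamma>"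
    if bin: "generated_by_binary E" and \<Gamma>: "\<Gamma> \<in> connected_graphs" for \<Gamma>
  proof -
    let ?m = "card (verts \<Gamma>) - 1"
    let ?a = "\<lambda>I. (- 1) ^ (card (verts (contract \<Gamma> I)) - 1) * int (koszul_dual_dim E R (contract \<Gamma> I))"
    let ?b = "\<lambda>G. int (contractad_dim E R (induced \<Gamma> G))"
    \<comment> \<open>Each factor is a monomial, and by \<open>sum_card_blocks\<close> all summands
      of the convolution share the exponent \<open>?m\<close>; a single coefficient therefore
      carries the whole identity.\<close>
    have summand: "weight_series_neg (koszul_dual_weight_dim E R) (contract \<Gamma> I) *
        (\<Prod>G\<in>I. weight_series (contractad_weight_dim E R) (induced \<Gamma> G)) =
        fps_const (?a I * (\<Prod>G\<in>I. ?b G)) * fps_X ^ ?m"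
      if I: "I \<in> graph_partitions \<Gamma>" for I
    proof -
      note conn = contract_partition_connected[OF \<Gamma> I]
      have neg: "weight_series_neg (koszul_dual_weight_dim E R) (contract \<Gamma> I) =
          fps_const (?a I) * fps_X ^ (card I - 1)"
        using weight_series_single(2)[where dm = "koszul_dual_weight_dim E R",
            OF koszul_dual_weight_dim_binary[OF bin E conn(1)]]
        by (simp add: conn(2))
      have "weight_series (contractad_weight_dim E R) (induced \<Gamma> G) = fps_const (?b G) * fps_X ^ (card G - 1)"
        if "G \<in> I" for G
        using weight_series_single(1)[where dm = "contractad_weight_dim E R",
            OF contractad_weight_dim_binary[OF bin E block_connected[OF \<Gamma> I that]]]
        by (simp add: induced_def)
      then have "(\<Prod>G\<in>I. weight_series (contractad_weight_dim E R) (induced \<Gamma> G)) =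
          (\<Prod>G\<in>I. fps_const (?b G) * fps_X ^ (card G - 1))"
        by (intro prod.cong) auto
      also have "\<dots> = fps_const (\<Prod>G\<in>I. ?b G) * fps_X ^ (\<Sum>G\<in>I. card G - 1)"
        by (rule prod_fps_monomial)
      finally have pos: "(\<Prod>G\<in>I. weight_series (contractad_weight_dim E R) (induced \<Gamma> G)) =
          fps_const (\<Prod>G\<in>I. ?b G) * fps_X ^ (\<Sum>G\<in>I. card G - 1)" .
      show ?thesis
        unfolding neg pos sum_card_blocks[OF \<Gamma> I, symmetric] power_add
        by (simp only: fps_const_mult[symmetric] mult_ac)
    qed
    have "graphic_conv (weight_series_neg (koszul_dual_weight_dim E R))
          (weight_series (contractad_weight_dim E R)) \<Gamma> =
        (\<Sum>I\<in>graph_partitions \<Gamma>. fps_const (?a I * (\<Prod>G\<in>I. ?b G)) * fps_X ^ ?m)"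
      unfolding graphic_conv_def using summand by (intro sum.cong) auto
    then have "fps_nth (graphic_unit \<Gamma>) ?m = (\<Sum>I\<in>graph_partitions \<Gamma>. ?a I * (\<Prod>G\<in>I. ?b G))"
      unfolding graphic_conv_weight_series[OF \<Gamma>] by (simp add: fps_sum_nth fps_X_power_nth)
    \<comment> \<open>The unit has the right coefficient at \<open>?m\<close>: for one vertex
      \<open>?m\<close> is zero and the coefficient is one, and for more vertices the unit
      vanishes.\<close>
    then show ?thesis by (simp add: graphic_conv_def graphic_unit_def split: if_splits)
  qed
  show ?thesis
    using graphic_conv_weight_series unit binary by simp
qed

end
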